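(* Let $\mathbb H$ be a graded affine Hecke algebra, $\Pi_M\subset\Pi$, and let $\sigma=\sigma_0\otimes\mathbb C_\nu$ be a (finite dimensional) $\mathbb H_M$-module on a space $U_\sigma$, where $\sigma_0$ is an $\mathbb H_M^0$-module and $\nu\in(V_M^{\vee,\perp})_{\mathbb C}$, and suppose $\sigma$ has a $\bullet$-invariant hermitian form $\langle\ ,\ \rangle_{\sigma,\bullet}$. Write $\widetilde M=\delta(M)$, $w^0=w^0_M$, $R^0=R_{w^0_M}$. Then the ($\bullet$-invariant sesquilinear) form $$\langle h_1\otimes v_1,h_2\otimes v_2\rangle_\bullet=\big\langle a\sigma\big[\epsilon_{\widetilde M}(t_{(w^0)^{-1}}\,h_2^\bullet\, h_1\, R^0)\big]v_1,\,v_2\big\rangle_{\sigma,\bullet}\qquad(h_1,h_2\in\mathbb H,\ v_1,v_2\in U_\sigma)$$ on $X(M,\sigma)=\mathbb H\otimes_{\mathbb H_M}U_\sigma$ is hermitian, and therefore it gives a $\bullet$-invariant hermitian form on the induced module $X(M,\sigma)$.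
   Context: Root data and algebra: $V,V^\vee$ are finite dimensional real vector spaces with a perfect pairing; $R\subset V$, $R^\vee\subset V^\vee$ form a reduced root system with Weyl group $W$, simple roots $\Pi$, positive roots $R^+$; $k:\Pi\to\mathbb R$ is constant on $W$-conjugate simple roots. $V_{\mathbb C}$ is the complexification of $V$ with conjugation $\bar{\ }$. The graded affine Hecke algebra $\mathbb H$ is the unital associative $\mathbb C$-algebra generated by $S(V_{\mathbb C})$ and $\{t_w:w\in W\}$ such that $w\otimes a\mapsto t_wa$ is an isomorphism $\mathbb C[W]\otimes S(V_{\mathbb C})\cong\mathbb H$ of $(\mathbb C[W],S(V_{\mathbb C}))$-bimodules and $a\,t_{s_\alpha}=t_{s_\alpha}s_\alpha(a)+k_\alpha\frac{a-s_\alpha(a)}{\alpha}$ for $\alpha\in\Pi$, $a\in S(V_{\mathbb C})$. The star operation $\bullet$ is the conjugate-linear anti-automorphism with $t_w^\bullet=t_{w^{-1}}$, $\omega^\bullet=\overline\omega$ ($\omega\in V_{\mathbb C}$). A form on a module $(\pi,X)$ is $\bullet$-invariant if $\langle\pi(h)x,y\rangle=\langle x,\pi(h^\bullet)y\rangle$ for all $h$. Parabolic subalgebras: for $\Pi_M\subset\Pi$, $W_M$ is generated by $s_\alpha$, $\alpha\in\Pi_M$, with longest element $w_{0,M}$; $\mathbb H_M$ is the subalgebra generated by $t_w$ ($w\in W_M$) and $S(V_{\mathbb C})$ (stable under $\bullet$). $R_M$ is the set of roots spanned by $\Pi_M$; $V_M$, $V_M^\vee$ are the real spans of $R_M$, $R_M^\vee$;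 $V_M^\perp=\{v\in V:(v,\alpha^\vee)=0\ \forall\alpha\in R_M\}$, $V_M^{\vee,\perp}=\{v^\vee\in V^\vee:(\alpha,v^\vee)=0\ \forall\alpha\in R_M\}$. $\mathbb H_M^0$ is the graded affine Hecke algebra of $(V_M,R_M,V_M^\vee,R_M^\vee)$ with restricted parameters, $\mathbb H_M=\mathbb H_M^0\otimes S((V_M^\perp)_{\mathbb C})$, and $S((V_M^\perp)_{\mathbb C})$ acts on $\mathbb C_\nu$ by $\nu$. $\mathcal J_M$ is the set of minimal length representatives of $W/W_M$. Every $h\in\mathbb H$ is uniquely $h=\sum_{w\in\mathcal J_M}t_wm_w$, $m_w\in\mathbb H_M$, and $\epsilon_M(h):=m_1$; the same formula is used for elements with rational coefficients. With $w_0$ the longest element of $W$, $\delta(\alpha)=-w_0(\alpha)$, $\Pi_{\delta(M)}=\delta(\Pi_M)$, $w^0_M=w_0w_{0,\delta(M)}=w_{0,M}w_0$. Transfer: $\phi(t_m)=t_{(w^0_M)^{-1}mw^0_M}$ ($m\in W_M$), $\phi(\omega)=(w^0_M)^{-1}(\omega)$ ($\omega\in V_{\mathbb C}$) defines an isomorphism $\mathbb H_M\to\mathbb H_{\delta(M)}$; the $\mathbb H_{\delta(M)}$-module $a\sigma$ is $U_{a\sigma}=U_\sigma$ with $(a\sigma)(m')=\sigma(\phi^{-1}(m'))$. Elements $R_w$: in $\hat{\mathbb H}=\mathbb H\otimes_{S(V_{\mathbb C})}\mathcal O$, where $\mathcal O$ is the ring of rational functions (the fraction field of $S(V_{\mathbb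 C})$), put $R_{s_\alpha}=t_{s_\alpha}\frac{\alpha}{k_\alpha-\alpha}-\frac{k_\alpha}{k_\alpha-\alpha}$ ($\alpha\in\Pi$) and $R_x=R_{s_{\alpha_1}}\cdots R_{s_{\alpha_k}}$ for a reduced expression $x=s_{\alpha_1}\cdots s_{\alpha_k}$ (independent of the choice).
   Formalization: The formula has poles (rank one, M empty, ν(α) = -k_α ≠ 0), so it is assumed that R^0 has a denominator in S(V_C) acting invertibly in aσ; this is the condition for the displayed form to be defined for all h_1, h_2. *)

theory Defs
  imports Complex_Main "HOL-Library.Poly_Mapping"
    "HOL-Computational_Algebra.Polynomial" "HOL-Computational_Algebra.Fraction_Field"
begin

section \<open>The symmetric algebra of \<open>V\<^sub>\<complex>\<close>\<close>

text \<open>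
  \<open>S(V\<^sub>\<complex>)\<close> is realised as the algebra of complex valued polynomial functions on the real space
  \<open>V\<^sup>\<or>\<close>: since the pairing is perfect, \<open>V\<close> is the space of all real linear functionals on \<open>V\<^sup>\<or>\<close>, and
  \<open>V\<^sub>\<complex>\<close> is the space of their complex combinations. It is an integral domain, so its field of
  fractions, the field of rational functions, is the library type constructor \<open>fract\<close>.
\<close>

inductive_set poly_functions :: "('w::real_vector \<Rightarrow> complex) set" where
  const: "(\<lambda>_. c) \<in> poly_functions"
| functional: "linear f \<Longrightarrow> (\<lambda>\<xi>. complex_of_real (f \<xi>)) \<in> poly_functions"
| add: "p \<in> poly_functions \<Longrightarrow> q \<in> poly_functions \<Longrightarrow> (\<lambda>\<xi>. p \<xi> + q \<xi>) \<in> poly_functions"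
| mult: "p \<in> poly_functions \<Longrightarrow> q \<in> poly_functions \<Longrightarrow> (\<lambda>\<xi>. p \<xi> * q \<xi>) \<in> poly_functions"

typedef (overloaded) 'w polyfun = "poly_functions :: ('w::real_vector \<Rightarrow> complex) set"
  morphisms peval Abs_polyfun
  using poly_functions.const by blast

setup_lifting type_definition_polyfun

lemma poly_functions_uminus:
  assumes "p \<in> poly_functions" shows "(\<lambda>\<xi>. - p \<xi>) \<in> poly_functions"
  using poly_functions.mult[OF poly_functions.const[of "-1"] assms] by simp

lemma poly_functions_diff:
  assumes "p \<in> poly_functions" "q \<in> poly_functions" shows "(\<lambda>\<xi>. p \<xi> - q \<xi>) \<in> poly_functions"
  using poly_functions.add[OF assms(1) poly_functions_uminus[OF assms(2)]] by simp

lemma poly_functions_cnj: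
  "p \<in> poly_functions \<Longrightarrow> (\<lambda>\<xi>. cnj (p \<xi>)) \<in> poly_functions"
  by (induction rule: poly_functions.induct) (auto intro: poly_functions.intros)

lemma poly_functions_comp_linear:
  "p \<in> poly_functions \<Longrightarrow> linear g \<Longrightarrow> (\<lambda>\<xi>. p (g \<xi>)) \<in> poly_functions"
proof (induction rule: poly_functions.induct)
  case (functional f)
  have "linear (f \<circ> g)" using functional by (rule linear_compose[rotated])
  then show ?case using poly_functions.functional[of "f \<circ> g"] by (simp add: o_def)
qed (auto intro: poly_functions.intros)

lemma poly_functions_line:
  assumes "p \<in> poly_functions"
  shows "\<exists>P. \<forall>s::real. p (x + s *\<^sub>R y) = poly P (complex_of_real s)"
  using assms
proof (induction rule: poly_functions.induct)
  case (const c)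
  show ?case by (rule exI[of _ "[:c:]"]) simp
next
  case (functional f)
  show ?case
    by (rule exI[of _ "[:complex_of_real (f x), complex_of_real (f y):]"])
      (simp add: linear_add[OF functional] linear_scale[OF functional])
next
  case (add p q)
  then obtain P Q where "\<forall>s::real. p (x + s *\<^sub>R y) = poly P (complex_of_real s)"
    "\<forall>s::real. q (x + s *\<^sub>R y) = poly Q (complex_of_real s)" by blast
  then show ?case by (intro exI[of _ "P + Q"]) simp
next
  case (mult p q)
  then obtain P Q where "\<forall>s::real. p (x + s *\<^sub>R y) = poly P (complex_of_real s)"
    "\<forall>s::real. q (x + s *\<^sub>R y) = poly Q (complex_of_real s)" by blast
  then show ?case by (intro exI[of _ "P * Q"]) simp
qed

lemma poly_functions_no_zero_divisors:
  assumes p: "p \<in> poly_functions" and q: "q \<in> poly_functions"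
    and "p x \<noteq> 0" "q y \<noteq> 0"
  shows "\<exists>z. p z * q z \<noteq> 0"
proof (rule ccontr)
  assume "\<not> ?thesis"
  then have z: "p z * q z = 0" for z by blast
  obtain P where P: "\<And>s::real. p (x + s *\<^sub>R (y - x)) = poly P (complex_of_real s)"
    using poly_functions_line[OF p] by blast
  obtain Q where Q: "\<And>s::real. q (x + s *\<^sub>R (y - x)) = poly Q (complex_of_real s)"
    using poly_functions_line[OF q] by blast
  have "poly (P * Q) (complex_of_real s) = 0" for s
    using z[of "x + s *\<^sub>R (y - x)"] unfolding P Q poly_mult .
  then have "range complex_of_real \<subseteq> {c. poly (P * Q) c = 0}" by blast
  moreover have "infinite (range complex_of_real)"
    using infinite_UNIV_char_0 inj_of_real by (metis finite_imageD)
  ultimately have "P * Q = 0" using poly_roots_finite[of "P * Q"] finite_subset by blast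
  then have "P = 0 \<or> Q = 0" by simp
  then show False using P[of 0] Q[of 1] assms by auto
qed

instantiation polyfun :: (real_vector) idom
begin

lift_definition zero_polyfun :: "'a polyfun" is "\<lambda>_. 0" by (rule poly_functions.const)
lift_definition one_polyfun :: "'a polyfun" is "\<lambda>_. 1" by (rule poly_functions.const)
lift_definition plus_polyfun :: "'a polyfun \<Rightarrow> 'a polyfun \<Rightarrow> 'a polyfun"
  is "\<lambda>p q \<xi>. p \<xi> + q \<xi>" by (rule poly_functions.add)
lift_definition times_polyfun :: "'a polyfun \<Rightarrow> 'a polyfun \<Rightarrow> 'a polyfun"
  is "\<lambda>p q \<xi>. p \<xi> * q \<xi>" by (rule poly_functions.mult)
lift_definition uminus_polyfun :: "'a polyfun \<Rightarrow> 'a polyfun"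
  is "\<lambda>p \<xi>. - p \<xi>" by (rule poly_functions_uminus)
lift_definition minus_polyfun :: "'a polyfun \<Rightarrow> 'a polyfun \<Rightarrow> 'a polyfun"
  is "\<lambda>p q \<xi>. p \<xi> - q \<xi>" by (rule poly_functions_diff)

instance
proof
  fix a b :: "'a polyfun"
  assume "a \<noteq> 0" "b \<noteq> 0"
  then show "a * b \<noteq> 0"
    by transfer (metis poly_functions_no_zero_divisors)
qed (transfer; simp add: fun_eq_iff algebra_simps)+

end

lift_definition pconst :: "complex \<Rightarrow> 'w::real_vector polyfun" is "\<lambda>c _. c"
  by (rule poly_functions.const)

lift_definition pcnj :: "'w::real_vector polyfun \<Rightarrow> 'w polyfun" is "\<lambda>p \<xi>. cnj (p \<xi>)"
  by (rule poly_functions_cnj)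


section \<open>Root systems and Weyl groups\<close>

record ('v, 'w) root_datum =
  pairing :: "'v \<Rightarrow> 'w \<Rightarrow> real"
  roots :: "'v set"
  coroots :: "'w set"
  coroot :: "'v \<Rightarrow> 'w"
  simples :: "'v set"

definition root_refl :: "('v::real_vector, 'w, 'z) root_datum_scheme \<Rightarrow> 'v \<Rightarrow> 'v \<Rightarrow> 'v" where
  "root_refl D \<alpha> x = x - pairing D x (coroot D \<alpha>) *\<^sub>R \<alpha>"

definition coroot_refl :: "('v, 'w::real_vector, 'z) root_datum_scheme \<Rightarrow> 'v \<Rightarrow> 'w \<Rightarrow> 'w" where
  "coroot_refl D \<alpha> \<xi> = \<xi> - pairing D \<alpha> \<xi> *\<^sub>R coroot D \<alpha>"

text \<open>
  The root system is a real one: no integrality of the numbers \<open>(\<alpha>, \<beta>\<^sup>\<or>)\<close> is imposed, and the roots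
  need not span.
\<close>

locale reduced_root_datum =
  fixes D :: "('v::real_vector, 'w::real_vector, 'z) root_datum_scheme" (structure)
  assumes finite_dim_V: "\<exists>B::'v set. finite B \<and> span B = UNIV"
    and finite_dim_V_dual: "\<exists>B::'w set. finite B \<and> span B = UNIV"
    and pairing_linear: "linear (\<lambda>x. pairing D x \<xi>)" "linear (\<lambda>\<xi>. pairing D x \<xi>)"
    and pairing_nondegenerate:
      "(\<forall>\<xi>. pairing D x \<xi> = 0) \<Longrightarrow> x = 0" "(\<forall>x. pairing D x \<xi> = 0) \<Longrightarrow> \<xi> = 0"
    and roots_finite: "finite (roots D)"
    and coroot_bij: "bij_betw (coroot D) (roots D) (coroots D)"
    and pairing_root_coroot: "\<alpha> \<in> roots D \<Longrightarrow> pairing D \<alpha> (coroot D \<alpha>) = 2"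
    and refl_roots: "\<alpha> \<in> roots D \<Longrightarrow> root_refl D \<alpha> ` roots D = roots D"
    and corefl_coroots: "\<alpha> \<in> roots D \<Longrightarrow> coroot_refl D \<alpha> ` coroots D = coroots D"
    and reduced: "\<alpha> \<in> roots D \<Longrightarrow> c *\<^sub>R \<alpha> \<in> roots D \<Longrightarrow> c = 1 \<or> c = - 1"
    and simples_roots: "simples D \<subseteq> roots D"
    and simples_independent: "independent (simples D)"
    and simples_base: "\<alpha> \<in> roots D \<Longrightarrow>
      \<exists>c. \<alpha> = (\<Sum>\<beta>\<in>simples D. c \<beta> *\<^sub>R \<beta>) \<and>
          ((\<forall>\<beta>\<in>simples D. 0 \<le> c \<beta>) \<or> (\<forall>\<beta>\<in>simples D. c \<beta> \<le> 0))"

text \<open>Weyl group elements are represented by the linear maps by which they act on \<open>V\<close>.\<close>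

inductive_set refl_group :: "('v::real_vector, 'w, 'z) root_datum_scheme \<Rightarrow> 'v set \<Rightarrow> ('v \<Rightarrow> 'v) set"
  for D A where
  one: "id \<in> refl_group D A"
| step: "\<alpha> \<in> A \<Longrightarrow> w \<in> refl_group D A \<Longrightarrow> root_refl D \<alpha> \<circ> w \<in> refl_group D A"

definition weyl :: "('v::real_vector, 'w, 'z) root_datum_scheme \<Rightarrow> ('v \<Rightarrow> 'v) set" where
  "weyl D = refl_group D (roots D)"

definition refl_word :: "('v::real_vector, 'w, 'z) root_datum_scheme \<Rightarrow> 'v list \<Rightarrow> 'v \<Rightarrow> 'v" where
  "refl_word D \<alpha>s = foldr (\<lambda>\<alpha> w. root_refl D \<alpha> \<circ> w) \<alpha>s id"

definition wlength :: "('v::real_vector, 'w, 'z) root_datum_scheme \<Rightarrow> ('v \<Rightarrow> 'v) \<Rightarrow> nat" where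
  "wlength D w = (LEAST n. \<exists>\<alpha>s. set \<alpha>s \<subseteq> simples D \<and> length \<alpha>s = n \<and> refl_word D \<alpha>s = w)"

definition reduced_expression ::
    "('v::real_vector, 'w, 'z) root_datum_scheme \<Rightarrow> ('v \<Rightarrow> 'v) \<Rightarrow> 'v list \<Rightarrow> bool" where
  "reduced_expression D w \<alpha>s \<longleftrightarrow>
     set \<alpha>s \<subseteq> simples D \<and> refl_word D \<alpha>s = w \<and> length \<alpha>s = wlength D w"

definition longest :: "('v::real_vector, 'w, 'z) root_datum_scheme \<Rightarrow> ('v \<Rightarrow> 'v) set \<Rightarrow> 'v \<Rightarrow> 'v" where
  "longest D G = (THE w. w \<in> G \<and> (\<forall>u\<in>G. wlength D u \<le> wlength D w))"

text \<open>The minimal length representatives \<open>\<J>\<^sub>M\<close> of \<open>W/W\<^sub>M\<close>; the set \<open>\<Pi>\<^sub>M\<close> is written \<open>M\<close>.\<close>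

definition min_reps :: "('v::real_vector, 'w, 'z) root_datum_scheme \<Rightarrow> 'v set \<Rightarrow> ('v \<Rightarrow> 'v) set" where
  "min_reps D M = {w \<in> weyl D. \<forall>u\<in>refl_group D M. wlength D w \<le> wlength D (w \<circ> u)}"

definition delta :: "('v::real_vector, 'w, 'z) root_datum_scheme \<Rightarrow> 'v \<Rightarrow> 'v" where
  "delta D \<alpha> = - longest D (weyl D) \<alpha>"

definition w0M :: "('v::real_vector, 'w, 'z) root_datum_scheme \<Rightarrow> 'v set \<Rightarrow> 'v \<Rightarrow> 'v" where
  "w0M D M = longest D (weyl D) \<circ> longest D (refl_group D (delta D ` M))"

definition levi_roots :: "('v::real_vector, 'w, 'z) root_datum_scheme \<Rightarrow> 'v set \<Rightarrow> 'v set" where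
  "levi_roots D M = roots D \<inter> span M"

definition levi_V :: "('v::real_vector, 'w, 'z) root_datum_scheme \<Rightarrow> 'v set \<Rightarrow> 'v set" where
  "levi_V D M = span (levi_roots D M)"

definition levi_V_perp :: "('v::real_vector, 'w, 'z) root_datum_scheme \<Rightarrow> 'v set \<Rightarrow> 'v set" where
  "levi_V_perp D M = {x. \<forall>\<alpha>\<in>levi_roots D M. pairing D x (coroot D \<alpha>) = 0}"

definition levi_V_dual_perp :: "('v::real_vector, 'w, 'z) root_datum_scheme \<Rightarrow> 'v set \<Rightarrow> 'w set" where
  "levi_V_dual_perp D M = {\<xi>. \<forall>\<alpha>\<in>levi_roots D M. pairing D \<alpha> \<xi> = 0}"


section \<open>The action of \<open>W\<close> on \<open>S(V\<^sub>\<complex>)\<close>\<close>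

definition lin :: "('v, 'w::real_vector, 'z) root_datum_scheme \<Rightarrow> 'v \<Rightarrow> 'w polyfun" where
  "lin D x = Abs_polyfun (\<lambda>\<xi>. complex_of_real (pairing D x \<xi>))"

text \<open>The element \<open>x + \<i>y\<close> of \<open>V\<^sub>\<complex>\<close>.\<close>

definition clin :: "('v, 'w::real_vector, 'z) root_datum_scheme \<Rightarrow> 'v \<Rightarrow> 'v \<Rightarrow> 'w polyfun" where
  "clin D x y = lin D x + pconst \<i> * lin D y"

text \<open>
  The transpose of \<open>w\<close> on \<open>V\<^sup>\<or>\<close> (the contragredient action of \<open>w\<^sup>-\<^sup>1\<close>); composing with it is the
  automorphism of \<open>S(V\<^sub>\<complex>)\<close> that extends \<open>w\<close>, see \<open>wact_lin\<close> below.
\<close>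

definition wtranspose :: "('v, 'w, 'z) root_datum_scheme \<Rightarrow> ('v \<Rightarrow> 'v) \<Rightarrow> 'w \<Rightarrow> 'w" where
  "wtranspose D w \<xi> = (THE \<eta>. \<forall>x. pairing D x \<eta> = pairing D (w x) \<xi>)"

definition wact ::
    "('v, 'w::real_vector, 'z) root_datum_scheme \<Rightarrow> ('v \<Rightarrow> 'v) \<Rightarrow> 'w polyfun \<Rightarrow> 'w polyfun" where
  "wact D w p = Abs_polyfun (\<lambda>\<xi>. peval p (wtranspose D w \<xi>))"


section \<open>Graded affine Hecke algebras\<close>

text \<open>
  \<open>tw w\<close> is \<open>t\<^sub>w\<close> and \<open>sym\<close> is the embedding of \<open>S(V\<^sub>\<complex>)\<close>. The algebra is a type; its complex
  structure is the one given by \<open>sym\<close> on constants, which the relations make central.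
\<close>

record (overloaded) ('v, 'w::real_vector, 'h) hecke = "('v, 'w) root_datum" +
  param :: "'v \<Rightarrow> real"
  tw :: "('v \<Rightarrow> 'v) \<Rightarrow> 'h"
  sym :: "'w polyfun \<Rightarrow> 'h"

definition hscale :: "('v, 'w::real_vector, 'h::ring_1, 'z) hecke_scheme \<Rightarrow> complex \<Rightarrow> 'h \<Rightarrow> 'h" where
  "hscale H c h = sym H (pconst c) * h"

locale graded_hecke_algebra = reduced_root_datum H
  for H :: "('v::real_vector, 'w::real_vector, 'h::ring_1, 'z) hecke_scheme" (structure) +
  assumes param_conjugate:
      "\<alpha> \<in> simples H \<Longrightarrow> \<beta> \<in> simples H \<Longrightarrow> w \<in> weyl H \<Longrightarrow> w \<alpha> = \<beta> \<Longrightarrow> param H \<alpha> = param H \<beta>"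
    and tw_one: "tw H id = 1"
    and tw_mult: "v \<in> weyl H \<Longrightarrow> w \<in> weyl H \<Longrightarrow> tw H (v \<circ> w) = tw H v * tw H w"
    and sym_one: "sym H 1 = 1"
    and sym_add: "sym H (a + b) = sym H a + sym H b"
    and sym_mult: "sym H (a * b) = sym H a * sym H b"
    and cross_relation: \<comment> \<open>\<open>b\<close> is the quotient \<open>(a - s\<^sub>\<alpha>(a))/\<alpha>\<close>, which exists by \<open>divided_difference_exists\<close>\<close>
      "\<alpha> \<in> simples H \<Longrightarrow> a - wact H (root_refl H \<alpha>) a = lin H \<alpha> * b \<Longrightarrow>
       sym H a * tw H (root_refl H \<alpha>) =
         tw H (root_refl H \<alpha>) * sym H (wact H (root_refl H \<alpha>) a) + hscale H (complex_of_real (param H \<alpha>)) (sym H b)"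
    and pbw: \<comment> \<open>\<open>w \<otimes> a \<mapsto> t\<^sub>w a\<close> is bijective on \<open>\<complex>[W] \<otimes> S(V\<^sub>\<complex>)\<close>\<close>
      "\<exists>!a. (\<forall>w. w \<notin> weyl H \<longrightarrow> a w = 0) \<and> h = (\<Sum>w\<in>weyl H. tw H w * sym H (a w))"

definition hecke_star ::
    "('v::real_vector, 'w::real_vector, 'h::ring_1, 'z) hecke_scheme \<Rightarrow> ('h \<Rightarrow> 'h) \<Rightarrow> bool" where
  "hecke_star H star \<longleftrightarrow> bij star \<and>
     (\<forall>h h'. star (h + h') = star h + star h') \<and>
     (\<forall>c h. star (hscale H c h) = hscale H (cnj c) (star h)) \<and>
     (\<forall>h h'. star (h * h') = star h' * star h) \<and>
     (\<forall>w\<in>weyl H. star (tw H w) = tw H (inv w)) \<and>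
     (\<forall>x y. star (sym H (clin H x y)) = sym H (clin H x (- y)))"

inductive_set generated_subalgebra ::
    "('v, 'w::real_vector, 'h::ring_1, 'z) hecke_scheme \<Rightarrow> 'h set \<Rightarrow> 'h set"
  for H G where
  gen: "g \<in> G \<Longrightarrow> g \<in> generated_subalgebra H G"
| one: "1 \<in> generated_subalgebra H G"
| scale: "a \<in> generated_subalgebra H G \<Longrightarrow> hscale H c a \<in> generated_subalgebra H G"
| add: "a \<in> generated_subalgebra H G \<Longrightarrow> b \<in> generated_subalgebra H G \<Longrightarrow>
    a + b \<in> generated_subalgebra H G"
| mult: "a \<in> generated_subalgebra H G \<Longrightarrow> b \<in> generated_subalgebra H G \<Longrightarrow>
    a * b \<in> generated_subalgebra H G"

text \<open>\<open>\<H>\<^sub>M\<close>, and \<open>\<H>\<^sub>M\<^sup>0\<close> as a tensor factor of \<open>\<H>\<^sub>M = \<H>\<^sub>M\<^sup>0 \<otimes> S((V\<^sub>M\<^sup>\<bottom>)\<^sub>\<complex>)\<close>.\<close>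

definition levi :: "('v::real_vector, 'w::real_vector, 'h::ring_1, 'z) hecke_scheme \<Rightarrow> 'v set \<Rightarrow> 'h set" where
  "levi H M = generated_subalgebra H (tw H ` refl_group H M \<union> range (sym H))"

definition levi0 :: "('v::real_vector, 'w::real_vector, 'h::ring_1, 'z) hecke_scheme \<Rightarrow> 'v set \<Rightarrow> 'h set" where
  "levi0 H M = generated_subalgebra H (tw H ` refl_group H M \<union> sym H ` lin H ` levi_V H M)"

definition levi_transfer ::
    "('v::real_vector, 'w::real_vector, 'h::ring_1, 'z) hecke_scheme \<Rightarrow> 'v set \<Rightarrow> ('h \<Rightarrow> 'h) \<Rightarrow> bool" where
  "levi_transfer H M \<phi> \<longleftrightarrow> bij_betw \<phi> (levi H M) (levi H (delta H ` M)) \<and>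
     \<phi> 1 = 1 \<and>
     (\<forall>a\<in>levi H M. \<forall>c. \<phi> (hscale H c a) = hscale H c (\<phi> a)) \<and>
     (\<forall>a\<in>levi H M. \<forall>b\<in>levi H M. \<phi> (a + b) = \<phi> a + \<phi> b \<and> \<phi> (a * b) = \<phi> a * \<phi> b) \<and>
     (\<forall>m\<in>refl_group H M. \<phi> (tw H m) = tw H (inv (w0M H M) \<circ> m \<circ> w0M H M)) \<and>
     (\<forall>x y. \<phi> (sym H (clin H x y)) = sym H (clin H (inv (w0M H M) x) (inv (w0M H M) y)))"


section \<open>The algebra with rational coefficients\<close>

text \<open>\<open>emb\<close> and \<open>rat\<close> are the maps of \<open>\<H>\<close> and of the rational functions into \<open>\<H> \<otimes> \<O>\<close>.\<close>

record (overloaded) ('v, 'w::real_vector, 'h, 'q) rational_hecke = "('v, 'w, 'h) hecke" +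
  emb :: "'h \<Rightarrow> 'q"
  rat :: "'w polyfun fract \<Rightarrow> 'q"

locale rational_hecke_algebra = graded_hecke_algebra H
  for H :: "('v::real_vector, 'w::real_vector, 'h::ring_1, 'q::ring_1, 'z) rational_hecke_scheme" (structure) +
  assumes emb_one: "emb H 1 = 1"
    and emb_add: "emb H (h + h') = emb H h + emb H h'"
    and emb_mult: "emb H (h * h') = emb H h * emb H h'"
    and rat_one: "rat H 1 = 1"
    and rat_add: "rat H (f + g) = rat H f + rat H g"
    and rat_mult: "rat H (f * g) = rat H f * rat H g"
    and emb_sym: "emb H (sym H a) = rat H (Fract a 1)"
    and rational_basis: \<comment> \<open>by \<open>pbw\<close>: \<open>h \<otimes> f \<mapsto> emb h rat f\<close> is bijective on \<open>\<H> \<otimes>\<^bsub>S\<^esub> \<O>\<close>\<close>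
      "\<exists>!f. (\<forall>w. w \<notin> weyl H \<longrightarrow> f w = 0) \<and> x = (\<Sum>w\<in>weyl H. emb H (tw H w) * rat H (f w))"

definition rational_levi ::
    "('v::real_vector, 'w::real_vector, 'h::ring_1, 'q::ring_1, 'z) rational_hecke_scheme \<Rightarrow> 'v set \<Rightarrow> 'q set" where
  "rational_levi H M = range (\<lambda>f. \<Sum>w\<in>refl_group H M. emb H (tw H w) * rat H (f w))"

definition epsilon ::
    "('v::real_vector, 'w::real_vector, 'h::ring_1, 'q::ring_1, 'z) rational_hecke_scheme \<Rightarrow> 'v set \<Rightarrow> 'q \<Rightarrow> 'q" where
  "epsilon H M x = (THE m1. \<exists>m. (\<forall>w\<in>min_reps H M. m w \<in> rational_levi H M) \<and>
     x = (\<Sum>w\<in>min_reps H M. emb H (tw H w) * m w) \<and> m1 = m id)"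

definition R_simple ::
    "('v::real_vector, 'w::real_vector, 'h::ring_1, 'q::ring_1, 'z) rational_hecke_scheme \<Rightarrow> 'v \<Rightarrow> 'q" where
  "R_simple H \<alpha> =
     (let k = pconst (complex_of_real (param H \<alpha>)); a = lin H \<alpha>
      in emb H (tw H (root_refl H \<alpha>)) * rat H (Fract a (k - a)) - rat H (Fract k (k - a)))"

definition R_elt ::
    "('v::real_vector, 'w::real_vector, 'h::ring_1, 'q::ring_1, 'z) rational_hecke_scheme \<Rightarrow> ('v \<Rightarrow> 'v) \<Rightarrow> 'q" where
  "R_elt H w = prod_list (map (R_simple H) (SOME \<alpha>s. reduced_expression H w \<alpha>s))"


section \<open>Modules and forms\<close>

text \<open>A representation, on a complex vector space with scalar multiplication \<open>sc\<close>, of a subalgebra \<open>A\<close>.\<close>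

definition representation ::
    "('v, 'w::real_vector, 'h::ring_1, 'z) hecke_scheme \<Rightarrow> 'h set \<Rightarrow>
     (complex \<Rightarrow> 'u::ab_group_add \<Rightarrow> 'u) \<Rightarrow> ('h \<Rightarrow> 'u \<Rightarrow> 'u) \<Rightarrow> bool" where
  "representation H A sc \<rho> \<longleftrightarrow>
     (\<forall>a\<in>A. Vector_Spaces.linear sc sc (\<rho> a)) \<and> \<rho> 1 = id \<and>
     (\<forall>a\<in>A. \<forall>c. \<rho> (hscale H c a) = (\<lambda>u. sc c (\<rho> a u))) \<and>
     (\<forall>a\<in>A. \<forall>b\<in>A. \<rho> (a + b) = (\<lambda>u. \<rho> a u + \<rho> b u) \<and> \<rho> (a * b) = \<rho> a \<circ> \<rho> b)"

text \<open>
  \<open>\<sigma> = \<sigma>\<^sub>0 \<otimes> \<complex>\<^sub>\<nu>\<close>, on the space of \<open>\<sigma>\<^sub>0\<close>, for \<open>\<nu> = fst \<nu> + \<i> snd \<nu>\<close> in the complexification of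
  \<open>V\<^sub>M\<^sup>\<or>\<^sup>,\<^sup>\<bottom>\<close>.
\<close>

definition twisted_by ::
    "('v::real_vector, 'w::real_vector, 'h::ring_1, 'z) hecke_scheme \<Rightarrow> 'v set \<Rightarrow>
     (complex \<Rightarrow> 'u \<Rightarrow> 'u) \<Rightarrow> ('h \<Rightarrow> 'u \<Rightarrow> 'u) \<Rightarrow> 'w \<times> 'w \<Rightarrow> ('h \<Rightarrow> 'u \<Rightarrow> 'u) \<Rightarrow> bool" where
  "twisted_by H M sc \<sigma>\<^sub>0 \<nu> \<sigma> \<longleftrightarrow>
     (\<forall>h\<in>levi0 H M. \<sigma> h = \<sigma>\<^sub>0 h) \<and>
     (\<forall>x\<in>levi_V_perp H M.
        \<sigma> (sym H (lin H x)) = sc (Complex (pairing H x (fst \<nu>)) (pairing H x (snd \<nu>))))"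

definition transfer_rep ::
    "('v::real_vector, 'w::real_vector, 'h::ring_1, 'z) hecke_scheme \<Rightarrow> 'v set \<Rightarrow>
     ('h \<Rightarrow> 'h) \<Rightarrow> ('h \<Rightarrow> 'u \<Rightarrow> 'u) \<Rightarrow> 'h \<Rightarrow> 'u \<Rightarrow> 'u" where
  "transfer_rep H M \<phi> \<sigma> m = \<sigma> (inv_into (levi H M) \<phi> m)"

text \<open>
  Extension of a representation \<open>\<rho>\<close> of \<open>A\<close> to the elements \<open>x = h q\<^sup>-\<^sup>1\<close> with rational coefficients whose
  denominator \<open>q\<close> acts invertibly: \<open>\<rho>(h q\<^sup>-\<^sup>1) = \<rho>(h) \<rho>(q)\<^sup>-\<^sup>1\<close>.
\<close>

definition regular_on ::
    "('v, 'w::real_vector, 'h::ring_1, 'q::ring_1, 'z) rational_hecke_scheme \<Rightarrow>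
     ('h \<Rightarrow> 'u \<Rightarrow> 'u) \<Rightarrow> 'q \<Rightarrow> bool" where
  "regular_on H \<rho> x \<longleftrightarrow> (\<exists>h q. bij (\<rho> (sym H q)) \<and> x * emb H (sym H q) = emb H h)"

definition rational_extension ::
    "('v, 'w::real_vector, 'h::ring_1, 'q::ring_1, 'z) rational_hecke_scheme \<Rightarrow> 'h set \<Rightarrow>
     ('h \<Rightarrow> 'u \<Rightarrow> 'u) \<Rightarrow> 'q \<Rightarrow> 'u \<Rightarrow> 'u" where
  "rational_extension H A \<rho> x = (THE T. \<exists>h\<in>A. \<exists>q.
     bij (\<rho> (sym H q)) \<and> x * emb H (sym H q) = emb H h \<and> T \<circ> \<rho> (sym H q) = \<rho> h)"

text \<open>
  Forms on a complex vector space with carrier \<open>X\<close>, addition \<open>add\<close> and scalar multiplication \<open>sc\<close>;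
  they are linear in the first variable. A hermitian form may be degenerate.
\<close>

definition sesquilinear_form ::
    "'x set \<Rightarrow> ('x \<Rightarrow> 'x \<Rightarrow> 'x) \<Rightarrow> (complex \<Rightarrow> 'x \<Rightarrow> 'x) \<Rightarrow> ('x \<Rightarrow> 'x \<Rightarrow> complex) \<Rightarrow> bool" where
  "sesquilinear_form X add sc B \<longleftrightarrow>
     (\<forall>x\<in>X. \<forall>y\<in>X. \<forall>z\<in>X. B (add x y) z = B x z + B y z \<and> B z (add x y) = B z x + B z y) \<and>
     (\<forall>c. \<forall>x\<in>X. \<forall>y\<in>X. B (sc c x) y = c * B x y \<and> B x (sc c y) = cnj c * B x y)"

definition hermitian_form ::
    "'x set \<Rightarrow> ('x \<Rightarrow> 'x \<Rightarrow> 'x) \<Rightarrow> (complex \<Rightarrow> 'x \<Rightarrow> 'x) \<Rightarrow> ('x \<Rightarrow> 'x \<Rightarrow> complex) \<Rightarrow> bool" where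
  "hermitian_form X add sc B \<longleftrightarrow>
     sesquilinear_form X add sc B \<and> (\<forall>x\<in>X. \<forall>y\<in>X. B y x = cnj (B x y))"

definition invariant_form ::
    "'h set \<Rightarrow> ('h \<Rightarrow> 'h) \<Rightarrow> 'x set \<Rightarrow> ('h \<Rightarrow> 'x \<Rightarrow> 'x) \<Rightarrow> ('x \<Rightarrow> 'x \<Rightarrow> complex) \<Rightarrow> bool" where
  "invariant_form A star X \<pi> B \<longleftrightarrow>
     (\<forall>h\<in>A. \<forall>x\<in>X. \<forall>y\<in>X. B (\<pi> h x) y = B x (\<pi> (star h) y))"


section \<open>The induced module\<close>

text \<open>
  \<open>\<H> \<otimes>\<^bsub>A\<^esub> U\<close> is the quotient of the free abelian group on \<open>\<H> \<times> U\<close> by the subgroup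
  \<open>tensor_relations\<close>; its elements are cosets.
\<close>

inductive_set tensor_relations ::
    "'h::ring_1 set \<Rightarrow> ('h \<Rightarrow> 'u::ab_group_add \<Rightarrow> 'u) \<Rightarrow> ('h \<times> 'u \<Rightarrow>\<^sub>0 int) set"
  for A \<rho> where
  add_left: "frag_of (g + h, u) - frag_of (g, u) - frag_of (h, u) \<in> tensor_relations A \<rho>"
| add_right: "frag_of (h, u + v) - frag_of (h, u) - frag_of (h, v) \<in> tensor_relations A \<rho>"
| balanced: "a \<in> A \<Longrightarrow> frag_of (h * a, u) - frag_of (h, \<rho> a u) \<in> tensor_relations A \<rho>"
| zero: "0 \<in> tensor_relations A \<rho>"
| diff: "x \<in> tensor_relations A \<rho> \<Longrightarrow> y \<in> tensor_relations A \<rho> \<Longrightarrow> x - y \<in> tensor_relations A \<rho>"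

type_synonym ('h, 'u) tensor = "('h \<times> 'u \<Rightarrow>\<^sub>0 int) set"

definition tclass ::
    "'h::ring_1 set \<Rightarrow> ('h \<Rightarrow> 'u::ab_group_add \<Rightarrow> 'u) \<Rightarrow> ('h \<times> 'u \<Rightarrow>\<^sub>0 int) \<Rightarrow> ('h, 'u) tensor" where
  "tclass A \<rho> x = {y. y - x \<in> tensor_relations A \<rho>}"

definition induced_space ::
    "'h::ring_1 set \<Rightarrow> ('h \<Rightarrow> 'u::ab_group_add \<Rightarrow> 'u) \<Rightarrow> ('h, 'u) tensor set" where
  "induced_space A \<rho> = range (tclass A \<rho>)"

definition tens ::
    "'h::ring_1 set \<Rightarrow> ('h \<Rightarrow> 'u::ab_group_add \<Rightarrow> 'u) \<Rightarrow> 'h \<Rightarrow> 'u \<Rightarrow> ('h, 'u) tensor" where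
  "tens A \<rho> h u = tclass A \<rho> (frag_of (h, u))"

definition induced_add ::
    "'h::ring_1 set \<Rightarrow> ('h \<Rightarrow> 'u::ab_group_add \<Rightarrow> 'u) \<Rightarrow>
     ('h, 'u) tensor \<Rightarrow> ('h, 'u) tensor \<Rightarrow> ('h, 'u) tensor" where
  "induced_add A \<rho> X Y = (\<Union>x\<in>X. \<Union>y\<in>Y. tclass A \<rho> (x + y))"

definition induced_act ::
    "'h::ring_1 set \<Rightarrow> ('h \<Rightarrow> 'u::ab_group_add \<Rightarrow> 'u) \<Rightarrow> 'h \<Rightarrow> ('h, 'u) tensor \<Rightarrow> ('h, 'u) tensor" where
  "induced_act A \<rho> h X = (\<Union>x\<in>X. tclass A \<rho> (frag_extend (\<lambda>(g, u). frag_of (h * g, u)) x))"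

definition induced_scale ::
    "('v, 'w::real_vector, 'h::ring_1, 'z) hecke_scheme \<Rightarrow> 'h set \<Rightarrow>
     ('h \<Rightarrow> 'u::ab_group_add \<Rightarrow> 'u) \<Rightarrow> complex \<Rightarrow> ('h, 'u) tensor \<Rightarrow> ('h, 'u) tensor" where
  "induced_scale H A \<rho> c = induced_act A \<rho> (hscale H c 1)"

text \<open>
  \<open>B\<close> is the form
  \<open>\<langle>h\<^sub>1 \<otimes> v\<^sub>1, h\<^sub>2 \<otimes> v\<^sub>2\<rangle> = \<langle>a\<sigma>[\<epsilon>(t\<^bsub>(w\<^sup>0)\<^sup>-\<^sup>1\<^esub> h\<^sub>2\<^sup>\<bullet> h\<^sub>1 R\<^sup>0)] v\<^sub>1, v\<^sub>2\<rangle>\<close> on the module induced from \<open>\<sigma>\<close>.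
\<close>

definition induced_form ::
    "('v::real_vector, 'w::real_vector, 'h::ring_1, 'q::ring_1, 'z) rational_hecke_scheme \<Rightarrow>
     ('h \<Rightarrow> 'h) \<Rightarrow> 'v set \<Rightarrow> ('h \<Rightarrow> 'h) \<Rightarrow> ('h \<Rightarrow> 'u::ab_group_add \<Rightarrow> 'u) \<Rightarrow> ('u \<Rightarrow> 'u \<Rightarrow> complex) \<Rightarrow>
     (('h, 'u) tensor \<Rightarrow> ('h, 'u) tensor \<Rightarrow> complex) \<Rightarrow> bool" where
  "induced_form H star M \<phi> \<sigma> form B \<longleftrightarrow>
     sesquilinear_form (induced_space (levi H M) \<sigma>) (induced_add (levi H M) \<sigma>)
       (induced_scale H (levi H M) \<sigma>) B \<and>
     (\<forall>h\<^sub>1 h\<^sub>2 v\<^sub>1 v\<^sub>2.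
        B (tens (levi H M) \<sigma> h\<^sub>1 v\<^sub>1) (tens (levi H M) \<sigma> h\<^sub>2 v\<^sub>2) =
        form (rational_extension H (levi H (delta H ` M)) (transfer_rep H M \<phi> \<sigma>)
               (epsilon H (delta H ` M)
                  (emb H (tw H (inv (w0M H M)) * star h\<^sub>2 * h\<^sub>1) * R_elt H (w0M H M))) v\<^sub>1) v\<^sub>2)"


section \<open>Well-definedness of the encodings\<close>

context reduced_root_datum
begin

lemma peval_lin: "peval (lin D x) \<xi> = complex_of_real (pairing D x \<xi>)"
  unfolding lin_def
  by (subst Abs_polyfun_inverse) (auto intro: poly_functions.functional pairing_linear)

lemma wtranspose_eqI:
  assumes "\<And>x. pairing D x \<eta> = pairing D (w x) \<xi>"
  shows "wtranspose D w \<xi> = \<eta>"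
  unfolding wtranspose_def
proof (rule the_equality)
  show "\<forall>x. pairing D x \<eta> = pairing D (w x) \<xi>" using assms by blast
next
  fix \<eta>' assume "\<forall>x. pairing D x \<eta>' = pairing D (w x) \<xi>"
  then have "pairing D x (\<eta>' - \<eta>) = 0" for x
    using assms linear_diff[OF pairing_linear(2)] by simp
  then show "\<eta>' = \<eta>" using pairing_nondegenerate(2) by (metis right_minus_eq)
qed

lemma wtranspose_root_refl: "wtranspose D (root_refl D \<alpha>) = coroot_refl D \<alpha>"
proof
  fix \<xi>
  show "wtranspose D (root_refl D \<alpha>) \<xi> = coroot_refl D \<alpha> \<xi>"
    by (rule wtranspose_eqI)
      (simp add: root_refl_def coroot_refl_def linear_diff[OF pairing_linear(1)] linear_diff[OF pairing_linear(2)]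
        linear_scale[OF pairing_linear(1)] linear_scale[OF pairing_linear(2)])
qed

lemma linear_coroot_refl: "linear (coroot_refl D \<alpha>)"
  by (rule linearI)
    (simp_all add: coroot_refl_def linear_add[OF pairing_linear(2)] linear_scale[OF pairing_linear(2)] algebra_simps)

lemma wtranspose_comp:
  assumes "\<And>x \<xi>. pairing D x (wtranspose D w \<xi>) = pairing D (w x) \<xi>"
  shows "wtranspose D (root_refl D \<alpha> \<circ> w) = wtranspose D w \<circ> coroot_refl D \<alpha>"
proof
  fix \<xi>
  have "pairing D (root_refl D \<alpha> y) \<xi> = pairing D y (coroot_refl D \<alpha> \<xi>)" for y
    by (simp add: root_refl_def coroot_refl_def linear_diff[OF pairing_linear(1)] linear_diff[OF pairing_linear(2)]
        linear_scale[OF pairing_linear(1)] linear_scale[OF pairing_linear(2)])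
  then show "wtranspose D (root_refl D \<alpha> \<circ> w) \<xi> = (wtranspose D w \<circ> coroot_refl D \<alpha>) \<xi>"
    using assms by (intro wtranspose_eqI) simp
qed

lemma weyl_wtranspose:
  assumes "w \<in> weyl D"
  shows "linear (wtranspose D w) \<and> (\<forall>x \<xi>. pairing D x (wtranspose D w \<xi>) = pairing D (w x) \<xi>)"
  using assms unfolding weyl_def
proof (induction rule: refl_group.induct)
  case one
  have "wtranspose D id = (\<lambda>\<xi>. \<xi>)"
    using wtranspose_eqI[where w = id] by fastforce
  then show ?case by (simp add: id_def linear_ident)
next
  case (step \<alpha> w)
  have eq: "wtranspose D (root_refl D \<alpha> \<circ> w) = wtranspose D w \<circ> coroot_refl D \<alpha>"
    using step wtranspose_comp by blast
  have "linear (wtranspose D w \<circ> coroot_refl D \<alpha>)"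
    using linear_compose[OF linear_coroot_refl] step by blast
  moreover have "pairing D x (wtranspose D w (coroot_refl D \<alpha> \<xi>)) = pairing D (root_refl D \<alpha> (w x)) \<xi>" for x \<xi>
    using step by (simp add: root_refl_def coroot_refl_def linear_diff[OF pairing_linear(1)]
        linear_diff[OF pairing_linear(2)] linear_scale[OF pairing_linear(1)] linear_scale[OF pairing_linear(2)])
  ultimately show ?case unfolding eq by (intro conjI) (assumption, simp)
qed

lemma peval_wact:
  assumes "w \<in> weyl D"
  shows "peval (wact D w p) \<xi> = peval p (wtranspose D w \<xi>)"
  unfolding wact_def using weyl_wtranspose[OF assms]
  by (subst Abs_polyfun_inverse) (auto intro: poly_functions_comp_linear peval)

lemma wact_lin:
  assumes "w \<in> weyl D"
  shows "wact D w (lin D x) = lin D (w x)"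
  using weyl_wtranspose[OF assms]
  by (simp add: peval_inject[symmetric] fun_eq_iff peval_wact[OF assms] peval_lin)

lemma wact_hom:
  assumes "w \<in> weyl D"
  shows "wact D w (p + q) = wact D w p + wact D w q" "wact D w (p * q) = wact D w p * wact D w q"
    "wact D w (pconst c) = pconst c"
  by (simp_all add: peval_inject[symmetric] fun_eq_iff peval_wact[OF assms]
      plus_polyfun.rep_eq times_polyfun.rep_eq pconst.rep_eq)

lemma refl_weyl: "\<alpha> \<in> roots D \<Longrightarrow> root_refl D \<alpha> \<in> weyl D"
  unfolding weyl_def using refl_group.step[OF _ refl_group.one] by fastforce

lemma divided_difference_exists:
  assumes "\<alpha> \<in> roots D"
  shows "\<exists>!b. a - wact D (root_refl D \<alpha>) a = lin D \<alpha> * b"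
proof -
  note W = refl_weyl[OF assms]
  have "\<exists>b\<in>poly_functions. \<forall>\<xi>. p \<xi> - p (coroot_refl D \<alpha> \<xi>) = complex_of_real (pairing D \<alpha> \<xi>) * b \<xi>"
    if "p \<in> poly_functions" for p :: "'w \<Rightarrow> complex"
    using that
  proof (induction rule: poly_functions.induct)
    case (const c)
    show ?case by (rule bexI[OF _ poly_functions.const[of 0]]) simp
  next
    case (functional f)
    show ?case
      by (rule bexI[OF _ poly_functions.const[of "complex_of_real (f (coroot D \<alpha>))"]])
        (simp add: coroot_refl_def linear_diff[OF functional] linear_scale[OF functional])
  next
    case (add p q)
    then obtain b c where b: "b \<in> poly_functions" "c \<in> poly_functions"
      and eq: "\<And>\<xi>. p \<xi> - p (coroot_refl D \<alpha> \<xi>) = complex_of_real (pairing D \<alpha> \<xi>) * b \<xi>"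
      "\<And>\<xi>. q \<xi> - q (coroot_refl D \<alpha> \<xi>) = complex_of_real (pairing D \<alpha> \<xi>) * c \<xi>" by blast
    have "(p \<xi> + q \<xi>) - (p (coroot_refl D \<alpha> \<xi>) + q (coroot_refl D \<alpha> \<xi>)) =
        complex_of_real (pairing D \<alpha> \<xi>) * (b \<xi> + c \<xi>)" for \<xi>
      unfolding distrib_left eq[symmetric] by simp
    then show ?case by (intro bexI[OF _ poly_functions.add[OF b]] allI)
  next
    case (mult p q)
    then obtain b c where b: "b \<in> poly_functions" "c \<in> poly_functions"
      and eq: "\<And>\<xi>. p \<xi> - p (coroot_refl D \<alpha> \<xi>) = complex_of_real (pairing D \<alpha> \<xi>) * b \<xi>"
      "\<And>\<xi>. q \<xi> - q (coroot_refl D \<alpha> \<xi>) = complex_of_real (pairing D \<alpha> \<xi>) * c \<xi>" by blast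
    have "(\<lambda>\<xi>. p \<xi> * c \<xi> + b \<xi> * q (coroot_refl D \<alpha> \<xi>)) \<in> poly_functions"
      using b mult poly_functions_comp_linear[OF mult(2) linear_coroot_refl]
      by (intro poly_functions.add poly_functions.mult) auto
    moreover have "p \<xi> * q \<xi> - p (coroot_refl D \<alpha> \<xi>) * q (coroot_refl D \<alpha> \<xi>) =
        complex_of_real (pairing D \<alpha> \<xi>) * (p \<xi> * c \<xi> + b \<xi> * q (coroot_refl D \<alpha> \<xi>))" for \<xi>
    proof -
      have "p \<xi> * q \<xi> - p (coroot_refl D \<alpha> \<xi>) * q (coroot_refl D \<alpha> \<xi>) =
          p \<xi> * (q \<xi> - q (coroot_refl D \<alpha> \<xi>)) + (p \<xi> - p (coroot_refl D \<alpha> \<xi>)) * q (coroot_refl D \<alpha> \<xi>)"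
        by (simp add: algebra_simps)
      then show ?thesis unfolding eq by (simp only: distrib_left mult_ac)
    qed
    ultimately show ?case by (intro bexI[of _ "\<lambda>\<xi>. p \<xi> * c \<xi> + b \<xi> * q (coroot_refl D \<alpha> \<xi>)"] allI)
  qed
  from this[OF peval[of a]] obtain b where b: "b \<in> poly_functions"
    "\<And>\<xi>. peval a \<xi> - peval a (coroot_refl D \<alpha> \<xi>) = complex_of_real (pairing D \<alpha> \<xi>) * b \<xi>" by blast
  have ex: "a - wact D (root_refl D \<alpha>) a = lin D \<alpha> * Abs_polyfun b"
    by (simp add: peval_inject[symmetric] fun_eq_iff minus_polyfun.rep_eq times_polyfun.rep_eq
        peval_wact[OF W] peval_lin wtranspose_root_refl Abs_polyfun_inverse[OF b(1)] b(2))
  have "peval (lin D \<alpha>) (coroot D \<alpha>) \<noteq> 0"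
    using pairing_root_coroot[OF assms] by (simp add: peval_lin)
  then have "lin D \<alpha> \<noteq> 0" by (metis zero_polyfun.rep_eq)
  then show ?thesis using ex by (metis mult_left_cancel)
qed

end

end

theory Submission
  imports Defs
begin

text \<open>
  Write \<open>w\<^sup>0\<close> for \<open>w\<^sup>0\<^sub>M\<close> and \<open>N\<close> for \<open>\<delta>(M)\<close>. For \<open>x\<close> in the algebra let \<open>E(x) = \<epsilon>\<^sub>N(t\<^bsub>(w\<^sup>0)\<^sup>-\<^sup>1\<^esub> x)\<close>: the
  component of \<open>x\<close> in the coset part \<open>t\<^bsub>w\<^sup>0\<^esub> \<H>\<^sub>N\<close> is \<open>t\<^bsub>w\<^sup>0\<^esub> E(x)\<close>. With \<open>T(h) = a\<sigma>[E(h R\<^sup>0)]\<close> the form is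
  \<open>\<langle>h\<^sub>1 \<otimes> v\<^sub>1, h\<^sub>2 \<otimes> v\<^sub>2\<rangle> = \<langle>T(h\<^sub>2\<^sup>\<bullet> h\<^sub>1) v\<^sub>1, v\<^sub>2\<rangle>\<close>. It depends on \<open>h\<^sub>1\<close> and \<open>h\<^sub>2\<close> through \<open>h\<^sub>2\<^sup>\<bullet> h\<^sub>1\<close>, which
  makes it \<open>\<bullet>\<close>-invariant. The real content is that it is hermitian, which means that \<open>T(h)\<close> and
  \<open>T(h\<^sup>\<bullet>)\<close> are adjoint, and that it respects the tensor relations.

  The element \<open>w\<^sup>0\<close> is strictly the longest of the minimal length representatives of \<open>W/W\<^sub>N\<close>. Apart
  from the leading term \<open>t\<^sub>w w\<^sup>-\<^sup>1(a)\<close>, moving a polynomial \<open>a\<close> past \<open>t\<^sub>w\<close> produces only terms shorter than \<open>w\<close>,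
  and these never reach the coset of \<open>w\<^sup>0\<close> from a lower one. Therefore \<open>E(m h) = \<phi>(m) E(h)\<close> for \<open>m\<close> in \<open>\<H>\<^sub>M\<close> (\<open>top_part_levi_left\<close>),
  and the form is balanced in the second variable. Balance in the first variable then follows from
  hermitian symmetry.

  For the symmetry one has to see that \<open>E(h R\<^sup>0)\<^sup>\<bullet> = E(h\<^sup>\<bullet> R\<^sup>0)\<close>. As functions of \<open>h\<close>, both \<open>E(h R\<^sup>0)\<close> and
  \<open>E(h\<^sup>\<bullet> R\<^sup>0)\<^sup>\<bullet>\<close> are compatible with left and right multiplication by polynomials, twisted by
  \<open>(w\<^sup>0)\<^sup>-\<^sup>1\<close>. Test them on elements \<open>\<tau>\<^sub>w\<close> with \<open>a \<tau>\<^sub>w = \<tau>\<^sub>w w\<^sup>-\<^sup>1(a)\<close>: the values lie in \<open>\<H>\<^sub>N\<close> and satisfy the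
  same relation for \<open>(w\<^sup>0)\<^sup>-\<^sup>1 w w\<^sup>0\<close>. An element with such a relation for \<open>v\<close> is determined by its
  coefficient at \<open>t\<^sub>v\<close> (\<open>intertwines_zero\<close>), so both values vanish unless \<open>w\<close> lies in \<open>W\<^sub>M\<close>. If it does, then
  \<open>\<tau>\<^sub>w\<close> can be chosen in \<open>\<H>\<^sub>M\<close>, and the comparison reduces to properties of \<open>E(R\<^sup>0)\<close>. This is the
  coefficient of \<open>R\<^sup>0\<close> at \<open>t\<^bsub>w\<^sup>0\<^esub>\<close>, the product of \<open>\<gamma>/(k\<^sub>\<gamma> - \<gamma>)\<close> over the positive roots \<open>\<gamma>\<close> that \<open>w\<^sup>0\<close> makes
  negative. It is real, and it is fixed by \<open>W\<^sub>N\<close> because the simple reflections of \<open>N\<close> permute these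
  roots. Since \<open>\<tau>\<^sub>w\<close> has a nonzero coefficient at \<open>t\<^sub>w\<close> and otherwise only shorter terms, an induction on
  length extends the equality from the \<open>\<tau>\<^sub>w\<close> to all \<open>h\<close>.

  Denominators are cleared once: regularity gives a polynomial \<open>q\<close> that acts invertibly with
  \<open>R\<^sup>0 q = h\<^sub>0\<close> in \<open>\<H>\<close>. Then \<open>T(h)\<close> is given by \<open>E(h h\<^sub>0)\<close> and the inverse of \<open>q\<close>, and the symmetry becomes the
  identity \<open>q\<^sup>\<bullet> E(h h\<^sub>0) = E(h\<^sup>\<bullet> h\<^sub>0)\<^sup>\<bullet> q\<close> in \<open>\<H>\<close> (\<open>top_part_symmetry\<close>).

  The facts on Weyl groups that enter (length as number of inversions, exchange, coset
  representatives) are derived for real root systems from the action on positive roots.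
\<close>

section \<open>Reflections and coroots\<close>

context reduced_root_datum
begin

lemma linear_refl: "linear (root_refl D \<alpha>)"
  by (rule linearI)
    (simp_all add: root_refl_def linear_add[OF pairing_linear(1)] linear_scale[OF pairing_linear(1)] algebra_simps)

lemma refl_self: "\<alpha> \<in> roots D \<Longrightarrow> root_refl D \<alpha> \<alpha> = - \<alpha>"
  by (simp add: root_refl_def pairing_root_coroot scaleR_2)

lemma refl_involution: "\<alpha> \<in> roots D \<Longrightarrow> root_refl D \<alpha> (root_refl D \<alpha> x) = x"
  by (simp add: root_refl_def pairing_root_coroot linear_diff[OF pairing_linear(1)]
      linear_scale[OF pairing_linear(1)] algebra_simps)

lemma refl_comp_refl: "\<alpha> \<in> roots D \<Longrightarrow> root_refl D \<alpha> \<circ> root_refl D \<alpha> = id"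
  by (simp add: fun_eq_iff refl_involution)

lemma corefl_involution: "\<alpha> \<in> roots D \<Longrightarrow> coroot_refl D \<alpha> (coroot_refl D \<alpha> \<xi>) = \<xi>"
  by (simp add: coroot_refl_def pairing_root_coroot linear_diff[OF pairing_linear(2)]
      linear_scale[OF pairing_linear(2)] algebra_simps)

lemma refl_root: "\<alpha> \<in> roots D \<Longrightarrow> \<beta> \<in> roots D \<Longrightarrow> root_refl D \<alpha> \<beta> \<in> roots D"
  using refl_roots by blast

lemma neg_root: "\<alpha> \<in> roots D \<Longrightarrow> - \<alpha> \<in> roots D"
  using refl_root[of \<alpha> \<alpha>] refl_self by simp

lemma root_nonzero: "\<alpha> \<in> roots D \<Longrightarrow> \<alpha> \<noteq> 0"
  using pairing_root_coroot[of \<alpha>] linear_0[OF pairing_linear(1)] by force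

lemma pairing_refl: "pairing D (root_refl D \<alpha> x) \<xi> = pairing D x (coroot_refl D \<alpha> \<xi>)"
  by (simp add: root_refl_def coroot_refl_def linear_diff[OF pairing_linear(1)] linear_diff[OF pairing_linear(2)]
      linear_scale[OF pairing_linear(1)] linear_scale[OF pairing_linear(2)])

text \<open>
  If the values differed at \<open>x\<close>, the product of the two reflections would translate \<open>x\<close> by nonzero
  multiples of \<open>\<gamma>\<close> again and again, producing infinitely many roots.
\<close>

lemma functional_on_roots_unique:
  assumes \<gamma>: "\<gamma> \<in> roots D" and f: "linear f" "f \<gamma> = 2" "\<And>x. x \<in> roots D \<Longrightarrow> x - f x *\<^sub>R \<gamma> \<in> roots D"
    and x: "x \<in> roots D"
  shows "f x = pairing D x (coroot D \<gamma>)"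
proof (rule ccontr)
  define c where "c = f x - pairing D x (coroot D \<gamma>)"
  assume "\<not> ?thesis"
  then have c: "c \<noteq> 0" by (simp add: c_def)
  have p\<gamma>: "pairing D \<gamma> (coroot D \<gamma>) = 2" using pairing_root_coroot[OF \<gamma>] .
  have "x + real n *\<^sub>R (c *\<^sub>R \<gamma>) \<in> roots D" for n
  proof (induction n)
    case (Suc n)
    define z where "z = x + real n *\<^sub>R (c *\<^sub>R \<gamma>)"
    have "root_refl D \<gamma> (z - f z *\<^sub>R \<gamma>) \<in> roots D"
      using f(3) refl_root[OF \<gamma>] Suc unfolding z_def by blast
    moreover have two: "(f z * 2) *\<^sub>R \<gamma> = f z *\<^sub>R \<gamma> + f z *\<^sub>R \<gamma>"
      by (simp flip: scaleR_add_left)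
    then have "root_refl D \<gamma> (z - f z *\<^sub>R \<gamma>) = z + (f z - pairing D z (coroot D \<gamma>)) *\<^sub>R \<gamma>"
      by (simp add: root_refl_def linear_diff[OF pairing_linear(1)] linear_scale[OF pairing_linear(1)] p\<gamma> two algebra_simps)
    moreover have "f z - pairing D z (coroot D \<gamma>) = c"
      by (simp add: linear_add[OF f(1)] linear_scale[OF f(1)] linear_add[OF pairing_linear(1)]
          linear_scale[OF pairing_linear(1)] f(2) p\<gamma> c_def z_def)
    ultimately have "z + c *\<^sub>R \<gamma> \<in> roots D" by simp
    then show ?case by (simp add: z_def algebra_simps)
  qed (use x in simp)
  then have "range (\<lambda>n. x + real n *\<^sub>R (c *\<^sub>R \<gamma>)) \<subseteq> roots D" by blast
  moreover have "inj (\<lambda>n. x + real n *\<^sub>R (c *\<^sub>R \<gamma>))"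
    using c root_nonzero[OF \<gamma>] by (auto simp: inj_on_def)
  ultimately show False
    using roots_finite finite_subset range_inj_infinite by blast
qed

text \<open>
  Both reflections fix \<open>a - b\<close>, and their product sends \<open>a\<close> to \<open>a + 2(a - b)\<close>. Iterating it would give
  infinitely many roots.
\<close>

lemma same_coroot_functional:
  assumes a: "a \<in> roots D" and b: "b \<in> roots D"
    and eq: "\<And>x. x \<in> roots D \<Longrightarrow> pairing D x (coroot D a) = pairing D x (coroot D b)"
  shows "a = b"
proof (rule ccontr)
  assume "a \<noteq> b"
  have ab: "pairing D b (coroot D a) = 2" "pairing D a (coroot D b) = 2"
    using eq a b pairing_root_coroot by force+
  have "a + (2 * real n) *\<^sub>R (a - b) \<in> roots D" for n
  proof (induction n)
    case (Suc n)
    have "root_refl D a (root_refl D b (a + (2 * real n) *\<^sub>R (a - b))) \<in> roots D"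
      using refl_root a b Suc by blast
    moreover have "root_refl D b (a + (2 * real n) *\<^sub>R (a - b)) = a + (2 * real n) *\<^sub>R (a - b) - 2 *\<^sub>R b"
      by (simp add: root_refl_def linear_add[OF pairing_linear(1)] linear_scale[OF pairing_linear(1)]
        linear_diff[OF pairing_linear(1)] ab pairing_root_coroot a b)
    moreover have "root_refl D a (a + (2 * real n) *\<^sub>R (a - b) - 2 *\<^sub>R b) = a + (2 * real (Suc n)) *\<^sub>R (a - b)"
      by (simp add: root_refl_def linear_add[OF pairing_linear(1)] linear_scale[OF pairing_linear(1)]
        linear_diff[OF pairing_linear(1)] ab pairing_root_coroot a b) (simp add: algebra_simps scaleR_2)
    ultimately show ?case by simp
  qed (use a in simp)
  then have "range (\<lambda>n. a + (2 * real n) *\<^sub>R (a - b)) \<subseteq> roots D" by blast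
  moreover have "inj (\<lambda>n. a + (2 * real n) *\<^sub>R (a - b))"
    using \<open>a \<noteq> b\<close> by (auto simp: inj_on_def)
  ultimately show False
    using roots_finite finite_subset range_inj_infinite by blast
qed

text \<open>
  The functional \<open>s\<^sub>\<beta>(\<gamma>\<^sup>\<or>)\<close> is the coroot of some root \<open>d\<close>, and on roots it agrees with the coroot of
  \<open>s\<^sub>\<beta>(\<gamma>)\<close>. Roots may fail to span \<open>V\<close>, so this agreement alone does not identify the two coroots;
  it does give \<open>d = s\<^sub>\<beta>(\<gamma>)\<close>.
\<close>

lemma coroot_refl_root:
  assumes \<beta>: "\<beta> \<in> roots D" and \<gamma>: "\<gamma> \<in> roots D"
  shows "coroot D (root_refl D \<beta> \<gamma>) = coroot_refl D \<beta> (coroot D \<gamma>)"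
proof -
  let ?g = "root_refl D \<beta> \<gamma>"
  let ?f = "\<lambda>x. pairing D x (coroot_refl D \<beta> (coroot D \<gamma>))"
  have g: "?g \<in> roots D" using refl_root \<beta> \<gamma> by blast
  have "coroot_refl D \<beta> (coroot D \<gamma>) \<in> coroots D"
    using corefl_coroots[OF \<beta>] coroot_bij \<gamma> by (auto simp: bij_betw_def)
  then obtain d where d: "d \<in> roots D" "coroot D d = coroot_refl D \<beta> (coroot D \<gamma>)"
    using coroot_bij unfolding bij_betw_def by (metis imageE)
  have "?f x = pairing D x (coroot D ?g)" if "x \<in> roots D" for x
  proof (rule functional_on_roots_unique[OF g _ _ _ that])
    show "linear ?f" by (rule pairing_linear(1))
    show "?f ?g = 2"
      using pairing_refl[of \<beta> ?g "coroot D \<gamma>", symmetric]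
      by (simp add: refl_involution \<beta> pairing_root_coroot \<gamma>)
    fix y assume "y \<in> roots D"
    then have "root_refl D \<beta> (root_refl D \<gamma> (root_refl D \<beta> y)) \<in> roots D"
      using refl_root \<beta> \<gamma> by blast
    moreover have "root_refl D \<beta> (root_refl D \<gamma> (root_refl D \<beta> y)) = y - ?f y *\<^sub>R ?g"
      unfolding root_refl_def[of D \<gamma> "root_refl D \<beta> y"]
      by (simp add: linear_diff[OF linear_refl] linear_scale[OF linear_refl] refl_involution \<beta> pairing_refl)
    ultimately show "y - ?f y *\<^sub>R ?g \<in> roots D" by simp
  qed
  then have "d = ?g" by (intro same_coroot_functional[OF d(1) g]) (simp add: d(2))
  then show ?thesis using d(2) by simp
qed

lemma refl_conj:
  assumes \<beta>: "\<beta> \<in> roots D" and \<gamma>: "\<gamma> \<in> roots D"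
  shows "root_refl D (root_refl D \<beta> \<gamma>) (root_refl D \<beta> x) = root_refl D \<beta> (root_refl D \<gamma> x)"
  unfolding root_refl_def[of D \<gamma> x] root_refl_def[of D "root_refl D \<beta> \<gamma>" "root_refl D \<beta> x"]
  by (simp add: coroot_refl_root[OF assms] pairing_refl corefl_involution \<beta>
      linear_diff[OF linear_refl] linear_scale[OF linear_refl])

subsection \<open>Reflection groups\<close>

lemma refl_group_comp:
  "v \<in> refl_group D A \<Longrightarrow> w \<in> refl_group D A \<Longrightarrow> v \<circ> w \<in> refl_group D A"
  by (induction rule: refl_group.induct) (auto simp: comp_assoc intro: refl_group.step)

lemma refl_group_refl: "\<alpha> \<in> A \<Longrightarrow> root_refl D \<alpha> \<in> refl_group D A"
  using refl_group.step[OF _ refl_group.one] by fastforce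

lemma refl_group_mono: "A \<subseteq> B \<Longrightarrow> w \<in> refl_group D A \<Longrightarrow> w \<in> refl_group D B"
  by (rotate_tac 1, induction rule: refl_group.induct) (auto intro: refl_group.intros)

lemma refl_group_linear: "w \<in> refl_group D A \<Longrightarrow> linear w"
  by (induction rule: refl_group.induct)
    (simp_all only: linear_id linear_compose[OF _ linear_refl])

lemma refl_group_root: "A \<subseteq> roots D \<Longrightarrow> w \<in> refl_group D A \<Longrightarrow> \<gamma> \<in> roots D \<Longrightarrow> w \<gamma> \<in> roots D"
  by (rotate_tac 1, induction rule: refl_group.induct) (auto intro: refl_root)

lemma refl_group_bij_inv:
  assumes A: "A \<subseteq> roots D"
  shows "w \<in> refl_group D A \<Longrightarrow> bij w \<and> inv w \<in> refl_group D A"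
proof (induction rule: refl_group.induct)
  case one
  show ?case unfolding inv_id using bij_id refl_group.one by blast
next
  case (step \<alpha> w)
  then have \<alpha>: "\<alpha> \<in> roots D" using A by blast
  have b: "bij (root_refl D \<alpha>)" "inv (root_refl D \<alpha>) = root_refl D \<alpha>"
    using refl_comp_refl[OF \<alpha>] o_bij inv_unique_comp by blast+
  then have "inv (root_refl D \<alpha> \<circ> w) = inv w \<circ> root_refl D \<alpha>"
    using step o_inv_distrib[of "root_refl D \<alpha>" w] by simp
  then show ?case
    using step b refl_group_comp refl_group_refl bij_comp by metis
qed

lemma weyl_linear: "w \<in> weyl D \<Longrightarrow> linear w" unfolding weyl_def by (rule refl_group_linear)

lemma weyl_bij: "w \<in> weyl D \<Longrightarrow> bij w" and weyl_inv: "w \<in> weyl D \<Longrightarrow> inv w \<in> weyl D"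
  unfolding weyl_def using refl_group_bij_inv by blast+

lemma weyl_comp: "v \<in> weyl D \<Longrightarrow> w \<in> weyl D \<Longrightarrow> v \<circ> w \<in> weyl D"
  unfolding weyl_def by (rule refl_group_comp)

lemma weyl_id: "id \<in> weyl D" unfolding weyl_def by (rule refl_group.one)

lemma weyl_root: "w \<in> weyl D \<Longrightarrow> \<gamma> \<in> roots D \<Longrightarrow> w \<gamma> \<in> roots D"
  unfolding weyl_def using refl_group_root by blast

lemma weyl_inv_apply: "w \<in> weyl D \<Longrightarrow> inv w (w x) = x" "w \<in> weyl D \<Longrightarrow> w (inv w x) = x"
  using weyl_bij[of w] by (simp_all add: bij_is_inj bij_is_surj surj_f_inv_f)

lemma weyl_inv_comp: "w \<in> weyl D \<Longrightarrow> inv w \<circ> w = id" "w \<in> weyl D \<Longrightarrow> w \<circ> inv w = id"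
  by (simp_all add: fun_eq_iff weyl_inv_apply)

lemma weyl_neg: "w \<in> weyl D \<Longrightarrow> w (- x) = - w x"
  using weyl_linear linear_neg by blast

lemma levi_group_weyl: "M \<subseteq> roots D \<Longrightarrow> u \<in> refl_group D M \<Longrightarrow> u \<in> weyl D"
  unfolding weyl_def by (rule refl_group_mono)

lemma simple_group_weyl: "M \<subseteq> simples D \<Longrightarrow> u \<in> refl_group D M \<Longrightarrow> u \<in> weyl D"
  using levi_group_weyl simples_roots by blast

lemma weyl_refl_conj:
  assumes "w \<in> weyl D" "\<gamma> \<in> roots D"
  shows "root_refl D (w \<gamma>) \<circ> w = w \<circ> root_refl D \<gamma>"
  using assms unfolding weyl_def
proof (induction rule: refl_group.induct)
  case (step \<alpha> w)
  then have "w \<gamma> \<in> roots D" using refl_group_root by blast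
  then have "root_refl D (root_refl D \<alpha> (w \<gamma>)) \<circ> (root_refl D \<alpha> \<circ> w)
      = root_refl D \<alpha> \<circ> (root_refl D (w \<gamma>) \<circ> w)"
    using refl_conj[OF step.hyps(1) \<open>w \<gamma> \<in> roots D\<close>] by (intro ext) simp
  also have "\<dots> = root_refl D \<alpha> \<circ> (w \<circ> root_refl D \<gamma>)"
    by (rule arg_cong[OF step.IH[OF step.prems]])
  finally show ?case by (simp add: fun_eq_iff)
qed simp

lemma weyl_refl_conj': "w \<in> weyl D \<Longrightarrow> \<gamma> \<in> roots D \<Longrightarrow> root_refl D (w \<gamma>) = w \<circ> root_refl D \<gamma> \<circ> inv w"
  using weyl_refl_conj[of w \<gamma>] weyl_inv_comp(2)[of w] by (metis comp_assoc comp_id)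

subsection \<open>Positive roots\<close>

text \<open>
  Coordinates with respect to the simple roots; they are \<open>0\<close> outside the span of the simple roots.
\<close>

definition cf :: "'v \<Rightarrow> 'v \<Rightarrow> real" where
  "cf x \<beta> = Real_Vector_Spaces.representation (simples D) x \<beta>"

definition pos :: "'v \<Rightarrow> bool" where
  "pos \<gamma> \<longleftrightarrow> \<gamma> \<in> roots D \<and> (\<forall>\<beta>\<in>simples D. 0 \<le> cf \<gamma> \<beta>)"

lemma finite_simples: "finite (simples D)"
  using simples_roots roots_finite finite_subset by blast

lemma simple_root: "\<alpha> \<in> simples D \<Longrightarrow> \<alpha> \<in> roots D" using simples_roots by blast

lemma root_span: "\<gamma> \<in> roots D \<Longrightarrow> \<gamma> \<in> span (simples D)"
  using simples_base by (metis (no_types, lifting) span_base span_scale span_sum)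

lemma cf_add: "x \<in> span (simples D) \<Longrightarrow> y \<in> span (simples D) \<Longrightarrow> cf (x + y) \<beta> = cf x \<beta> + cf y \<beta>"
  unfolding cf_def by (simp add: real_vector.representation_add[OF simples_independent])

lemma cf_scale: "x \<in> span (simples D) \<Longrightarrow> cf (c *\<^sub>R x) \<beta> = c * cf x \<beta>"
  unfolding cf_def by (simp add: real_vector.representation_scale[OF simples_independent])

lemma cf_neg: "x \<in> span (simples D) \<Longrightarrow> cf (- x) \<beta> = - cf x \<beta>"
  using cf_scale[of x "-1"] by simp

lemma cf_diff: "x \<in> span (simples D) \<Longrightarrow> y \<in> span (simples D) \<Longrightarrow> cf (x - y) \<beta> = cf x \<beta> - cf y \<beta>"
  using cf_add[of x "- y"] by (simp add: cf_neg span_neg)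

lemma cf_refl: "x \<in> span (simples D) \<Longrightarrow> \<alpha> \<in> simples D \<Longrightarrow>
    cf (root_refl D \<alpha> x) \<beta> = cf x \<beta> - pairing D x (coroot D \<alpha>) * cf \<alpha> \<beta>"
  unfolding root_refl_def by (simp add: cf_diff cf_scale span_base span_scale)

lemma cf_simple: "\<alpha> \<in> simples D \<Longrightarrow> cf \<alpha> \<beta> = (if \<alpha> = \<beta> then 1 else 0)"
  unfolding cf_def by (auto simp add: real_vector.representation_basis[OF simples_independent])

lemma cf_sum: "(\<And>i. i \<in> I \<Longrightarrow> g i \<in> span (simples D)) \<Longrightarrow> cf (\<Sum>i\<in>I. c i *\<^sub>R g i) \<beta> = (\<Sum>i\<in>I. c i * cf (g i) \<beta>)"
proof (induction I rule: infinite_finite_induct)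
  case (insert i I)
  then have "(\<Sum>i\<in>I. c i *\<^sub>R g i) \<in> span (simples D)" by (intro span_sum span_scale) auto
  with insert show ?case by (simp add: cf_add cf_scale span_scale)
qed (simp_all add: cf_def real_vector.representation_zero)

lemma cf_expand: "x \<in> span (simples D) \<Longrightarrow> x = (\<Sum>\<beta>\<in>simples D. cf x \<beta> *\<^sub>R \<beta>)"
  unfolding cf_def
  using real_vector.sum_representation_eq[OF simples_independent _ finite_simples order_refl] by force

lemma cf_eqI:
  assumes "x \<in> span (simples D)" "y \<in> span (simples D)" "\<And>\<beta>. \<beta> \<in> simples D \<Longrightarrow> cf x \<beta> = cf y \<beta>"
  shows "x = y"
proof -
  have "(\<Sum>\<beta>\<in>simples D. cf x \<beta> *\<^sub>R \<beta>) = (\<Sum>\<beta>\<in>simples D. cf y \<beta> *\<^sub>R \<beta>)"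
    using assms(3) by (intro sum.cong) auto
  then show ?thesis using cf_expand[OF assms(1)] cf_expand[OF assms(2)] by metis
qed

lemma root_sign:
  assumes "\<gamma> \<in> roots D"
  shows "(\<forall>\<beta>\<in>simples D. 0 \<le> cf \<gamma> \<beta>) \<or> (\<forall>\<beta>\<in>simples D. cf \<gamma> \<beta> \<le> 0)"
proof -
  obtain c where c: "\<gamma> = (\<Sum>\<beta>\<in>simples D. c \<beta> *\<^sub>R \<beta>)"
    "(\<forall>\<beta>\<in>simples D. 0 \<le> c \<beta>) \<or> (\<forall>\<beta>\<in>simples D. c \<beta> \<le> 0)" using simples_base[OF assms] by blast
  have "cf \<gamma> \<beta> = c \<beta>" if "\<beta> \<in> simples D" for \<beta>
  proof -
    have "cf \<gamma> \<beta> = (\<Sum>b\<in>simples D. c b * cf b \<beta>)"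
      unfolding c(1) by (rule cf_sum) (rule span_base)
    also have "\<dots> = (\<Sum>b\<in>simples D. if b = \<beta> then c b else 0)"
      by (rule sum.cong) (auto simp: cf_simple)
    finally show ?thesis using that finite_simples by simp
  qed
  then show ?thesis using c(2) by simp
qed

lemma cf_root_nonzero: "\<gamma> \<in> roots D \<Longrightarrow> \<exists>\<beta>\<in>simples D. cf \<gamma> \<beta> \<noteq> 0" (is "_ \<Longrightarrow> ?thesis")
proof (rule ccontr)
  assume \<gamma>: "\<gamma> \<in> roots D" and "\<not> ?thesis"
  then have "(\<Sum>\<beta>\<in>simples D. cf \<gamma> \<beta> *\<^sub>R \<beta>) = 0" by (intro sum.neutral) auto
  then show False using cf_expand[OF root_span[OF \<gamma>]] root_nonzero[OF \<gamma>] by simp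
qed

lemma pos_root: "pos \<gamma> \<Longrightarrow> \<gamma> \<in> roots D" by (simp add: pos_def)

lemma pos_simple: "\<alpha> \<in> simples D \<Longrightarrow> pos \<alpha>" by (simp add: pos_def simple_root cf_simple)

lemma pos_neg_iff:
  assumes \<gamma>: "\<gamma> \<in> roots D" shows "pos (- \<gamma>) \<longleftrightarrow> \<not> pos \<gamma>"
proof -
  obtain \<beta> where \<beta>: "\<beta> \<in> simples D" "cf \<gamma> \<beta> \<noteq> 0" using cf_root_nonzero[OF \<gamma>] by blast
  have neg: "pos (- \<gamma>) \<longleftrightarrow> (\<forall>\<beta>\<in>simples D. cf \<gamma> \<beta> \<le> 0)"
    unfolding pos_def using neg_root[OF \<gamma>] cf_neg[OF root_span[OF \<gamma>]] by simp
  have "pos \<gamma> \<longleftrightarrow> (\<forall>\<beta>\<in>simples D. 0 \<le> cf \<gamma> \<beta>)" unfolding pos_def using \<gamma> by simp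
  then show ?thesis using neg root_sign[OF \<gamma>] \<beta> by (metis order_antisym)
qed

lemma posI_cf: "\<gamma> \<in> roots D \<Longrightarrow> \<beta> \<in> simples D \<Longrightarrow> 0 < cf \<gamma> \<beta> \<Longrightarrow> pos \<gamma>"
  using root_sign[of \<gamma>] unfolding pos_def by force

lemma single_cf_root:
  assumes "pos \<gamma>" "\<alpha> \<in> simples D" "\<And>\<beta>. \<beta> \<in> simples D \<Longrightarrow> \<beta> \<noteq> \<alpha> \<Longrightarrow> cf \<gamma> \<beta> = 0"
  shows "\<gamma> = \<alpha>"
proof -
  have \<gamma>: "\<gamma> \<in> roots D" using assms(1) pos_root by blast
  have "\<gamma> = cf \<gamma> \<alpha> *\<^sub>R \<alpha>"
    by (rule cf_eqI) (use assms \<gamma> in \<open>auto simp: cf_scale span_base span_scale root_span cf_simple\<close>)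
  moreover have "cf \<gamma> \<alpha> \<ge> 0" using assms unfolding pos_def by blast
  ultimately show ?thesis
    using reduced[OF simple_root[OF assms(2)], of "cf \<gamma> \<alpha>"] \<gamma> by fastforce
qed

text \<open>
  Only the coordinate at \<open>\<alpha>\<close> changes, and by reducedness \<open>\<gamma>\<close> has a positive coordinate elsewhere.
\<close>

lemma refl_pos:
  assumes \<alpha>: "\<alpha> \<in> simples D" and \<gamma>: "pos \<gamma>" "\<gamma> \<noteq> \<alpha>"
  shows "pos (root_refl D \<alpha> \<gamma>)"
proof -
  obtain \<beta> where \<beta>: "\<beta> \<in> simples D" "\<beta> \<noteq> \<alpha>" "cf \<gamma> \<beta> \<noteq> 0" using single_cf_root[OF \<gamma>(1) \<alpha>] \<gamma>(2) by blast
  then have "cf \<gamma> \<beta> > 0" using \<gamma>(1) unfolding pos_def by force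
  moreover have "cf (root_refl D \<alpha> \<gamma>) \<beta> = cf \<gamma> \<beta>"
    using \<beta>(2) by (simp add: cf_refl \<alpha> root_span pos_root[OF \<gamma>(1)] cf_simple)
  ultimately show ?thesis using posI_cf refl_root \<alpha> \<beta> pos_root[OF \<gamma>(1)] simple_root by metis
qed


subsection \<open>Inversions and length\<close>

definition inversions :: "('v \<Rightarrow> 'v) \<Rightarrow> 'v set" where
  "inversions w = {\<gamma>. pos \<gamma> \<and> \<not> pos (w \<gamma>)}"

definition len :: "('v \<Rightarrow> 'v) \<Rightarrow> nat" where
  "len w = card (inversions w)"

lemma finite_inversions: "finite (inversions w)"
  by (rule finite_subset[OF _ roots_finite]) (auto simp: inversions_def pos_root)

lemma inversions_empty_iff: "inversions w = {} \<longleftrightarrow> len w = 0"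
  by (simp add: len_def finite_inversions)

lemma pos_weyl_neg: "w \<in> weyl D \<Longrightarrow> \<gamma> \<in> roots D \<Longrightarrow> pos (w (- \<gamma>)) \<longleftrightarrow> \<not> pos (w \<gamma>)"
  by (simp add: weyl_neg pos_neg_iff weyl_root)

lemma inversions_inv:
  assumes "w \<in> weyl D" shows "inversions (inv w) = (\<lambda>\<gamma>. - w \<gamma>) ` inversions w"
proof (intro equalityI subsetI)
  fix \<gamma> assume \<gamma>: "\<gamma> \<in> inversions (inv w)"
  then have r: "\<gamma> \<in> roots D" "inv w \<gamma> \<in> roots D"
    using pos_root weyl_root[OF weyl_inv[OF assms]] by (auto simp: inversions_def)
  have "- inv w \<gamma> \<in> inversions w"
    using \<gamma> r by (auto simp: inversions_def pos_neg_iff weyl_neg[OF assms] weyl_inv_apply[OF assms])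
  moreover have "\<gamma> = - w (- inv w \<gamma>)" by (simp add: weyl_neg[OF assms] weyl_inv_apply[OF assms])
  ultimately show "\<gamma> \<in> (\<lambda>\<gamma>. - w \<gamma>) ` inversions w" by blast
next
  fix \<mu> assume "\<mu> \<in> (\<lambda>\<gamma>. - w \<gamma>) ` inversions w"
  then obtain \<gamma> where "\<gamma> \<in> inversions w" "\<mu> = - w \<gamma>" by blast
  then show "\<mu> \<in> inversions (inv w)"
    using weyl_inv[OF assms] weyl_root[OF assms] pos_root
    by (auto simp: inversions_def pos_neg_iff weyl_neg[OF weyl_inv[OF assms]] weyl_inv_apply[OF assms])
qed

lemma len_inv: "w \<in> weyl D \<Longrightarrow> len (inv w) = len w"
  unfolding len_def
  by (subst inversions_inv, assumption, rule card_image)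
    (auto simp: inj_on_def dest: bij_is_inj[OF weyl_bij] injD)

text \<open>
  After \<open>w\<close>, the reflection \<open>s\<^sub>\<alpha>\<close> changes the sign of \<open>\<plusminus>\<alpha>\<close> only, so the inversion sets differ in \<open>w\<^sup>-\<^sup>1(\<alpha>)\<close>
  alone.
\<close>

lemma inversions_left_pos:
  assumes w: "w \<in> weyl D" and \<alpha>: "\<alpha> \<in> simples D" and p: "pos (inv w \<alpha>)"
  shows "inversions (root_refl D \<alpha> \<circ> w) = insert (inv w \<alpha>) (inversions w)" "inv w \<alpha> \<notin> inversions w"
proof -
  show n: "inv w \<alpha> \<notin> inversions w" using pos_simple[OF \<alpha>] by (simp add: inversions_def weyl_inv_apply[OF w])
  have "\<gamma> \<in> inversions (root_refl D \<alpha> \<circ> w) \<longleftrightarrow> \<gamma> \<in> insert (inv w \<alpha>) (inversions w)" if \<gamma>: "pos \<gamma>" for \<gamma>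
  proof (cases "\<gamma> = inv w \<alpha>")
    case True
    then show ?thesis using pos_simple[OF \<alpha>] p
      by (simp add: inversions_def weyl_inv_apply[OF w] refl_self simple_root \<alpha> pos_neg_iff)
  next
    case False
    have r: "w \<gamma> \<in> roots D" using \<gamma> pos_root weyl_root[OF w] by blast
    have ne: "w \<gamma> \<noteq> \<alpha>" using False weyl_inv_apply[OF w] by metis
    show ?thesis
    proof (cases "pos (w \<gamma>)")
      case True
      then show ?thesis using refl_pos[OF \<alpha> True ne] False \<gamma> by (simp add: inversions_def)
    next
      case neg: False
      have "- w \<gamma> \<noteq> \<alpha>"
      proof
        assume "- w \<gamma> = \<alpha>"
        then have "inv w \<alpha> = - \<gamma>" using weyl_neg[OF weyl_inv[OF w], of "w \<gamma>"] weyl_inv_apply[OF w] by simp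
        then show False using p \<gamma> pos_neg_iff pos_root by auto
      qed
      then have "pos (root_refl D \<alpha> (- w \<gamma>))" using refl_pos[OF \<alpha>] neg r pos_neg_iff by blast
      then have "\<not> pos (root_refl D \<alpha> (w \<gamma>))"
        using pos_neg_iff[OF refl_root[OF simple_root[OF \<alpha>] r]] linear_neg[OF linear_refl] by simp
      then show ?thesis using neg \<gamma> by (simp add: inversions_def)
    qed
  qed
  then show "inversions (root_refl D \<alpha> \<circ> w) = insert (inv w \<alpha>) (inversions w)"
    using p by (auto simp: inversions_def)
qed

lemma len_left_pos:
  "w \<in> weyl D \<Longrightarrow> \<alpha> \<in> simples D \<Longrightarrow> pos (inv w \<alpha>) \<Longrightarrow> len (root_refl D \<alpha> \<circ> w) = Suc (len w)"
  unfolding len_def using inversions_left_pos finite_inversions by simp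

lemma len_left_neg:
  assumes w: "w \<in> weyl D" and \<alpha>: "\<alpha> \<in> simples D" and n: "\<not> pos (inv w \<alpha>)"
  shows "len w = Suc (len (root_refl D \<alpha> \<circ> w))"
proof -
  let ?s = "root_refl D \<alpha>"
  have s: "?s \<in> weyl D" using refl_weyl simple_root \<alpha> by blast
  have sw: "?s \<circ> w \<in> weyl D" using weyl_comp s w by blast
  have "inv ?s = ?s" using inv_unique_comp refl_comp_refl simple_root[OF \<alpha>] by blast
  then have "inv (?s \<circ> w) = inv w \<circ> ?s" using o_inv_distrib[OF weyl_bij[OF s] weyl_bij[OF w]] by simp
  then have "inv (?s \<circ> w) \<alpha> = - inv w \<alpha>" by (simp add: refl_self simple_root \<alpha> weyl_neg weyl_inv w)
  moreover have "inv w \<alpha> \<in> roots D" using weyl_root weyl_inv w simple_root \<alpha> by blast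
  ultimately have "pos (inv (?s \<circ> w) \<alpha>)" using n pos_neg_iff by simp
  from len_left_pos[OF sw \<alpha> this] have "len (?s \<circ> (?s \<circ> w)) = Suc (len (?s \<circ> w))" .
  moreover have "?s \<circ> (?s \<circ> w) = w" by (simp add: fun_eq_iff refl_involution simple_root \<alpha>)
  ultimately show ?thesis by simp
qed

lemma refl_word_Cons: "refl_word D (\<alpha> # \<alpha>s) = root_refl D \<alpha> \<circ> refl_word D \<alpha>s"
  and refl_word_Nil: "refl_word D [] = id"
  by (simp_all add: refl_word_def)

lemma refl_word_group: "set \<alpha>s \<subseteq> A \<Longrightarrow> refl_word D \<alpha>s \<in> refl_group D A"
  by (induction \<alpha>s) (auto simp: refl_word_Cons refl_word_Nil simp del: comp_apply intro: refl_group.intros)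

lemma refl_group_word: "w \<in> refl_group D A \<Longrightarrow> \<exists>\<alpha>s. set \<alpha>s \<subseteq> A \<and> refl_word D \<alpha>s = w"
proof (induction rule: refl_group.induct)
  case one show ?case by (rule exI[of _ "[]"]) (simp add: refl_word_Nil)
next
  case (step \<alpha> w)
  then obtain \<alpha>s where "set \<alpha>s \<subseteq> A" "refl_word D \<alpha>s = w" by blast
  with step show ?case by (intro exI[of _ "\<alpha> # \<alpha>s"]) (simp add: refl_word_Cons)
qed

lemma word_weyl: "set \<alpha>s \<subseteq> simples D \<Longrightarrow> refl_word D \<alpha>s \<in> weyl D"
  using refl_word_group simple_group_weyl by blast

lemma inv_refl_comp:
  assumes "w \<in> weyl D" "\<alpha> \<in> roots D"
  shows "inv (root_refl D \<alpha> \<circ> w) = inv w \<circ> root_refl D \<alpha>"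
proof -
  have "inv (root_refl D \<alpha>) = root_refl D \<alpha>" using inv_unique_comp refl_comp_refl assms(2) by blast
  then show ?thesis using o_inv_distrib[OF weyl_bij[OF refl_weyl[OF assms(2)]] weyl_bij[OF assms(1)]] by simp
qed

text \<open>
  As the letters of the word act on \<open>\<gamma>\<close> one after another, its sign has to change somewhere. At that
  letter the current image of \<open>\<gamma>\<close> is the simple root itself, and \<open>s\<^sub>\<gamma>\<close> cancels the letter.
\<close>

lemma exchange:
  assumes "set \<alpha>s \<subseteq> simples D" "pos \<gamma>" "\<not> pos (inv (refl_word D \<alpha>s) \<gamma>)"
  shows "\<exists>\<beta>s. set \<beta>s \<subseteq> set \<alpha>s \<and> Suc (length \<beta>s) = length \<alpha>s \<and> refl_word D \<beta>s = root_refl D \<gamma> \<circ> refl_word D \<alpha>s"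
  using assms
proof (induction \<alpha>s arbitrary: \<gamma>)
  case Nil
  then show ?case by (simp add: refl_word_Nil inv_id[unfolded id_def] id_def)
next
  case (Cons \<beta> \<alpha>s)
  let ?w = "refl_word D \<alpha>s"
  have \<beta>: "\<beta> \<in> simples D" and w: "?w \<in> weyl D" using Cons.prems word_weyl by auto
  show ?case
  proof (cases "\<gamma> = \<beta>")
    case True
    then show ?thesis using refl_involution[OF simple_root[OF \<beta>]]
      by (intro exI[of _ \<alpha>s]) (auto simp: refl_word_Cons fun_eq_iff)
  next
    case False
    let ?g = "root_refl D \<beta> \<gamma>"
    have g: "pos ?g" using refl_pos[OF \<beta> Cons.prems(2) False] .
    have "inv (refl_word D (\<beta> # \<alpha>s)) \<gamma> = inv ?w ?g"
      unfolding refl_word_Cons inv_refl_comp[OF w simple_root[OF \<beta>]] by (rule o_apply)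
    then have n: "\<not> pos (inv ?w ?g)" using Cons.prems(3) by simp
    have "set \<alpha>s \<subseteq> simples D" using Cons.prems(1) by simp
    from Cons.IH[OF this g n] obtain \<beta>s where \<beta>s: "set \<beta>s \<subseteq> set \<alpha>s" "Suc (length \<beta>s) = length \<alpha>s"
      "refl_word D \<beta>s = root_refl D ?g \<circ> ?w" by blast
    have "root_refl D \<beta> (root_refl D ?g x) = root_refl D \<gamma> (root_refl D \<beta> x)" for x
      using refl_conj[OF simple_root[OF \<beta>] pos_root[OF Cons.prems(2)], of "root_refl D \<beta> x"]
      by (simp add: refl_involution simple_root \<beta>)
    then have "refl_word D (\<beta> # \<beta>s) = root_refl D \<gamma> \<circ> refl_word D (\<beta> # \<alpha>s)"
      by (simp add: refl_word_Cons \<beta>s fun_eq_iff)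
    then show ?thesis using \<beta>s(1,2) by (intro exI[of _ "\<beta> # \<beta>s"]) auto
  qed
qed

text \<open>
  In a shortest nonempty word for \<open>w\<close>, the element without the first letter \<open>\<alpha>\<close> has \<open>\<alpha>\<close> as inversion of
  its inverse, and the exchange property would shorten the word by two letters.
\<close>

lemma no_inversions_simple_group:
  assumes "w \<in> refl_group D (simples D)" "inversions w = {}"
  shows "w = id"
proof -
  define L where "L = (LEAST n. \<exists>\<alpha>s. set \<alpha>s \<subseteq> simples D \<and> length \<alpha>s = n \<and> refl_word D \<alpha>s = w)"
  have w: "w \<in> weyl D" using assms(1) simple_group_weyl by blast
  have ex: "\<exists>\<alpha>s. set \<alpha>s \<subseteq> simples D \<and> length \<alpha>s = L \<and> refl_word D \<alpha>s = w"
    unfolding L_def by (rule LeastI_ex) (use refl_group_word[OF assms(1)] in blast)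
  then obtain \<alpha>s where \<alpha>s: "set \<alpha>s \<subseteq> simples D" "length \<alpha>s = L" "refl_word D \<alpha>s = w" by blast
  show ?thesis
  proof (cases \<alpha>s)
    case Nil then show ?thesis using \<alpha>s refl_word_Nil by simp
  next
    case (Cons \<alpha> \<beta>s)
    let ?v = "refl_word D \<beta>s"
    have \<alpha>: "\<alpha> \<in> simples D" and v: "?v \<in> weyl D" using \<alpha>s Cons word_weyl by auto
    have wv: "w = root_refl D \<alpha> \<circ> ?v" using \<alpha>s Cons by (simp only: refl_word_Cons)
    have "inversions (inv w) = {}" using assms(2) inversions_inv[OF w] by simp
    then have "pos (inv w \<alpha>)" using pos_simple[OF \<alpha>] by (auto simp: inversions_def)
    moreover have "inv w \<alpha> = - inv ?v \<alpha>"
      unfolding wv using inv_refl_comp[OF v simple_root[OF \<alpha>]]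
      by (simp add: refl_self simple_root \<alpha> weyl_neg weyl_inv v)
    ultimately have "\<not> pos (inv ?v \<alpha>)"
      using pos_neg_iff[OF weyl_root[OF weyl_inv[OF v] simple_root[OF \<alpha>]]] by simp
    moreover have \<beta>s: "set \<beta>s \<subseteq> simples D" using \<alpha>s Cons by simp
    ultimately obtain \<gamma>s where \<gamma>s: "set \<gamma>s \<subseteq> set \<beta>s" "Suc (length \<gamma>s) = length \<beta>s" "refl_word D \<gamma>s = w"
      using exchange[OF _ pos_simple[OF \<alpha>], of \<beta>s] unfolding wv by blast
    then have "L \<le> length \<gamma>s" unfolding L_def using \<beta>s by (intro Least_le) blast
    then show ?thesis using \<alpha>s Cons \<open>Suc (length \<gamma>s) = length \<beta>s\<close> by simp
  qed
qed

lemma len_bounded: "len w \<le> card (roots D)"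
  unfolding len_def by (rule card_mono[OF roots_finite]) (auto simp: inversions_def pos_root)

lemma ex_max_len:
  assumes "M \<subseteq> simples D"
  obtains u where "u \<in> refl_group D M" "\<And>v. v \<in> refl_group D M \<Longrightarrow> len v \<le> len u"
proof -
  have "\<exists>u. u \<in> refl_group D M \<and> (\<forall>v. v \<in> refl_group D M \<longrightarrow> len v \<le> len u)"
    by (rule ex_has_greatest_nat[of _ id _ "Suc (card (roots D))"])
      (simp_all add: refl_group.one less_Suc_eq_le len_bounded)
  then show ?thesis using that by blast
qed

lemma max_len_neg_left:
  assumes M: "M \<subseteq> simples D" and u: "u \<in> refl_group D M" "\<And>v. v \<in> refl_group D M \<Longrightarrow> len v \<le> len u"
    and \<beta>: "\<beta> \<in> M"
  shows "\<not> pos (inv u \<beta>)"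
proof
  assume "pos (inv u \<beta>)"
  then have "len (root_refl D \<beta> \<circ> u) = Suc (len u)"
    using len_left_pos simple_group_weyl[OF M u(1)] M \<beta> by blast
  moreover have "len (root_refl D \<beta> \<circ> u) \<le> len u" by (rule u(2)) (use \<beta> u(1) in \<open>rule refl_group.step\<close>)
  ultimately show False by simp
qed

lemma linear_pos_combination:
  assumes \<gamma>: "pos \<gamma>" and f: "linear f" "f \<gamma> \<in> roots D"
    "\<And>\<beta>. \<beta> \<in> simples D \<Longrightarrow> cf \<gamma> \<beta> \<noteq> 0 \<Longrightarrow> pos (f \<beta>)"
  shows "pos (f \<gamma>)"
proof -
  let ?I = "{\<beta>\<in>simples D. cf \<gamma> \<beta> \<noteq> 0}"
  have "\<gamma> = (\<Sum>\<beta>\<in>simples D. cf \<gamma> \<beta> *\<^sub>R \<beta>)" by (rule cf_expand[OF root_span[OF pos_root[OF \<gamma>]]])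
  also have "\<dots> = (\<Sum>\<beta>\<in>?I. cf \<gamma> \<beta> *\<^sub>R \<beta>)"
    by (rule sum.mono_neutral_right[OF finite_simples]) auto
  finally have "f \<gamma> = f (\<Sum>\<beta>\<in>?I. cf \<gamma> \<beta> *\<^sub>R \<beta>)" by (rule arg_cong)
  also have "\<dots> = (\<Sum>\<beta>\<in>?I. cf \<gamma> \<beta> *\<^sub>R f \<beta>)"
    by (simp only: linear_sum[OF f(1)] linear_scale[OF f(1)])
  finally have "f \<gamma> = (\<Sum>\<beta>\<in>?I. cf \<gamma> \<beta> *\<^sub>R f \<beta>)" .
  moreover have "cf (\<Sum>\<beta>\<in>?I. cf \<gamma> \<beta> *\<^sub>R f \<beta>) b \<ge> 0" if "b \<in> simples D" for b
  proof -
    have "cf (\<Sum>\<beta>\<in>?I. cf \<gamma> \<beta> *\<^sub>R f \<beta>) b = (\<Sum>\<beta>\<in>?I. cf \<gamma> \<beta> * cf (f \<beta>) b)"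
      by (rule cf_sum) (use f(3) root_span pos_root in blast)
    also have "\<dots> \<ge> 0" using \<gamma> f(3) that by (intro sum_nonneg mult_nonneg_nonneg) (auto simp: pos_def)
    finally show ?thesis .
  qed
  ultimately show ?thesis using f(2) by (simp add: pos_def)
qed

text \<open>
  An element \<open>u\<close> of maximal length in the group generated by the simple reflections has an inverse that
  makes every positive root \<open>\<gamma>\<close> negative. The exchange property then expresses \<open>s\<^sub>\<gamma> u\<close> as a word in simple
  reflections, so \<open>s\<^sub>\<gamma>\<close> itself belongs to that group.
\<close>

theorem weyl_simple_group: "weyl D = refl_group D (simples D)"
proof
  show "refl_group D (simples D) \<subseteq> weyl D" using simple_group_weyl by blast
  obtain u where u: "u \<in> refl_group D (simples D)" "\<And>v. v \<in> refl_group D (simples D) \<Longrightarrow> len v \<le> len u"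
    using ex_max_len by blast
  have uW: "u \<in> weyl D" using u(1) simple_group_weyl by blast
  obtain \<alpha>s where \<alpha>s: "set \<alpha>s \<subseteq> simples D" "refl_word D \<alpha>s = u" using refl_group_word[OF u(1)] by blast
  have neg: "\<not> pos (inv u \<gamma>)" if \<gamma>: "pos \<gamma>" for \<gamma>
  proof -
    have r: "inv u x \<in> roots D" if "x \<in> roots D" for x using weyl_root[OF weyl_inv[OF uW] that] .
    have "pos (- inv u \<gamma>)"
    proof (rule linear_pos_combination[OF \<gamma>, of "\<lambda>x. - inv u x"])
      show "linear (\<lambda>x. - inv u x)" using weyl_linear[OF weyl_inv[OF uW]] by (rule linear_compose_neg)
      show "- inv u \<gamma> \<in> roots D" using r pos_root[OF \<gamma>] neg_root by blast
      show "pos (- inv u \<beta>)" if "\<beta> \<in> simples D" for \<beta>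
        using max_len_neg_left[OF order_refl u that] pos_neg_iff r simple_root that by blast
    qed
    then show ?thesis using pos_neg_iff r pos_root[OF \<gamma>] by blast
  qed
  have "root_refl D \<gamma> \<in> refl_group D (simples D)" if \<gamma>: "pos \<gamma>" for \<gamma>
  proof -
    obtain \<beta>s where "set \<beta>s \<subseteq> simples D" "refl_word D \<beta>s = root_refl D \<gamma> \<circ> u"
      using exchange[OF \<alpha>s(1) \<gamma>] neg[OF \<gamma>] \<alpha>s by blast
    then have "root_refl D \<gamma> \<circ> u \<in> refl_group D (simples D)" using refl_word_group by metis
    then have "(root_refl D \<gamma> \<circ> u) \<circ> inv u \<in> refl_group D (simples D)"
      using refl_group_comp refl_group_bij_inv[OF simples_roots u(1)] by blast
    then show ?thesis by (simp add: comp_assoc weyl_inv_comp(2)[OF uW])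
  qed
  moreover have "root_refl D (- \<gamma>) = root_refl D \<gamma>" if "\<gamma> \<in> roots D" for \<gamma>
    using weyl_refl_conj'[OF refl_weyl[OF that] that] refl_self[OF that] refl_comp_refl[OF that]
      inv_unique_comp[of "root_refl D \<gamma>" "root_refl D \<gamma>"] by simp
  ultimately have refl: "root_refl D \<gamma> \<in> refl_group D (simples D)" if "\<gamma> \<in> roots D" for \<gamma>
    using that pos_neg_iff by metis
  show "weyl D \<subseteq> refl_group D (simples D)"
  proof
    fix w assume "w \<in> weyl D"
    then show "w \<in> refl_group D (simples D)" unfolding weyl_def
      by (induction rule: refl_group.induct) (blast intro: refl refl_group_comp refl_group.one)+
  qed
qed

lemma no_inversions: "w \<in> weyl D \<Longrightarrow> inversions w = {} \<Longrightarrow> w = id"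
  using no_inversions_simple_group weyl_simple_group by blast

text \<open>
  Equal inversion sets mean that \<open>v w\<^sup>-\<^sup>1\<close> keeps all positive roots positive.
\<close>

lemma inversions_eq_imp_eq:
  assumes v: "v \<in> weyl D" and w: "w \<in> weyl D" and eq: "inversions v = inversions w"
  shows "v = w"
proof -
  have "pos (v (inv w \<gamma>))" if \<gamma>: "pos \<gamma>" for \<gamma>
  proof -
    let ?m = "inv w \<gamma>"
    have m: "?m \<in> roots D" "w ?m = \<gamma>" using weyl_root[OF weyl_inv[OF w]] pos_root[OF \<gamma>] weyl_inv_apply[OF w] by auto
    show ?thesis
    proof (cases "pos ?m")
      case True
      then have "?m \<notin> inversions v" using eq \<gamma> m by (simp add: inversions_def)
      then show ?thesis using True by (simp add: inversions_def)
    next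
      case False
      then have "- ?m \<in> inversions w"
        using m \<gamma> pos_neg_iff[of ?m] pos_weyl_neg[OF w, of ?m] by (simp add: inversions_def)
      then have "\<not> pos (v (- ?m))" using eq by (auto simp: inversions_def)
      then show ?thesis using pos_weyl_neg[OF v m(1)] by blast
    qed
  qed
  then have "inversions (v \<circ> inv w) = {}" by (auto simp: inversions_def)
  then have "v \<circ> inv w = id" using no_inversions weyl_comp[OF v weyl_inv[OF w]] by blast
  then have "v \<circ> inv w \<circ> w = w" by simp
  then show ?thesis using weyl_inv_comp(1)[OF w] by (simp only: comp_assoc comp_id)
qed

lemma finite_weyl: "finite (weyl D)"
proof (rule finite_imageD)
  show "inj_on inversions (weyl D)" using inversions_eq_imp_eq by (auto intro: inj_onI)
  have "inversions ` weyl D \<subseteq> Pow (roots D)" using pos_root by (auto simp: inversions_def)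
  then show "finite (inversions ` weyl D)" using roots_finite finite_subset by blast
qed

subsection \<open>Standard parabolic subgroups\<close>

text \<open>
  Membership of a root in the span of \<open>M\<close>, read off from its coordinates.
\<close>

definition in_span :: "'v set \<Rightarrow> 'v \<Rightarrow> bool" where
  "in_span M x \<longleftrightarrow> (\<forall>\<beta>\<in>simples D - M. cf x \<beta> = 0)"

lemma levi_cf:
  assumes M: "M \<subseteq> simples D" and u: "u \<in> refl_group D M" and x: "x \<in> roots D" and \<beta>: "\<beta> \<in> simples D - M"
  shows "cf (u x) \<beta> = cf x \<beta>"
  using u
proof (induction rule: refl_group.induct)
  case (step \<alpha> w)
  have "w x \<in> roots D" using weyl_root[OF simple_group_weyl[OF M step.hyps(2)] x] .
  moreover have "\<alpha> \<in> simples D" "\<alpha> \<noteq> \<beta>" using step.hyps(1) M \<beta> by auto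
  ultimately have "cf (root_refl D \<alpha> (w x)) \<beta> = cf (w x) \<beta>"
    by (simp add: cf_refl root_span cf_simple)
  then show ?case using step.IH by simp
qed simp

text \<open>
  Elements of \<open>W\<^sub>M\<close> do not change coordinates outside \<open>M\<close>, and one positive coordinate keeps a root
  positive.
\<close>

lemma inversions_levi_in_span:
  assumes M: "M \<subseteq> simples D" and u: "u \<in> refl_group D M" and \<gamma>: "\<gamma> \<in> inversions u"
  shows "in_span M \<gamma>"
proof (rule ccontr)
  assume "\<not> in_span M \<gamma>"
  then obtain \<beta> where \<beta>: "\<beta> \<in> simples D - M" "cf \<gamma> \<beta> \<noteq> 0" by (auto simp: in_span_def)
  have p: "pos \<gamma>" "\<not> pos (u \<gamma>)" using \<gamma> by (auto simp: inversions_def)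
  then have "cf \<gamma> \<beta> > 0" using \<beta> by (force simp: pos_def)
  then have "cf (u \<gamma>) \<beta> > 0" using levi_cf[OF M u pos_root[OF p(1)] \<beta>(1)] by simp
  then show False
    using posI_cf[OF weyl_root[OF simple_group_weyl[OF M u] pos_root[OF p(1)]]] \<beta>(1) p(2) by blast
qed

lemma pos_on_span:
  assumes w: "w \<in> weyl D" and p: "\<And>\<beta>. \<beta> \<in> M \<Longrightarrow> pos (w \<beta>)" and \<gamma>: "pos \<gamma>" "in_span M \<gamma>"
  shows "pos (w \<gamma>)"
proof (rule linear_pos_combination[OF \<gamma>(1) weyl_linear[OF w] weyl_root[OF w pos_root[OF \<gamma>(1)]]])
  fix \<beta> assume "\<beta> \<in> simples D" "cf \<gamma> \<beta> \<noteq> 0"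
  then have "\<beta> \<in> M" using \<gamma>(2) by (auto simp: in_span_def)
  then show "pos (w \<beta>)" by (rule p)
qed

lemma neg_on_span:
  assumes w: "w \<in> weyl D" and p: "\<And>\<beta>. \<beta> \<in> M \<Longrightarrow> \<not> pos (w \<beta>)" and M: "M \<subseteq> simples D"
    and \<gamma>: "pos \<gamma>" "in_span M \<gamma>"
  shows "\<not> pos (w \<gamma>)"
proof -
  have "pos (- w \<gamma>)"
  proof (rule linear_pos_combination[OF \<gamma>(1), of "\<lambda>x. - w x"])
    show "linear (\<lambda>x. - w x)" using weyl_linear[OF w] by (rule linear_compose_neg)
    show "- w \<gamma> \<in> roots D" using neg_root weyl_root[OF w pos_root[OF \<gamma>(1)]] by blast
    fix \<beta> assume "\<beta> \<in> simples D" "cf \<gamma> \<beta> \<noteq> 0"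
    then have "\<beta> \<in> M" using \<gamma>(2) by (auto simp: in_span_def)
    then show "pos (- w \<beta>)" using p M pos_neg_iff weyl_root[OF w simple_root] by blast
  qed
  then show ?thesis using pos_neg_iff weyl_root[OF w pos_root[OF \<gamma>(1)]] by blast
qed

lemma levi_pos_imp_id:
  assumes M: "M \<subseteq> simples D" and u: "u \<in> refl_group D M" and p: "\<And>\<beta>. \<beta> \<in> M \<Longrightarrow> pos (u \<beta>)"
  shows "u = id"
proof (rule no_inversions)
  show uW: "u \<in> weyl D" using simple_group_weyl[OF M u] .
  have "pos (u \<gamma>)" if "pos \<gamma>" for \<gamma>
    using inversions_levi_in_span[OF M u] pos_on_span[OF uW p] that by (auto simp: inversions_def)
  then show "inversions u = {}" by (auto simp: inversions_def)
qed

lemma levi_reduced_word: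
  assumes M: "M \<subseteq> simples D"
  shows "u \<in> refl_group D M \<Longrightarrow> \<exists>\<alpha>s. set \<alpha>s \<subseteq> M \<and> refl_word D \<alpha>s = u \<and> length \<alpha>s = len u"
proof (induction "len u" arbitrary: u)
  case 0
  then have "u = id" using no_inversions simple_group_weyl[OF M] inversions_empty_iff by metis
  then show ?case using 0 by (intro exI[of _ "[]"]) (simp add: refl_word_Nil)
next
  case (Suc n)
  have u: "u \<in> weyl D" using simple_group_weyl[OF M Suc.prems] .
  have iu: "inv u \<in> refl_group D M" using refl_group_bij_inv[OF _ Suc.prems] M simples_roots by blast
  have "inv u \<noteq> id"
  proof
    assume "inv u = id"
    then have "len (inv u) = 0" by (simp add: len_def inversions_def)
    then show False using len_inv[OF u] Suc.hyps(2) by simp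
  qed
  then obtain \<alpha> where \<alpha>: "\<alpha> \<in> M" "\<not> pos (inv u \<alpha>)" using levi_pos_imp_id[OF M iu] by blast
  let ?v = "root_refl D \<alpha> \<circ> u"
  have \<alpha>s: "\<alpha> \<in> simples D" using M \<alpha> by blast
  have "n = len ?v" using len_left_neg[OF u \<alpha>s \<alpha>(2)] Suc.hyps(2) by simp
  moreover have "?v \<in> refl_group D M" using refl_group.step[OF \<alpha>(1) Suc.prems] .
  ultimately obtain \<beta>s where \<beta>s: "set \<beta>s \<subseteq> M" "refl_word D \<beta>s = ?v" "length \<beta>s = n"
    using Suc.hyps(1)[of ?v] by auto
  have "refl_word D (\<alpha> # \<beta>s) = u" unfolding refl_word_Cons \<beta>s(2)
    by (rule ext) (simp add: refl_involution simple_root \<alpha>s)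
  then show ?case using \<beta>s \<alpha>(1) Suc.hyps(2) by (intro exI[of _ "\<alpha> # \<beta>s"]) auto
qed

lemma len_word_le: "set \<alpha>s \<subseteq> simples D \<Longrightarrow> len (refl_word D \<alpha>s) \<le> length \<alpha>s"
proof (induction \<alpha>s)
  case Nil
  then show ?case by (simp add: refl_word_Nil len_def inversions_def)
next
  case (Cons \<alpha> \<alpha>s)
  have \<alpha>: "\<alpha> \<in> simples D" and w: "refl_word D \<alpha>s \<in> weyl D" and IH: "len (refl_word D \<alpha>s) \<le> length \<alpha>s"
    using Cons word_weyl by auto
  have "len (root_refl D \<alpha> \<circ> refl_word D \<alpha>s) \<le> Suc (len (refl_word D \<alpha>s))"
    using len_left_pos[OF w \<alpha>] len_left_neg[OF w \<alpha>] by (cases "pos (inv (refl_word D \<alpha>s) \<alpha>)") simp_all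
  then have "len (refl_word D (\<alpha> # \<alpha>s)) \<le> Suc (len (refl_word D \<alpha>s))" by (subst refl_word_Cons)
  then show ?case using IH by simp
qed

lemma wlength_eq_len: "w \<in> weyl D \<Longrightarrow> wlength D w = len w"
  unfolding wlength_def
proof (rule Least_equality)
  assume "w \<in> weyl D"
  then show "\<exists>\<alpha>s. set \<alpha>s \<subseteq> simples D \<and> length \<alpha>s = len w \<and> refl_word D \<alpha>s = w"
    using levi_reduced_word[OF order_refl] weyl_simple_group by blast
next
  fix n assume "\<exists>\<alpha>s. set \<alpha>s \<subseteq> simples D \<and> length \<alpha>s = n \<and> refl_word D \<alpha>s = w"
  then show "len w \<le> n" using len_word_le by blast
qed

lemma reduced_expression_iff: "reduced_expression D w \<alpha>s \<longleftrightarrow>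
    set \<alpha>s \<subseteq> simples D \<and> refl_word D \<alpha>s = w \<and> length \<alpha>s = len w"
  unfolding reduced_expression_def using wlength_eq_len[OF word_weyl, of \<alpha>s] by auto


lemma len_refl_comp: "w \<in> weyl D \<Longrightarrow> \<alpha> \<in> simples D \<Longrightarrow> len (root_refl D \<alpha> \<circ> w) \<le> Suc (len w)"
  using len_left_pos[of w \<alpha>] len_left_neg[of w \<alpha>] by (cases "pos (inv w \<alpha>)") auto

text \<open>
  Two elements \<open>u\<close>, \<open>v\<close> of maximal length both make \<open>M\<close> negative, as do their inverses, so \<open>v\<^sup>-\<^sup>1 u\<close> keeps
  \<open>M\<close> positive and is trivial. The inverse of an element of maximal length has maximal length as well,
  whence the involution.
\<close>

lemma longest_spec:
  assumes M: "M \<subseteq> simples D"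
  defines "u \<equiv> longest D (refl_group D M)"
  shows "u \<in> refl_group D M" "\<And>\<beta>. \<beta> \<in> M \<Longrightarrow> \<not> pos (u \<beta>)" "inv u = u"
proof -
  define mx where "mx u \<longleftrightarrow> u \<in> refl_group D M \<and> (\<forall>v\<in>refl_group D M. len v \<le> len u)" for u
  have inv_mx: "mx (inv u)" if "mx u" for u
    using that refl_group_bij_inv[of M u] M simples_roots len_inv[OF simple_group_weyl[OF M]]
    unfolding mx_def by auto
  have neg: "\<not> pos (u \<beta>)" if "mx u" "\<beta> \<in> M" for u \<beta>
  proof -
    have "\<not> pos (inv (inv u) \<beta>)"
      using max_len_neg_left[OF M _ _ that(2), of "inv u"] inv_mx[OF that(1)] unfolding mx_def by blast
    moreover have "inv (inv u) = u"
      using that(1) inv_inv_eq weyl_bij simple_group_weyl[OF M] unfolding mx_def by blast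
    ultimately show ?thesis by simp
  qed
  have uniq: "u = v" if "mx u" "mx v" for u v
  proof -
    have uv: "u \<in> refl_group D M" "v \<in> refl_group D M" "inv v \<in> refl_group D M"
      using that inv_mx unfolding mx_def by blast+
    note W = uv[THEN simple_group_weyl[OF M]]
    have "pos (inv v (u \<beta>))" if \<beta>: "\<beta> \<in> M" for \<beta>
    proof -
      have \<beta>s: "\<beta> \<in> simples D" using M \<beta> by blast
      have r: "u \<beta> \<in> roots D" using weyl_root[OF W(1)] simple_root \<beta>s by blast
      have p: "pos (- u \<beta>)" using neg[OF \<open>mx u\<close> \<beta>] r pos_neg_iff by blast
      have "in_span M (- u \<beta>)"
        unfolding in_span_def
      proof
        fix b assume b: "b \<in> simples D - M"
        then have "cf (u \<beta>) b = cf \<beta> b" by (rule levi_cf[OF M uv(1) simple_root[OF \<beta>s]])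
        then show "cf (- u \<beta>) b = 0" using b \<beta> by (auto simp: cf_neg root_span r cf_simple \<beta>s)
      qed
      then have "\<not> pos (inv v (- u \<beta>))" using neg_on_span[OF W(3) neg[OF inv_mx[OF \<open>mx v\<close>]] M p] by blast
      then show ?thesis using pos_weyl_neg[OF W(3) r] by blast
    qed
    then have "inv v \<circ> u = id" using levi_pos_imp_id[OF M refl_group_comp[OF uv(3,1)]] by simp
    then have "v \<circ> (inv v \<circ> u) = v" by simp
    then show ?thesis using weyl_inv_comp(2)[OF W(2)] by (metis comp_assoc id_comp)
  qed
  obtain m where m: "mx m" using ex_max_len[OF M] unfolding mx_def by metis
  have "u = (THE w. mx w)" unfolding u_def longest_def mx_def
    by (rule arg_cong[of _ _ The])
      (use wlength_eq_len simple_group_weyl[OF M] in \<open>auto simp: fun_eq_iff\<close>)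
  then have u: "mx u" using m uniq by (metis theI)
  show "u \<in> refl_group D M" "\<And>\<beta>. \<beta> \<in> M \<Longrightarrow> \<not> pos (u \<beta>)" "inv u = u"
    using u neg uniq inv_mx unfolding mx_def by blast+
qed

text \<open>
  The map \<open>-u\<close> is an involution of the positive roots in the span of \<open>M\<close>. Applying it to the expansion of
  \<open>-u(\<beta>)\<close> in simple roots writes \<open>\<beta>\<close> as a nonnegative combination of positive roots. Since \<open>\<beta>\<close> is simple,
  all of these with nonzero coefficient are multiples of \<open>\<beta>\<close>.
\<close>

lemma longest_permutes:
  assumes M: "M \<subseteq> simples D" and \<beta>: "\<beta> \<in> M"
  defines "u \<equiv> longest D (refl_group D M)"
  shows "- u \<beta> \<in> M"
proof -
  note u = longest_spec[OF M, folded u_def]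
  have W: "u \<in> weyl D" using simple_group_weyl[OF M u(1)] .
  have \<beta>s: "\<beta> \<in> simples D" using M \<beta> by blast
  let ?g = "- u \<beta>"
  have r: "u b \<in> roots D" if "b \<in> M" for b using weyl_root[OF W] simple_root M that by blast
  have pneg: "pos (- u b)" if "b \<in> M" for b using u(2)[OF that] r[OF that] pos_neg_iff by blast
  have uu: "u (u x) = x" for x using weyl_inv_apply(1)[OF W] u(3) by simp
  have span: "in_span M ?g" unfolding in_span_def
  proof
    fix b assume b: "b \<in> simples D - M"
    then have "cf (u \<beta>) b = cf \<beta> b" by (rule levi_cf[OF M u(1) simple_root[OF \<beta>s]])
    then show "cf ?g b = 0" using b \<beta> by (auto simp: cf_neg root_span r cf_simple \<beta>s)
  qed
  define c where "c = cf ?g"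
  have g: "?g = (\<Sum>b\<in>simples D. c b *\<^sub>R b)"
    unfolding c_def by (rule cf_expand[OF root_span[OF pos_root[OF pneg[OF \<beta>]]]])
  also have "\<dots> = (\<Sum>b\<in>M. c b *\<^sub>R b)"
    using span finite_simples M by (intro sum.mono_neutral_right) (auto simp: c_def in_span_def)
  finally have g: "?g = (\<Sum>b\<in>M. c b *\<^sub>R b)" .
  have "\<beta> = - u ?g" by (simp add: weyl_neg[OF W] uu)
  also have "\<dots> = (\<Sum>b\<in>M. c b *\<^sub>R (- u b))" unfolding g
    by (simp add: linear_sum[OF weyl_linear[OF W]] linear_scale[OF weyl_linear[OF W]] sum_negf)
  finally have \<beta>eq: "\<beta> = (\<Sum>b\<in>M. c b *\<^sub>R (- u b))" .
  have c0: "c b \<ge> 0" if "b \<in> M" for b using pneg[OF \<beta>] that M unfolding c_def pos_def by blast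
  obtain b where b: "b \<in> M" "c b \<noteq> 0"
    using g root_nonzero[OF pos_root[OF pneg[OF \<beta>]]] by (metis (no_types, lifting) scale_zero_left sum.neutral)
  have "cf (- u b) d = 0" if d: "d \<in> simples D" "d \<noteq> \<beta>" for d
  proof -
    have "0 = cf \<beta> d" using d by (simp add: cf_simple \<beta>s)
    also have "\<dots> = (\<Sum>b\<in>M. c b * cf (- u b) d)" unfolding \<beta>eq
      by (rule cf_sum) (use pneg pos_root root_span in blast)
    finally have "(\<Sum>b\<in>M. c b * cf (- u b) d) = 0" by simp
    moreover have "0 \<le> c b * cf (- u b) d" if "b \<in> M" for b
      using c0[OF that] pneg[OF that] d by (simp add: pos_def)
    ultimately have "c b * cf (- u b) d = 0"
      using sum_nonneg_eq_0_iff[of M] finite_subset[OF M finite_simples] b(1) by (metis (no_types, lifting))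
    then show ?thesis using b(2) by simp
  qed
  then have "- u b = \<beta>" using single_cf_root[OF pneg[OF b(1)] \<beta>s] by blast
  then have "- u \<beta> = b" using uu[of b] weyl_neg[OF W, of "u b"] by auto
  then show ?thesis using b(1) by simp
qed

subsection \<open>Minimal length coset representatives\<close>

lemma len_right_neg:
  assumes w: "w \<in> weyl D" and \<beta>: "\<beta> \<in> simples D" and n: "\<not> pos (w \<beta>)"
  shows "len (w \<circ> root_refl D \<beta>) < len w"
proof -
  have iw: "inv w \<in> weyl D" "inv (inv w) = w" using weyl_inv[OF w] inv_inv_eq[OF weyl_bij[OF w]] by auto
  have s: "root_refl D \<beta> \<in> weyl D" using refl_weyl simple_root \<beta> by blast
  have "inv (root_refl D \<beta> \<circ> inv w) = w \<circ> root_refl D \<beta>"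
    using inv_refl_comp[OF iw(1) simple_root[OF \<beta>]] iw(2) by simp
  then have "len (w \<circ> root_refl D \<beta>) = len (root_refl D \<beta> \<circ> inv w)"
    using len_inv[OF weyl_comp[OF s iw(1)]] by simp
  moreover have "len (inv w) = Suc (len (root_refl D \<beta> \<circ> inv w))"
    using len_left_neg[OF iw(1) \<beta>] n iw(2) by simp
  ultimately show ?thesis using len_inv[OF w] by simp
qed

lemma min_repD:
  assumes M: "M \<subseteq> simples D" and d: "d \<in> min_reps D M"
  shows "d \<in> weyl D" "\<And>\<beta>. \<beta> \<in> M \<Longrightarrow> pos (d \<beta>)" "\<And>u. u \<in> refl_group D M \<Longrightarrow> len d \<le> len (d \<circ> u)"
proof -
  show dW: "d \<in> weyl D" using d by (simp add: min_reps_def)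
  show le: "len d \<le> len (d \<circ> u)" if "u \<in> refl_group D M" for u
    using d that wlength_eq_len[OF dW] wlength_eq_len[OF weyl_comp[OF dW simple_group_weyl[OF M that]]]
    by (auto simp: min_reps_def)
  show "pos (d \<beta>)" if "\<beta> \<in> M" for \<beta>
    using len_right_neg[OF dW, of \<beta>] le[OF refl_group_refl[OF that]] M that by force
qed

text \<open>
  If \<open>u\<close> made some \<open>\<beta>\<close> in \<open>M\<close> negative, then \<open>-u(\<beta>)\<close> would be a nonnegative combination of \<open>M\<close>, which \<open>d\<close> keeps
  positive, against positivity of \<open>d(u(\<beta>))\<close>.
\<close>

lemma pos_coset_rep_unique:
  assumes M: "M \<subseteq> simples D" and d: "d \<in> weyl D" "\<And>\<beta>. \<beta> \<in> M \<Longrightarrow> pos (d \<beta>)"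
    and u: "u \<in> refl_group D M" and du: "\<And>\<beta>. \<beta> \<in> M \<Longrightarrow> pos (d (u \<beta>))"
  shows "u = id"
proof (rule levi_pos_imp_id[OF M u])
  fix \<beta> assume \<beta>: "\<beta> \<in> M"
  have uW: "u \<in> weyl D" using simple_group_weyl[OF M u] .
  have r: "u \<beta> \<in> roots D" using weyl_root[OF uW simple_root] M \<beta> by blast
  show "pos (u \<beta>)"
  proof (rule ccontr)
    assume n: "\<not> pos (u \<beta>)"
    have "in_span M (- u \<beta>)" unfolding in_span_def
    proof
      fix b assume b: "b \<in> simples D - M"
      have \<beta>s: "\<beta> \<in> simples D" using M \<beta> by blast
      have "cf (u \<beta>) b = cf \<beta> b" by (rule levi_cf[OF M u simple_root[OF \<beta>s] b])
      then show "cf (- u \<beta>) b = 0" using b \<beta> by (auto simp: cf_neg root_span r cf_simple \<beta>s)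
    qed
    then have "pos (d (- u \<beta>))" using pos_on_span[OF d] n r pos_neg_iff by blast
    then show False using du[OF \<beta>] pos_weyl_neg[OF d(1) r] by blast
  qed
qed

lemma coset_decomposition:
  assumes M: "M \<subseteq> simples D" and w: "w \<in> weyl D"
  obtains d u where "d \<in> min_reps D M" "u \<in> refl_group D M" "w = d \<circ> u"
proof -
  obtain u where u: "u \<in> refl_group D M" "\<And>v. v \<in> refl_group D M \<Longrightarrow> len (w \<circ> u) \<le> len (w \<circ> v)"
    using ex_has_least_nat[of "\<lambda>u. u \<in> refl_group D M" id "\<lambda>u. len (w \<circ> u)"] refl_group.one by blast
  have uW: "u \<in> weyl D" using simple_group_weyl[OF M u(1)] .
  have wu: "w \<circ> u \<in> weyl D" using weyl_comp[OF w uW] .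
  have "w \<circ> u \<in> min_reps D M" unfolding min_reps_def
  proof (intro CollectI conjI ballI)
    fix v assume v: "v \<in> refl_group D M"
    then have "len (w \<circ> u) \<le> len (w \<circ> (u \<circ> v))" using u refl_group_comp by blast
    then show "wlength D (w \<circ> u) \<le> wlength D (w \<circ> u \<circ> v)"
      using wlength_eq_len[OF wu] wlength_eq_len[OF weyl_comp[OF wu simple_group_weyl[OF M v]]]
      by (simp only: comp_assoc)
  qed (rule wu)
  moreover have "inv u \<in> refl_group D M" using refl_group_bij_inv[OF _ u(1)] M simples_roots by blast
  moreover have "w = (w \<circ> u) \<circ> inv u" by (simp only: comp_assoc weyl_inv_comp(2)[OF uW] comp_id)
  ultimately show ?thesis by (rule that)
qed

lemma min_repI:
  assumes M: "M \<subseteq> simples D" and w: "w \<in> weyl D" and p: "\<And>\<beta>. \<beta> \<in> M \<Longrightarrow> pos (w \<beta>)"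
  shows "w \<in> min_reps D M"
proof -
  obtain d u where du: "d \<in> min_reps D M" "u \<in> refl_group D M" "w = d \<circ> u"
    using coset_decomposition[OF M w] .
  have "u = id"
    by (rule pos_coset_rep_unique[OF M min_repD(1,2)[OF M du(1)] du(2)]) (use p du(3) in auto)
  then show ?thesis using du by simp
qed

lemma id_min_rep: "M \<subseteq> simples D \<Longrightarrow> id \<in> min_reps D M"
  by (rule min_repI) (use pos_simple weyl_id in auto)

lemma coset_decomposition_bij:
  assumes M: "M \<subseteq> simples D"
  shows "bij_betw (\<lambda>(d, u). d \<circ> u) (min_reps D M \<times> refl_group D M) (weyl D)"
  unfolding bij_betw_def
proof
  show "inj_on (\<lambda>(d, u). d \<circ> u) (min_reps D M \<times> refl_group D M)"
  proof (rule inj_onI, clarify)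
    fix d u d' u'
    assume d: "d \<in> min_reps D M" "d' \<in> min_reps D M" and u: "u \<in> refl_group D M" "u' \<in> refl_group D M"
      and eq: "d \<circ> u = d' \<circ> u'"
    note W = simple_group_weyl[OF M u(1)] simple_group_weyl[OF M u(2)]
    have v: "u \<circ> inv u' \<in> refl_group D M"
      using refl_group_comp[OF u(1)] refl_group_bij_inv[OF _ u(2)] M simples_roots by blast
    have "d \<circ> (u \<circ> inv u') = d' \<circ> u' \<circ> inv u'" using eq by (simp only: comp_assoc[symmetric])
    then have d': "d \<circ> (u \<circ> inv u') = d'" by (simp only: comp_assoc weyl_inv_comp(2)[OF W(2)] comp_id)
    have "u \<circ> inv u' = id"
    proof (rule pos_coset_rep_unique[OF M min_repD(1,2)[OF M d(1)] v])
      fix \<beta> assume "\<beta> \<in> M"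
      then show "pos (d ((u \<circ> inv u') \<beta>))"
        using min_repD(2)[OF M d(2)] d'[THEN fun_cong, of \<beta>] by simp
    qed
    moreover from this have "d = d'" using d' by simp
    moreover have "u = u \<circ> inv u' \<circ> u'" by (simp only: comp_assoc weyl_inv_comp(1)[OF W(2)] comp_id)
    ultimately show "d = d' \<and> u = u'" by simp
  qed
  show "(\<lambda>(d, u). d \<circ> u) ` (min_reps D M \<times> refl_group D M) = weyl D"
  proof (intro equalityI subsetI)
    fix w assume "w \<in> weyl D"
    from coset_decomposition[OF M this] show "w \<in> (\<lambda>(d, u). d \<circ> u) ` (min_reps D M \<times> refl_group D M)"
      by (metis (mono_tags, lifting) SigmaI case_prod_conv image_eqI)
  next
    fix w assume "w \<in> (\<lambda>(d, u). d \<circ> u) ` (min_reps D M \<times> refl_group D M)"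
    then show "w \<in> weyl D" using min_repD(1)[OF M] weyl_comp simple_group_weyl[OF M] by auto
  qed
qed

subsection \<open>The element \<open>w\<^sup>0\<^sub>M\<close>\<close>

lemma longest_weyl_involution: "longest D (weyl D) (longest D (weyl D) x) = x"
  using longest_spec[OF order_refl] weyl_inv_apply[of "longest D (weyl D)" x] weyl_simple_group by simp

lemma longest_weyl_mem: "longest D (weyl D) \<in> weyl D"
  using longest_spec(1)[OF order_refl] weyl_simple_group by simp

lemma delta_delta: "delta D (delta D x) = x"
  by (simp add: delta_def weyl_neg[OF longest_weyl_mem] longest_weyl_involution)

lemma delta_simple: "\<beta> \<in> simples D \<Longrightarrow> delta D \<beta> \<in> simples D"
  unfolding delta_def using longest_permutes[OF order_refl] weyl_simple_group by simp

lemma delta_image: "M \<subseteq> simples D \<Longrightarrow> delta D ` M \<subseteq> simples D"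
  using delta_simple by blast

lemma w0M_weyl: "M \<subseteq> simples D \<Longrightarrow> w0M D M \<in> weyl D"
  unfolding w0M_def
  using longest_weyl_mem longest_spec(1)[OF delta_image] simple_group_weyl[OF delta_image] weyl_comp by blast

lemma w0M_delta:
  assumes M: "M \<subseteq> simples D" and \<beta>: "\<beta> \<in> delta D ` M"
  shows "w0M D M \<beta> \<in> M"
proof -
  define u where "u = longest D (refl_group D (delta D ` M))"
  have "- u \<beta> \<in> delta D ` M" unfolding u_def by (rule longest_permutes[OF delta_image[OF M] \<beta>])
  then obtain \<alpha> where \<alpha>: "\<alpha> \<in> M" "- u \<beta> = delta D \<alpha>" by blast
  have "w0M D M \<beta> = - longest D (weyl D) (- u \<beta>)"
    by (simp add: w0M_def u_def weyl_neg[OF longest_weyl_mem])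
  also have "\<dots> = delta D (delta D \<alpha>)" using \<alpha>(2) by (simp add: delta_def)
  finally show ?thesis using \<alpha>(1) delta_delta by simp
qed

lemma inv_w0M_simple:
  assumes M: "M \<subseteq> simples D" and \<alpha>: "\<alpha> \<in> M"
  shows "inv (w0M D M) \<alpha> \<in> delta D ` M"
proof -
  have fin: "finite M" using M finite_simples finite_subset by blast
  have "w0M D M ` (delta D ` M) \<subseteq> M" using w0M_delta[OF M] by blast
  moreover have "card (w0M D M ` (delta D ` M)) = card M"
  proof -
    have "inj (delta D)" by (rule inj_on_inverseI[of _ "delta D"]) (rule delta_delta)
    then show ?thesis
      using bij_is_inj[OF weyl_bij[OF w0M_weyl[OF M]]] by (metis card_image inj_on_subset subset_UNIV)
  qed
  ultimately have "w0M D M ` (delta D ` M) = M" using card_subset_eq[OF fin] by blast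
  then show ?thesis using \<alpha> weyl_inv_apply(1)[OF w0M_weyl[OF M]] by (metis imageE)
qed

text \<open>
  The longest element of \<open>W\<^sub>N\<close> makes exactly the positive roots in the span of \<open>N\<close> negative, and the longest
  element of \<open>W\<close> then reverses all signs.
\<close>

lemma inversions_w0M:
  assumes M: "M \<subseteq> simples D"
  shows "inversions (w0M D M) = {\<gamma>. pos \<gamma> \<and> \<not> in_span (delta D ` M) \<gamma>}"
proof -
  define u where "u = longest D (refl_group D (delta D ` M))"
  define w where "w = longest D (weyl D)"
  note dM = delta_image[OF M]
  note u = longest_spec[OF dM, folded u_def]
  have W: "u \<in> weyl D" "w \<in> weyl D" using simple_group_weyl[OF dM u(1)] longest_weyl_mem by (simp_all add: w_def)
  have wn: "\<not> pos (w \<gamma>)" if "pos \<gamma>" for \<gamma>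
    by (rule neg_on_span[OF W(2) _ order_refl that])
      (use longest_spec(2)[OF order_refl] in \<open>auto simp: w_def weyl_simple_group in_span_def\<close>)
  have "\<not> pos (w (u \<gamma>)) \<longleftrightarrow> \<not> in_span (delta D ` M) \<gamma>" if \<gamma>: "pos \<gamma>" for \<gamma>
  proof -
    have r: "u \<gamma> \<in> roots D" using weyl_root[OF W(1) pos_root[OF \<gamma>]] .
    have "pos (w (u \<gamma>)) \<longleftrightarrow> \<not> pos (u \<gamma>)"
      using wn[of "u \<gamma>"] wn[of "- u \<gamma>"] pos_neg_iff[OF r] pos_weyl_neg[OF W(2) r] by blast
    moreover have "\<not> pos (u \<gamma>) \<longleftrightarrow> in_span (delta D ` M) \<gamma>"
      using inversions_levi_in_span[OF dM u(1)] neg_on_span[OF W(1) u(2) dM \<gamma>] \<gamma> by (auto simp: inversions_def)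
    ultimately show ?thesis by blast
  qed
  then show ?thesis by (auto simp: inversions_def w0M_def u_def w_def)
qed

lemma w0M_min_rep: "M \<subseteq> simples D \<Longrightarrow> w0M D M \<in> min_reps D (delta D ` M)"
  by (rule min_repI[OF delta_image w0M_weyl]) (use w0M_delta pos_simple in blast)+

text \<open>
  A minimal length representative has no inversions in the span of \<open>\<delta>(M)\<close>, whereas \<open>w\<^sup>0\<^sub>M\<close> has all the others.
\<close>

lemma len_min_rep_less:
  assumes M: "M \<subseteq> simples D" and d: "d \<in> min_reps D (delta D ` M)" "d \<noteq> w0M D M"
  shows "len d < len (w0M D M)"
proof -
  note dM = delta_image[OF M]
  have "inversions d \<subseteq> inversions (w0M D M)"
    using pos_on_span[OF min_repD(1,2)[OF dM d(1)]] by (auto simp: inversions_w0M[OF M]) (auto simp: inversions_def)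
  moreover have "inversions d \<noteq> inversions (w0M D M)"
    using inversions_eq_imp_eq[OF min_repD(1)[OF dM d(1)] w0M_weyl[OF M]] d(2) by blast
  ultimately show ?thesis unfolding len_def using psubset_card_mono[OF finite_inversions] by blast
qed

lemma conj_levi_group:
  assumes "M \<subseteq> roots D" and w: "w \<in> weyl D" and maps: "\<And>\<alpha>. \<alpha> \<in> M \<Longrightarrow> w \<alpha> \<in> N"
    and u: "u \<in> refl_group D M"
  shows "w \<circ> u \<circ> inv w \<in> refl_group D N"
  using u
proof (induction rule: refl_group.induct)
  case one
  show ?case by (simp only: comp_id weyl_inv_comp(2)[OF w] refl_group.one)
next
  case (step \<alpha> u)
  have "w \<circ> (root_refl D \<alpha> \<circ> u) \<circ> inv w = (w \<circ> root_refl D \<alpha>) \<circ> (u \<circ> inv w)" by (simp only: comp_assoc)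
  also have "\<dots> = (root_refl D (w \<alpha>) \<circ> w) \<circ> (u \<circ> inv w)"
    using weyl_refl_conj[OF w] step.hyps(1) assms(1) by (metis subsetD)
  finally have "w \<circ> (root_refl D \<alpha> \<circ> u) \<circ> inv w = root_refl D (w \<alpha>) \<circ> (w \<circ> u \<circ> inv w)" by (simp only: comp_assoc)
  then show ?case using refl_group.step[OF maps[OF step.hyps(1)] step.IH] by (simp only:)
qed

lemma w0M_conj:
  assumes M: "M \<subseteq> simples D"
  shows "m \<in> refl_group D M \<Longrightarrow> inv (w0M D M) \<circ> m \<circ> w0M D M \<in> refl_group D (delta D ` M)"
    and "u \<in> refl_group D (delta D ` M) \<Longrightarrow> w0M D M \<circ> u \<circ> inv (w0M D M) \<in> refl_group D M"
proof -
  note W = w0M_weyl[OF M]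
  have ii: "inv (inv (w0M D M)) = w0M D M" using inv_inv_eq weyl_bij[OF W] by blast
  show "m \<in> refl_group D M \<Longrightarrow> inv (w0M D M) \<circ> m \<circ> w0M D M \<in> refl_group D (delta D ` M)"
    using conj_levi_group[OF _ weyl_inv[OF W] inv_w0M_simple[OF M]] M simples_roots unfolding ii by blast
  show "u \<in> refl_group D (delta D ` M) \<Longrightarrow> w0M D M \<circ> u \<circ> inv (w0M D M) \<in> refl_group D M"
    using conj_levi_group[OF _ W w0M_delta[OF M]] delta_image[OF M] simples_roots by blast
qed

text \<open>
  A reflection in \<open>\<delta>(M)\<close> changes neither the coordinates outside \<open>\<delta>(M)\<close> nor the positivity of roots having
  one. This makes the leading coefficient of \<open>R\<^sup>0\<close> invariant.
\<close>

lemma refl_permutes_inversions_w0M: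
  assumes M: "M \<subseteq> simples D" and \<beta>: "\<beta> \<in> delta D ` M"
  shows "root_refl D \<beta> ` inversions (w0M D M) = inversions (w0M D M)"
proof -
  have \<beta>s: "\<beta> \<in> simples D" using delta_image[OF M] \<beta> by blast
  note r = simple_root[OF \<beta>s]
  have sub: "root_refl D \<beta> \<gamma> \<in> inversions (w0M D M)" if "\<gamma> \<in> inversions (w0M D M)" for \<gamma>
  proof -
    have \<gamma>: "pos \<gamma>" "\<not> in_span (delta D ` M) \<gamma>" using that by (auto simp: inversions_w0M[OF M])
    then obtain b where b: "b \<in> simples D" "b \<notin> delta D ` M" "cf \<gamma> b \<noteq> 0" by (auto simp: in_span_def)
    have b\<beta>: "b \<noteq> \<beta>" using b(2) \<beta> by blast
    then have "\<gamma> \<noteq> \<beta>" using b(3) cf_simple[OF \<beta>s, of b] by auto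
    then have "pos (root_refl D \<beta> \<gamma>)" using refl_pos[OF \<beta>s \<gamma>(1)] by blast
    moreover
    have "cf (root_refl D \<beta> \<gamma>) b = cf \<gamma> b"
      using b\<beta> by (simp add: cf_refl root_span pos_root \<gamma> \<beta>s cf_simple)
    then have "\<not> in_span (delta D ` M) (root_refl D \<beta> \<gamma>)" using b unfolding in_span_def by (metis DiffI)
    ultimately show ?thesis by (simp add: inversions_w0M[OF M])
  qed
  moreover have "\<gamma> \<in> root_refl D \<beta> ` inversions (w0M D M)" if "\<gamma> \<in> inversions (w0M D M)" for \<gamma>
    using sub[OF that] refl_involution[OF r, of \<gamma>] by (metis imageI)
  ultimately show ?thesis by blast
qed

end

section \<open>Polynomial functions\<close>

lemma pcnj_pconst: "pcnj (pconst c) = pconst (cnj c)"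
  by (simp add: peval_inject[symmetric] fun_eq_iff pconst.rep_eq pcnj.rep_eq)

lemma pcnj_add: "pcnj (a + b) = pcnj a + pcnj b"
  and pcnj_mult: "pcnj (a * b) = pcnj a * pcnj b"
  and pcnj_diff: "pcnj (a - b) = pcnj a - pcnj b"
  and pcnj_1: "pcnj 1 = 1"
  and pcnj_pcnj: "pcnj (pcnj a) = a"
  by (simp_all add: peval_inject[symmetric] fun_eq_iff pcnj.rep_eq plus_polyfun.rep_eq times_polyfun.rep_eq
      minus_polyfun.rep_eq one_polyfun.rep_eq)

lemma pcnj_prod: "pcnj (\<Prod>i\<in>I. f i) = (\<Prod>i\<in>I. pcnj (f i))"
  by (induction I rule: infinite_finite_induct) (simp_all add: pcnj_mult pcnj_1)

context reduced_root_datum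
begin

lemma lin_inject: "lin D x = lin D y \<Longrightarrow> x = y"
proof -
  assume "lin D x = lin D y"
  then have "pairing D x \<xi> = pairing D y \<xi>" for \<xi> by (metis peval_lin of_real_eq_iff)
  then have "pairing D (x - y) \<xi> = 0" for \<xi> by (simp add: linear_diff[OF pairing_linear(1)])
  then show ?thesis using pairing_nondegenerate(1) by (metis right_minus_eq)
qed

lemma lin_0: "lin D 0 = 0"
  by (simp add: peval_inject[symmetric] fun_eq_iff peval_lin zero_polyfun.rep_eq linear_0[OF pairing_linear(1)])

lemma pcnj_lin: "pcnj (lin D x) = lin D x"
  by (simp add: peval_inject[symmetric] fun_eq_iff pcnj.rep_eq peval_lin)

text \<open>
  In the induction step some \<open>x\<close> that vanishes on \<open>B\<close> must not vanish at \<open>b\<^sub>0\<close>: otherwise subtracting the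
  components along a dual basis of \<open>B\<close> shows that \<open>b\<^sub>0\<close> is a combination of \<open>B\<close>, by nondegeneracy.
\<close>

lemma functional_on_independent:
  assumes "finite B" "independent B"
  shows "\<exists>x. \<forall>b\<in>B. pairing D x b = f b"
  using assms
proof (induction B arbitrary: f rule: finite_induct)
  case (insert b0 B)
  have indep: "independent B" "b0 \<notin> span B" using insert by (auto simp: independent_insert)
  have "\<exists>x. (\<forall>b\<in>B. pairing D x b = 0) \<and> pairing D x b0 \<noteq> 0"
  proof (rule ccontr)
    assume "\<not> ?thesis"
    then have kill: "pairing D x b0 = 0" if "\<forall>b\<in>B. pairing D x b = 0" for x using that by blast
    have "\<exists>e. \<forall>b\<in>B. pairing D e b = (if b = c then 1 else 0)" for c
      by (rule insert.IH[OF indep(1)])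
    then obtain e where e: "\<And>c b. b \<in> B \<Longrightarrow> pairing D (e c) b = (if b = c then 1 else 0)" by metis
    have "pairing D x (b0 - (\<Sum>c\<in>B. pairing D (e c) b0 *\<^sub>R c)) = 0" for x
    proof -
      \<comment> \<open>\<open>?y\<close> vanishes on \<open>B\<close>.\<close>
      let ?y = "x - (\<Sum>c\<in>B. pairing D x c *\<^sub>R e c)"
      have "pairing D ?y b = pairing D x b - (\<Sum>c\<in>B. pairing D x c * pairing D (e c) b)" for b
        by (simp add: linear_diff[OF pairing_linear(1)] linear_sum[OF pairing_linear(1)] linear_scale[OF pairing_linear(1)])
      moreover have "(\<Sum>c\<in>B. pairing D x c * pairing D (e c) b) = pairing D x b" if "b \<in> B" for b
      proof -
        have "(\<Sum>c\<in>B. pairing D x c * pairing D (e c) b) = (\<Sum>c\<in>B. if c = b then pairing D x c else 0)"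
          by (rule sum.cong) (auto simp: e that)
        then show ?thesis using that insert.hyps(1) by simp
      qed
      ultimately have "pairing D x b0 = (\<Sum>c\<in>B. pairing D x c * pairing D (e c) b0)"
        using kill[of ?y] by simp
      then show ?thesis
        by (simp add: linear_diff[OF pairing_linear(2)] linear_sum[OF pairing_linear(2)]
            linear_scale[OF pairing_linear(2)] mult.commute)
    qed
    then have "b0 - (\<Sum>c\<in>B. pairing D (e c) b0 *\<^sub>R c) = 0" by (intro pairing_nondegenerate(2)) blast
    then have "b0 = (\<Sum>c\<in>B. pairing D (e c) b0 *\<^sub>R c)" by (rule eq_iff_diff_eq_0[THEN iffD2])
    moreover have "(\<Sum>c\<in>B. pairing D (e c) b0 *\<^sub>R c) \<in> span B"
      by (intro span_sum span_scale span_base)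
    ultimately show False using indep(2) by simp
  qed
  then obtain x0 where x0: "\<forall>b\<in>B. pairing D x0 b = 0" "pairing D x0 b0 \<noteq> 0" by blast
  obtain x where x: "\<forall>b\<in>B. pairing D x b = f b" using insert.IH[OF indep(1)] by blast
  let ?c = "(f b0 - pairing D x b0) / pairing D x0 b0"
  have "pairing D (x + ?c *\<^sub>R x0) b = pairing D x b + ?c * pairing D x0 b" for b
    by (simp add: linear_add[OF pairing_linear(1)] linear_scale[OF pairing_linear(1)])
  then show ?case using x x0 by (intro exI[of _ "x + ?c *\<^sub>R x0"]) auto
qed simp

lemma functional_is_pairing:
  assumes f: "linear (f :: 'w \<Rightarrow> real)"
  shows "\<exists>x. \<forall>\<xi>. f \<xi> = pairing D x \<xi>"
proof -
  obtain S :: "'w set" where S: "finite S" "span S = UNIV" using finite_dim_V_dual by blast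
  obtain B where B: "B \<subseteq> S" "independent B" "S \<subseteq> span B" using maximal_independent_subset[of S] by blast
  have span: "span B = UNIV" using S(2) B span_mono span_span by (metis top.extremum_uniqueI)
  obtain x where x: "\<forall>b\<in>B. pairing D x b = f b"
    using functional_on_independent[OF finite_subset[OF B(1) S(1)] B(2)] by blast
  have "f \<xi> = pairing D x \<xi>" for \<xi>
    by (rule linear_eq_on_span[OF f pairing_linear(2), of B]) (use x span in auto)
  then show ?thesis by blast
qed

text \<open>
  As the pairing is perfect, \<open>V\<close> and the constants generate the algebra of polynomial functions; this
  extends identities known for \<open>\<omega>\<close> in \<open>V\<^sub>\<complex>\<close> to all polynomials.
\<close>

lemma polyfun_induct [case_names const lin add mult]:
  assumes "\<And>c. P (pconst c)" "\<And>x. P (lin D x)"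
    "\<And>a b. P a \<Longrightarrow> P b \<Longrightarrow> P (a + b)" "\<And>a b. P a \<Longrightarrow> P b \<Longrightarrow> P (a * b)"
  shows "P a"
proof -
  have "P (Abs_polyfun p)" if "p \<in> poly_functions" for p
    using that
  proof (induction rule: poly_functions.induct)
    case (const c)
    have "(Abs_polyfun (\<lambda>_. c) :: 'w polyfun) = pconst c"
      by (simp add: peval_inject[symmetric] pconst.rep_eq Abs_polyfun_inverse poly_functions.const)
    then show ?case using assms(1) by simp
  next
    case (functional f)
    obtain x where "\<And>\<xi>. f \<xi> = pairing D x \<xi>" using functional_is_pairing[OF functional] by blast
    then have "Abs_polyfun (\<lambda>\<xi>. complex_of_real (f \<xi>)) = lin D x" by (simp add: lin_def)
    then show ?case using assms(2) by simp
  next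
    case (add p q)
    have "Abs_polyfun (\<lambda>\<xi>. p \<xi> + q \<xi>) = Abs_polyfun p + Abs_polyfun q"
      by (simp add: peval_inject[symmetric] plus_polyfun.rep_eq Abs_polyfun_inverse poly_functions.add add.hyps)
    then show ?case using assms(3) add by simp
  next
    case (mult p q)
    have "Abs_polyfun (\<lambda>\<xi>. p \<xi> * q \<xi>) = Abs_polyfun p * Abs_polyfun q"
      by (simp add: peval_inject[symmetric] times_polyfun.rep_eq Abs_polyfun_inverse poly_functions.mult mult.hyps)
    then show ?case using assms(4) mult by simp
  qed
  from this[OF peval[of a]] show ?thesis by (simp add: peval_inverse)
qed

lemma wact_zero_one:
  assumes "w \<in> weyl D"
  shows "wact D w 0 = 0" "wact D w 1 = 1" "wact D w (- a) = - wact D w a" "wact D w (a - b) = wact D w a - wact D w b"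
  by (simp_all add: peval_inject[symmetric] fun_eq_iff peval_wact[OF assms]
      zero_polyfun.rep_eq one_polyfun.rep_eq uminus_polyfun.rep_eq minus_polyfun.rep_eq)

lemma pcnj_wact: "w \<in> weyl D \<Longrightarrow> pcnj (wact D w a) = wact D w (pcnj a)"
  by (simp add: peval_inject[symmetric] fun_eq_iff peval_wact pcnj.rep_eq)

lemma wact_prod: "w \<in> weyl D \<Longrightarrow> wact D w (\<Prod>i\<in>I. f i) = (\<Prod>i\<in>I. wact D w (f i))"
  by (induction I rule: infinite_finite_induct) (simp_all add: wact_hom wact_zero_one)

lemma wact_comp:
  assumes "v \<in> weyl D" "w \<in> weyl D"
  shows "wact D (v \<circ> w) a = wact D v (wact D w a)"
proof -
  have "wtranspose D (v \<circ> w) \<xi> = wtranspose D w (wtranspose D v \<xi>)" for \<xi>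
    by (rule wtranspose_eqI) (use weyl_wtranspose assms in simp)
  then show ?thesis
    by (simp add: peval_inject[symmetric] fun_eq_iff peval_wact assms weyl_comp)
qed

lemma wact_id: "wact D id a = a"
proof -
  have "wtranspose D id \<xi> = \<xi>" for \<xi> by (rule wtranspose_eqI) simp
  then show ?thesis by (simp add: peval_inject[symmetric] fun_eq_iff peval_wact weyl_id)
qed

lemma wact_inv: "w \<in> weyl D \<Longrightarrow> wact D (inv w) (wact D w a) = a"
  and wact_inv': "w \<in> weyl D \<Longrightarrow> wact D w (wact D (inv w) a) = a"
  using wact_comp[of "inv w" w a] wact_comp[of w "inv w" a] by (simp_all add: weyl_inv weyl_inv_comp wact_id)

end

section \<open>Graded Hecke algebras\<close>

context graded_hecke_algebra
begin

lemma sym_0: "sym H 0 = 0" using sym_add[of 0 0] by simp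

lemma sym_minus: "sym H (- a) = - sym H a"
  using sym_add[of a "- a"] by (simp add: sym_0 eq_neg_iff_add_eq_0 add.commute)

lemma sym_diff: "sym H (a - b) = sym H a - sym H b"
  using sym_add[of a "- b"] by (simp add: sym_minus)

lemma sym_comm: "sym H a * sym H b = sym H b * sym H a"
  by (simp add: sym_mult[symmetric] mult.commute)

lemma sym_tw_refl:
  assumes "\<alpha> \<in> simples H"
  obtains b where "lin H \<alpha> * b = a - wact H (root_refl H \<alpha>) a"
    "sym H a * tw H (root_refl H \<alpha>) = tw H (root_refl H \<alpha>) * sym H (wact H (root_refl H \<alpha>) a)
      + sym H (pconst (complex_of_real (param H \<alpha>)) * b)"
  using divided_difference_exists[OF simple_root[OF assms], of a] cross_relation[OF assms, of a]
  unfolding hscale_def sym_mult by metis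

lemma refl_simple_weyl: "\<alpha> \<in> simples H \<Longrightarrow> root_refl H \<alpha> \<in> weyl H"
  using refl_weyl simple_root by blast

subsection \<open>Coefficients in the basis \<open>t\<^sub>w\<close>\<close>

definition coef :: "'h \<Rightarrow> ('v \<Rightarrow> 'v) \<Rightarrow> 'w polyfun" where
  "coef h = (THE a. (\<forall>w. w \<notin> weyl H \<longrightarrow> a w = 0) \<and> h = (\<Sum>w\<in>weyl H. tw H w * sym H (a w)))"

lemma coef_outside: "w \<notin> weyl H \<Longrightarrow> coef h w = 0"
  and coef_expand: "h = (\<Sum>w\<in>weyl H. tw H w * sym H (coef h w))"
  using theI'[OF pbw[of h]] unfolding coef_def[symmetric] by blast+

lemma coef_unique:
  assumes "h = (\<Sum>w\<in>weyl H. tw H w * sym H (a w))" and w: "w \<in> weyl H"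
  shows "coef h w = a w"
proof -
  define a' where "a' w = (if w \<in> weyl H then a w else 0)" for w
  have "(\<forall>w. w \<notin> weyl H \<longrightarrow> a' w = 0) \<and> h = (\<Sum>w\<in>weyl H. tw H w * sym H (a' w))"
    using assms(1) by (auto simp: a'_def intro: sum.cong)
  moreover have "(\<forall>w. w \<notin> weyl H \<longrightarrow> coef h w = 0) \<and> h = (\<Sum>w\<in>weyl H. tw H w * sym H (coef h w))"
    using coef_outside coef_expand by blast
  ultimately have "coef h = a'" using pbw[of h] by (blast dest: ex1_implies_ex elim: ex1E)
  then show ?thesis using w by (simp add: a'_def)
qed

lemma coef_eqI: "(\<And>w. w \<in> weyl H \<Longrightarrow> coef g w = coef h w) \<Longrightarrow> g = h"
  by (subst coef_expand[of g], subst coef_expand[of h]) (auto intro: sum.cong)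

lemma coef_add: "coef (g + h) w = coef g w + coef h w"
proof (cases "w \<in> weyl H")
  case True
  have "g + h = (\<Sum>w\<in>weyl H. tw H w * sym H (coef g w + coef h w))"
    unfolding sym_add distrib_left sum.distrib using coef_expand by metis
  from coef_unique[OF this True] show ?thesis .
qed (simp add: coef_outside)

lemma coef_0: "coef 0 w = 0" using coef_add[of 0 0 w] by (metis add.right_neutral add_left_cancel)

lemma coef_minus: "coef (- h) w = - coef h w"
  using coef_add[of h "- h" w] by (simp add: coef_0 eq_neg_iff_add_eq_0 add.commute)

lemma coef_diff: "coef (g - h) w = coef g w - coef h w"
  using coef_add[of g "- h" w] by (simp add: coef_minus)

lemma coef_sum: "coef (\<Sum>i\<in>I. f i) w = (\<Sum>i\<in>I. coef (f i) w)"
  by (induction I rule: infinite_finite_induct) (simp_all add: coef_0 coef_add)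

lemma coef_sym_right: "coef (h * sym H a) w = coef h w * a"
proof (cases "w \<in> weyl H")
  case True
  have "h * sym H a = (\<Sum>w\<in>weyl H. tw H w * sym H (coef h w)) * sym H a" using coef_expand[of h] by simp
  also have "\<dots> = (\<Sum>w\<in>weyl H. tw H w * sym H (coef h w * a))" by (simp add: sum_distrib_right sym_mult mult.assoc)
  finally show ?thesis by (rule coef_unique[OF _ True])
qed (simp add: coef_outside)

lemma coef_tw_left:
  assumes v: "v \<in> weyl H" and w: "w \<in> weyl H"
  shows "coef (tw H v * h) w = coef h (inv v \<circ> w)"
proof (rule coef_unique[OF _ w])
  have "tw H v * h = tw H v * (\<Sum>u\<in>weyl H. tw H u * sym H (coef h u))" using coef_expand[of h] by simp
  also have "\<dots> = (\<Sum>u\<in>weyl H. tw H (v \<circ> u) * sym H (coef h u))"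
    by (simp add: sum_distrib_left tw_mult[OF v] mult.assoc)
  also have "\<dots> = (\<Sum>w\<in>weyl H. tw H w * sym H (coef h (inv v \<circ> w)))"
  proof (rule sum.reindex_bij_witness[of _ "\<lambda>w. inv v \<circ> w" "\<lambda>u. v \<circ> u"])
    fix u assume u: "u \<in> weyl H"
    show e: "inv v \<circ> (v \<circ> u) = u" by (simp only: comp_assoc[symmetric] weyl_inv_comp(1)[OF v] id_comp)
    show "v \<circ> u \<in> weyl H" using weyl_comp v u by blast
    show "tw H (v \<circ> u) * sym H (coef h (inv v \<circ> (v \<circ> u))) = tw H (v \<circ> u) * sym H (coef h u)" by (simp only: e)
    show "v \<circ> (inv v \<circ> u) = u" by (simp only: comp_assoc[symmetric] weyl_inv_comp(2)[OF v] id_comp)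
    show "inv v \<circ> u \<in> weyl H" using weyl_comp weyl_inv v u by blast
  qed
  finally show "tw H v * h = (\<Sum>w\<in>weyl H. tw H w * sym H (coef h (inv v \<circ> w)))" .
qed

lemma coef_1: "w \<in> weyl H \<Longrightarrow> coef 1 w = (if w = id then 1 else 0)"
proof (rule coef_unique)
  have "(\<Sum>w\<in>weyl H. tw H w * sym H (if w = id then 1 else 0)) = (\<Sum>w\<in>weyl H. if w = id then 1 else 0)"
    by (rule sum.cong) (auto simp: sym_0 sym_one tw_one)
  also have "\<dots> = 1" using finite_weyl weyl_id by simp
  finally show "1 = (\<Sum>w\<in>weyl H. tw H w * sym H (if w = id then 1 else 0))" by simp
qed

lemma coef_sym: "w \<in> weyl H \<Longrightarrow> coef (sym H a) w = (if w = id then a else 0)"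
  using coef_sym_right[of 1 a w] by (simp add: coef_1)

lemma coef_tw: 
  assumes v: "v \<in> weyl H" and w: "w \<in> weyl H" shows "coef (tw H v) w = (if w = v then 1 else 0)"
proof -
  have "inv v \<circ> w = id \<longleftrightarrow> w = v"
    using weyl_inv_comp[OF v] by (metis comp_assoc id_comp comp_id)
  then show ?thesis using coef_tw_left[OF v w, of 1] coef_1[OF weyl_comp[OF weyl_inv[OF v] w]] by simp
qed

lemma sym_right_cancel: "h * sym H a = 0 \<Longrightarrow> a \<noteq> 0 \<Longrightarrow> h = 0"
  by (rule coef_eqI) (metis coef_sym_right coef_0 mult_eq_0_iff)

lemma sym_right_cancel': "g * sym H a = h * sym H a \<Longrightarrow> a \<noteq> 0 \<Longrightarrow> g = h"
  using sym_right_cancel[of "g - h" a] by (simp add: left_diff_distrib)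

subsection \<open>The length filtration\<close>

text \<open>
  The filtration by length: straightening \<open>a t\<^sub>w\<close> creates terms of strictly smaller length only.
\<close>

definition shorter :: "nat \<Rightarrow> 'h \<Rightarrow> bool" where
  "shorter n h \<longleftrightarrow> (\<forall>w\<in>weyl H. coef h w \<noteq> 0 \<longrightarrow> len w < n)"

lemma shorter_coef: "shorter n h \<Longrightarrow> w \<in> weyl H \<Longrightarrow> n \<le> len w \<Longrightarrow> coef h w = 0"
  by (force simp: shorter_def)

lemma shorter_0: "shorter n 0" by (simp add: shorter_def coef_0)

lemma shorter_add: "shorter n g \<Longrightarrow> shorter n h \<Longrightarrow> shorter n (g + h)"
  unfolding shorter_def coef_add by (metis add.right_neutral)

lemma shorter_sum: "(\<And>i. i \<in> I \<Longrightarrow> shorter n (f i)) \<Longrightarrow> shorter n (\<Sum>i\<in>I. f i)"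
  by (induction I rule: infinite_finite_induct) (auto simp: shorter_0 intro: shorter_add)

lemma shorter_mono: "shorter m h \<Longrightarrow> m \<le> n \<Longrightarrow> shorter n h"
  by (force simp: shorter_def)

lemma shorter_sym_right: "shorter n h \<Longrightarrow> shorter n (h * sym H a)"
  unfolding shorter_def coef_sym_right by auto

lemma shorter_tw: "w \<in> weyl H \<Longrightarrow> len w < n \<Longrightarrow> shorter n (tw H w)"
  by (auto simp: shorter_def coef_tw split: if_splits)

lemma shorter_refl:
  assumes \<alpha>: "\<alpha> \<in> simples H" and h: "shorter n h"
  shows "shorter (Suc n) (tw H (root_refl H \<alpha>) * h)"
  unfolding shorter_def
proof (intro ballI impI)
  let ?s = "root_refl H \<alpha>"
  note s = refl_simple_weyl[OF \<alpha>] and ss = refl_comp_refl[OF simple_root[OF \<alpha>]]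
  fix w assume w: "w \<in> weyl H" and c: "coef (tw H ?s * h) w \<noteq> 0"
  have "inv ?s = ?s" using inv_unique_comp ss by blast
  then have "len (?s \<circ> w) < n" using c h coef_tw_left[OF s w] weyl_comp[OF s w] by (simp add: shorter_def)
  moreover have "?s \<circ> (?s \<circ> w) = w" by (simp only: comp_assoc[symmetric] ss id_comp)
  then have "len w \<le> Suc (len (?s \<circ> w))" using len_refl_comp[OF weyl_comp[OF s w] \<alpha>] by metis
  ultimately show "len w < Suc n" by simp
qed

lemma weyl_reduced_induct [consumes 1, case_names id refl]:
  assumes "w \<in> weyl H" "P id"
    "\<And>\<alpha> w. \<alpha> \<in> simples H \<Longrightarrow> w \<in> weyl H \<Longrightarrow> len (root_refl H \<alpha> \<circ> w) = Suc (len w) \<Longrightarrow> P w \<Longrightarrow> P (root_refl H \<alpha> \<circ> w)"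
  shows "P w"
proof -
  have "P (refl_word H \<alpha>s)" if "set \<alpha>s \<subseteq> simples H" "length \<alpha>s = len (refl_word H \<alpha>s)" for \<alpha>s
    using that
  proof (induction \<alpha>s)
    case Nil then show ?case using assms(2) by (simp only: refl_word_Nil)
  next
    case (Cons \<alpha> \<alpha>s)
    have \<alpha>: "\<alpha> \<in> simples H" and w: "refl_word H \<alpha>s \<in> weyl H" and sub: "set \<alpha>s \<subseteq> simples H" using Cons.prems word_weyl by auto
    have "len (root_refl H \<alpha> \<circ> refl_word H \<alpha>s) = Suc (length \<alpha>s)"
      using Cons.prems(2) by (subst refl_word_Cons[symmetric]) simp
    moreover have "len (root_refl H \<alpha> \<circ> refl_word H \<alpha>s) \<le> Suc (len (refl_word H \<alpha>s))" by (rule len_refl_comp[OF w \<alpha>])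
    moreover have "len (refl_word H \<alpha>s) \<le> length \<alpha>s" by (rule len_word_le[OF sub])
    ultimately have "len (refl_word H \<alpha>s) = length \<alpha>s"
      "len (root_refl H \<alpha> \<circ> refl_word H \<alpha>s) = Suc (len (refl_word H \<alpha>s))" by linarith+
    then show ?case using assms(3)[OF \<alpha> w] Cons.IH[OF sub] by (simp only: refl_word_Cons)
  qed
  then show ?thesis
    using levi_reduced_word[OF order_refl, of w] assms(1) weyl_simple_group by metis
qed

lemma sym_tw_shorter:
  assumes "w \<in> weyl H"
  shows "shorter (len w) (sym H a * tw H w - tw H w * sym H (wact H (inv w) a))"
  using assms
proof (induction w arbitrary: a rule: weyl_reduced_induct)
  case id
  show ?case by (simp only: tw_one inv_id wact_id) (simp add: shorter_0)
next
  case (refl \<alpha> w)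
  let ?s = "root_refl H \<alpha>"
  note s = refl_simple_weyl[OF refl(1)]
  obtain b where b: "sym H a * tw H ?s = tw H ?s * sym H (wact H ?s a)
      + sym H (pconst (complex_of_real (param H \<alpha>)) * b)" using sym_tw_refl[OF refl(1)] by metis
  let ?b = "pconst (complex_of_real (param H \<alpha>)) * b"
  let ?d = "\<lambda>a. sym H a * tw H w - tw H w * sym H (wact H (inv w) a)"
  have "wact H (inv (?s \<circ> w)) a = wact H (inv w) (wact H ?s a)"
    by (simp only: inv_refl_comp[OF refl(2) simple_root[OF refl(1)]] wact_comp[OF weyl_inv[OF refl(2)] s])
  then have "sym H a * tw H (?s \<circ> w) - tw H (?s \<circ> w) * sym H (wact H (inv (?s \<circ> w)) a)
      = (sym H a * tw H ?s) * tw H w - tw H ?s * (tw H w * sym H (wact H (inv w) (wact H ?s a)))"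
    by (simp only: tw_mult[OF s refl(2)] mult.assoc)
  also have "\<dots> = tw H ?s * ?d (wact H ?s a) + (?d ?b + tw H w * sym H (wact H (inv w) ?b))"
    unfolding b by (simp add: algebra_simps)
  also have "shorter (Suc (len w)) \<dots>"
    by (intro shorter_add shorter_refl[OF refl(1)] shorter_mono[OF refl(4)] refl(4) shorter_sym_right shorter_tw[OF refl(2)]) auto
  finally show ?case unfolding refl(3) .
qed

lemma shorter_sym_left: "shorter n h \<Longrightarrow> shorter n (sym H a * h)"
proof -
  assume h: "shorter n h"
  have "shorter n (sym H a * (tw H w * sym H (coef h w)))" if w: "w \<in> weyl H" for w
  proof (cases "coef h w = 0")
    case False
    then have lt: "len w < n" using h w by (simp add: shorter_def)
    have "sym H a * tw H w = (sym H a * tw H w - tw H w * sym H (wact H (inv w) a)) + tw H w * sym H (wact H (inv w) a)"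
      by simp
    moreover have "shorter n \<dots>"
      by (intro shorter_add shorter_mono[OF sym_tw_shorter[OF w]] shorter_sym_right shorter_tw w lt) (use lt in simp)
    ultimately have "shorter n (sym H a * tw H w)" by simp
    then show ?thesis unfolding mult.assoc[symmetric] by (rule shorter_sym_right)
  qed (simp add: sym_0 shorter_0)
  then have "shorter n (\<Sum>w\<in>weyl H. sym H a * (tw H w * sym H (coef h w)))" by (rule shorter_sum)
  then show ?thesis unfolding sum_distrib_left[symmetric] coef_expand[of h, symmetric] .
qed

text \<open>
  At a \<open>u\<close> of maximal length the shorter terms created by straightening do not interfere.
\<close>

lemma coef_sym_left_top:
  assumes h: "shorter (Suc (len u)) h" and u: "u \<in> weyl H"
  shows "coef (sym H a * h) u = wact H (inv u) a * coef h u"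
proof -
  have "coef (sym H a * (tw H w * sym H (coef h w))) u = (if w = u then wact H (inv u) a * coef h u else 0)"
    if w: "w \<in> weyl H" for w
  proof (cases "coef h w = 0")
    case False
    then have le: "len w \<le> len u" using h w by (auto simp: shorter_def)
    have "coef (sym H a * tw H w - tw H w * sym H (wact H (inv w) a)) u = 0"
      by (rule shorter_coef[OF sym_tw_shorter[OF w] u le])
    then have "coef (sym H a * tw H w) u = coef (tw H w * sym H (wact H (inv w) a)) u" by (simp add: coef_diff)
    then show ?thesis
      unfolding mult.assoc[symmetric] coef_sym_right by (auto simp: coef_tw w u)
  qed (auto simp: sym_0 coef_0)
  then have "(\<Sum>w\<in>weyl H. coef (sym H a * (tw H w * sym H (coef h w))) u) = wact H (inv u) a * coef h u"
    using finite_weyl u by simp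
  then show ?thesis unfolding coef_sum[symmetric] sum_distrib_left[symmetric] coef_expand[of h, symmetric] .
qed

subsection \<open>Intertwining elements\<close>

text \<open>
  The relation that characterises \<open>R\<^sub>w\<close> up to a factor on the right.
\<close>

definition intertwines :: "('v \<Rightarrow> 'v) \<Rightarrow> 'h \<Rightarrow> bool" where
  "intertwines w X \<longleftrightarrow> (\<forall>a. sym H a * X = X * sym H (wact H (inv w) a))"

lemma wact_determines:
  assumes v: "v \<in> weyl H" and w: "w \<in> weyl H" and eq: "\<And>a. wact H (inv v) a = wact H (inv w) a"
  shows "v = w"
proof -
  have "inv v x = inv w x" for x
    using eq[of "lin H x"] lin_inject by (simp add: wact_lin weyl_inv v w)
  then have "inv v = inv w" by blast
  then have "inv (inv v) = inv (inv w)" by simp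
  then show ?thesis by (simp add: inv_inv_eq weyl_bij v w)
qed

text \<open>
  Comparing the coefficients of \<open>a X\<close> and \<open>X w\<^sup>-\<^sup>1(a)\<close> at \<open>u\<close> gives \<open>u\<^sup>-\<^sup>1(a) = w\<^sup>-\<^sup>1(a)\<close> for all \<open>a\<close>.
\<close>

lemma intertwines_top:
  assumes X: "intertwines w X" and w: "w \<in> weyl H" and u: "u \<in> weyl H" "coef X u \<noteq> 0" "shorter (Suc (len u)) X"
  shows "u = w"
proof (rule wact_determines[OF u(1) w])
  fix a
  have "wact H (inv u) a * coef X u = coef X u * wact H (inv w) a"
    using coef_sym_left_top[OF u(3,1), of a] X unfolding intertwines_def by (metis coef_sym_right)
  then show "wact H (inv u) a = wact H (inv w) a" using u(2) by (metis mult.commute mult_right_cancel)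
qed

lemma exists_top:
  assumes "X \<noteq> 0"
  obtains u where "u \<in> weyl H" "coef X u \<noteq> 0" "shorter (Suc (len u)) X"
proof -
  define S where "S = {u \<in> weyl H. coef X u \<noteq> 0}"
  have S: "finite S" "S \<noteq> {}" using coef_eqI[of X 0] assms finite_weyl by (auto simp: S_def coef_0)
  have "Max (len ` S) \<in> len ` S" using S by (intro Max_in) auto
  then obtain u where u: "u \<in> S" "len u = Max (len ` S)" by auto
  then have "len v \<le> len u" if "v \<in> S" for v using S that by simp
  then have "shorter (Suc (len u)) X" unfolding shorter_def S_def by (auto simp: less_Suc_eq_le)
  then show ?thesis using u(1) by (intro that[of u]) (simp_all add: S_def)
qed

lemma intertwines_shorter:
  assumes X: "intertwines w X" and w: "w \<in> weyl H"
  shows "shorter (Suc (len w)) X"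
proof (cases "X = 0")
  case False
  then obtain u where u: "u \<in> weyl H" "coef X u \<noteq> 0" "shorter (Suc (len u)) X" using exists_top by blast
  then show ?thesis using intertwines_top[OF X w] by blast
qed (simp add: shorter_0)

lemma intertwines_support:
  assumes X: "intertwines w X" and w: "w \<in> weyl H" and u: "u \<in> weyl H" "len w \<le> len u" "u \<noteq> w"
  shows "coef X u = 0"
proof (rule ccontr)
  assume "coef X u \<noteq> 0"
  then show False
    using intertwines_top[OF X w u(1) _ shorter_mono[OF intertwines_shorter[OF X w]]] u(2,3) by simp
qed

text \<open>
  A nonzero \<open>X\<close> has a term of maximal length, which can only be the one at \<open>w\<close>.
\<close>

lemma intertwines_zero:
  assumes X: "intertwines w X" and w: "w \<in> weyl H" and c: "coef X w = 0"
  shows "X = 0"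
proof (rule ccontr)
  assume "X \<noteq> 0"
  then obtain u where "u \<in> weyl H" "coef X u \<noteq> 0" "shorter (Suc (len u)) X" using exists_top by blast
  then show False using intertwines_top[OF X w] c by blast
qed

lemma intertwines_mult:
  assumes "intertwines v X" "intertwines w Y" and v: "v \<in> weyl H" and w: "w \<in> weyl H"
  shows "intertwines (v \<circ> w) (X * Y)"
proof -
  have "wact H (inv (v \<circ> w)) a = wact H (inv w) (wact H (inv v) a)" for a
    by (simp only: o_inv_distrib[OF weyl_bij[OF v] weyl_bij[OF w]] wact_comp[OF weyl_inv[OF w] weyl_inv[OF v]])
  then show ?thesis using assms(1,2) unfolding intertwines_def by (metis mult.assoc)
qed

lemma intertwines_sym_right: "intertwines w X \<Longrightarrow> intertwines w (X * sym H a)"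
  unfolding intertwines_def by (metis mult.assoc sym_comm)

lemma intertwines_1: "intertwines id 1"
  unfolding intertwines_def inv_id wact_id by simp

abbreviation kap :: "'v \<Rightarrow> 'w polyfun" where
  "kap \<alpha> \<equiv> pconst (complex_of_real (param H \<alpha>))"

text \<open>
  The numerator of \<open>R\<^bsub>s\<^sub>\<alpha>\<^esub>\<close>: it equals \<open>R\<^bsub>s\<^sub>\<alpha>\<^esub> (k\<^sub>\<alpha> - \<alpha>)\<close> and has polynomial coefficients.
\<close>

definition tau :: "'v \<Rightarrow> 'h" where
  "tau \<alpha> = tw H (root_refl H \<alpha>) * sym H (lin H \<alpha>) - sym H (kap \<alpha>)"

definition tau_word :: "'v list \<Rightarrow> 'h" where
  "tau_word \<alpha>s = prod_list (map tau \<alpha>s)"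

lemma tau_word_Nil: "tau_word [] = 1" and tau_word_Cons: "tau_word (\<alpha> # \<alpha>s) = tau \<alpha> * tau_word \<alpha>s"
  by (simp_all add: tau_word_def)

lemma intertwines_tau:
  assumes \<alpha>: "\<alpha> \<in> simples H"
  shows "intertwines (root_refl H \<alpha>) (tau \<alpha>)"
  unfolding intertwines_def
proof
  fix a
  let ?s = "root_refl H \<alpha>"
  have si: "inv ?s = ?s" using inv_unique_comp refl_comp_refl[OF simple_root[OF \<alpha>]] by blast
  obtain b where b: "lin H \<alpha> * b = a - wact H ?s a"
    "sym H a * tw H ?s = tw H ?s * sym H (wact H ?s a) + sym H (kap \<alpha> * b)" using sym_tw_refl[OF \<alpha>] by metis
  have "sym H a * tau \<alpha> = sym H a * tw H ?s * sym H (lin H \<alpha>) - sym H (kap \<alpha> * a)"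
    by (simp add: tau_def right_diff_distrib mult.assoc sym_mult sym_comm)
  also have "\<dots> = tw H ?s * sym H (wact H ?s a) * sym H (lin H \<alpha>) + sym H (kap \<alpha> * (lin H \<alpha> * b)) - sym H (kap \<alpha> * a)"
    unfolding b(2) by (simp add: distrib_right sym_mult mult.assoc sym_comm[of b])
  also have "\<dots> = tau \<alpha> * sym H (wact H ?s a)"
    unfolding b(1) by (simp add: tau_def left_diff_distrib right_diff_distrib sym_diff sym_mult mult.assoc sym_comm[of "lin H \<alpha>"])
  finally show "sym H a * tau \<alpha> = tau \<alpha> * sym H (wact H (inv ?s) a)" unfolding si .
qed

lemma intertwines_tau_word: "set \<alpha>s \<subseteq> simples H \<Longrightarrow> intertwines (refl_word H \<alpha>s) (tau_word \<alpha>s)"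
proof (induction \<alpha>s)
  case Nil
  show ?case unfolding refl_word_Nil tau_word_Nil by (rule intertwines_1)
next
  case (Cons \<alpha> \<alpha>s)
  then have \<alpha>: "\<alpha> \<in> simples H" and sub: "set \<alpha>s \<subseteq> simples H" by auto
  show ?case unfolding refl_word_Cons tau_word_Cons
    by (rule intertwines_mult[OF intertwines_tau[OF \<alpha>] Cons.IH[OF sub] refl_simple_weyl[OF \<alpha>] word_weyl[OF sub]])
qed

lemma reduced_word_Cons:
  assumes "set (\<alpha> # \<alpha>s) \<subseteq> simples H" "length (\<alpha> # \<alpha>s) = len (refl_word H (\<alpha> # \<alpha>s))"
  shows "length \<alpha>s = len (refl_word H \<alpha>s)" "pos (inv (refl_word H \<alpha>s) \<alpha>)"
proof -
  have \<alpha>: "\<alpha> \<in> simples H" and w: "refl_word H \<alpha>s \<in> weyl H" and sub: "set \<alpha>s \<subseteq> simples H" using assms word_weyl by auto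
  have l: "len (root_refl H \<alpha> \<circ> refl_word H \<alpha>s) = Suc (length \<alpha>s)"
    using assms(2) by (subst refl_word_Cons[symmetric]) simp
  moreover have "len (root_refl H \<alpha> \<circ> refl_word H \<alpha>s) \<le> Suc (len (refl_word H \<alpha>s))" by (rule len_refl_comp[OF w \<alpha>])
  moreover have "len (refl_word H \<alpha>s) \<le> length \<alpha>s" by (rule len_word_le[OF sub])
  ultimately show *: "length \<alpha>s = len (refl_word H \<alpha>s)" by linarith
  show "pos (inv (refl_word H \<alpha>s) \<alpha>)"
    using len_left_neg[OF w \<alpha>] l * by force
qed

text \<open>
  Moving the factor \<open>\<alpha>\<close> of a new first letter past the rest of the word turns it into \<open>w\<^sup>-\<^sup>1(\<alpha>)\<close>, which is the
  inversion that the letter adds; the constant term of \<open>\<tau>\<^sub>\<alpha>\<close> contributes only to shorter terms.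
\<close>

lemma coef_tau_word:
  assumes "set \<alpha>s \<subseteq> simples H" "length \<alpha>s = len (refl_word H \<alpha>s)"
  shows "coef (tau_word \<alpha>s) (refl_word H \<alpha>s) = (\<Prod>\<gamma>\<in>inversions (refl_word H \<alpha>s). lin H \<gamma>)"
  using assms
proof (induction \<alpha>s)
  case Nil
  have none: "inversions id = {}" by (auto simp: inversions_def)
  show ?case by (simp only: refl_word_Nil tau_word_Nil coef_1[OF weyl_id] none prod.empty simp_thms if_True)
next
  case (Cons \<alpha> \<alpha>s)
  let ?w = "refl_word H \<alpha>s" and ?s = "root_refl H \<alpha>" and ?T = "tau_word \<alpha>s"
  have \<alpha>: "\<alpha> \<in> simples H" and w: "?w \<in> weyl H" and sub: "set \<alpha>s \<subseteq> simples H" using Cons.prems word_weyl by auto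
  note red = reduced_word_Cons[OF Cons.prems]
  note s = refl_simple_weyl[OF \<alpha>]
  have sw: "?s \<circ> ?w \<in> weyl H" using weyl_comp s w by blast
  have si: "inv ?s = ?s" using inv_unique_comp refl_comp_refl[OF simple_root[OF \<alpha>]] by blast
  have l: "len (?s \<circ> ?w) = Suc (len ?w)" by (rule len_left_pos[OF w \<alpha> red(2)])
  have sh: "shorter (Suc (len ?w)) ?T" by (rule intertwines_shorter[OF intertwines_tau_word[OF sub] w])
  have "tau_word (\<alpha> # \<alpha>s) = tw H ?s * (sym H (lin H \<alpha>) * ?T) - sym H (kap \<alpha>) * ?T"
    by (simp add: tau_word_def tau_def left_diff_distrib mult.assoc)
  then have "coef (tau_word (\<alpha> # \<alpha>s)) (?s \<circ> ?w)
      = coef (sym H (lin H \<alpha>) * ?T) (?s \<circ> (?s \<circ> ?w)) - coef (sym H (kap \<alpha>) * ?T) (?s \<circ> ?w)"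
    by (simp only: coef_diff coef_tw_left[OF s sw] si)
  also have "coef (sym H (kap \<alpha>) * ?T) (?s \<circ> ?w) = 0"
    by (rule shorter_coef[OF shorter_sym_left[OF sh] sw]) (simp only: l order_refl)
  also have "?s \<circ> (?s \<circ> ?w) = ?w" by (simp only: comp_assoc[symmetric] refl_comp_refl[OF simple_root[OF \<alpha>]] id_comp)
  also have "coef (sym H (lin H \<alpha>) * ?T) ?w = lin H (inv ?w \<alpha>) * (\<Prod>\<gamma>\<in>inversions ?w. lin H \<gamma>)"
    using coef_sym_left_top[OF sh w] Cons.IH[OF sub red(1)] by (simp add: wact_lin[OF weyl_inv[OF w]])
  also have "\<dots> - 0 = (\<Prod>\<gamma>\<in>insert (inv ?w \<alpha>) (inversions ?w). lin H \<gamma>)"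
    using inversions_left_pos(2)[OF w \<alpha> red(2)] finite_inversions by simp
  finally show ?case unfolding inversions_left_pos(1)[OF w \<alpha> red(2), symmetric] by (subst (1 2) refl_word_Cons)
qed

lemma inversions_prod_nonzero: "(\<Prod>\<gamma>\<in>inversions w. lin H \<gamma>) \<noteq> 0"
proof -
  have "lin H \<gamma> \<noteq> 0" if "\<gamma> \<in> inversions w" for \<gamma>
    using that root_nonzero pos_root lin_inject[of \<gamma> 0] by (auto simp: lin_0 inversions_def)
  then show ?thesis using finite_inversions by simp
qed

subsection \<open>Parabolic subalgebras\<close>

lemma wact_pconst_refl: "\<alpha> \<in> simples H \<Longrightarrow> wact H (root_refl H \<alpha>) (pconst c) = pconst c"
  using wact_hom(3) refl_simple_weyl by blast

lemma lin_simple_nonzero: "\<alpha> \<in> simples H \<Longrightarrow> lin H \<alpha> \<noteq> 0"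
  using root_nonzero[OF simple_root] lin_inject[of \<alpha> 0] by (auto simp: lin_0)

text \<open>
  The divided difference of a constant is zero.
\<close>

lemma pconst_central: "sym H (pconst c) * h = h * sym H (pconst c)"
proof -
  have tw: "sym H (pconst c) * tw H w = tw H w * sym H (pconst c)" if "w \<in> weyl H" for w
    using that
  proof (induction w rule: weyl_reduced_induct)
    case id show ?case by (simp only: tw_one mult_1_left mult_1_right)
  next
    case (refl \<alpha> w)
    have s: "sym H (pconst c) * tw H (root_refl H \<alpha>) = tw H (root_refl H \<alpha>) * sym H (pconst c)"
    proof -
      obtain b where b: "lin H \<alpha> * b = pconst c - wact H (root_refl H \<alpha>) (pconst c)"
        "sym H (pconst c) * tw H (root_refl H \<alpha>) = tw H (root_refl H \<alpha>) * sym H (wact H (root_refl H \<alpha>) (pconst c))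
          + sym H (kap \<alpha> * b)" using sym_tw_refl[OF refl(1)] by metis
      have "b = 0" using b(1) lin_simple_nonzero[OF refl(1)] by (simp add: wact_pconst_refl[OF refl(1)])
      then show ?thesis using b(2) by (simp add: wact_pconst_refl[OF refl(1)] sym_0)
    qed
    then show ?case
      unfolding tw_mult[OF refl_simple_weyl[OF refl(1)] refl(2)]
      by (simp only: mult.assoc[symmetric] s) (simp only: mult.assoc refl(4))
  qed
  have "sym H (pconst c) * (\<Sum>w\<in>weyl H. tw H w * sym H (coef h w)) = (\<Sum>w\<in>weyl H. tw H w * sym H (coef h w)) * sym H (pconst c)"
    unfolding sum_distrib_left sum_distrib_right
  proof (rule sum.cong[OF refl])
    fix w assume "w \<in> weyl H"
    then show "sym H (pconst c) * (tw H w * sym H (coef h w)) = tw H w * sym H (coef h w) * sym H (pconst c)"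
      by (simp only: mult.assoc[symmetric] tw) (simp only: mult.assoc sym_comm[of "pconst c" "coef h w"])
  qed
  then show ?thesis unfolding coef_expand[of h, symmetric] .
qed

definition supported :: "('v \<Rightarrow> 'v) set \<Rightarrow> 'h \<Rightarrow> bool" where
  "supported G h \<longleftrightarrow> (\<forall>w\<in>weyl H. coef h w \<noteq> 0 \<longrightarrow> w \<in> G)"

lemma supported_0: "supported G 0" by (simp add: supported_def coef_0)

lemma supported_add: "supported G g \<Longrightarrow> supported G h \<Longrightarrow> supported G (g + h)"
  unfolding supported_def coef_add by (metis add.right_neutral)

lemma supported_sum: "(\<And>i. i \<in> I \<Longrightarrow> supported G (f i)) \<Longrightarrow> supported G (\<Sum>i\<in>I. f i)"
  by (induction I rule: infinite_finite_induct) (auto simp: supported_0 intro: supported_add)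

lemma supported_sym_right: "supported G h \<Longrightarrow> supported G (h * sym H a)"
  unfolding supported_def coef_sym_right by auto

lemma levi_inv_group: "M \<subseteq> simples H \<Longrightarrow> u \<in> refl_group H M \<Longrightarrow> inv u \<in> refl_group H M"
  using refl_group_bij_inv simples_roots by blast

lemma supported_tw_left:
  assumes M: "M \<subseteq> simples H" and u: "u \<in> refl_group H M" and h: "supported (refl_group H M) h"
  shows "supported (refl_group H M) (tw H u * h)"
  unfolding supported_def
proof (intro ballI impI)
  fix w assume w: "w \<in> weyl H" and c: "coef (tw H u * h) w \<noteq> 0"
  note uW = simple_group_weyl[OF M u]
  have "inv u \<circ> w \<in> refl_group H M"
    using c h weyl_comp[OF weyl_inv[OF uW] w] coef_tw_left[OF uW w] by (simp add: supported_def)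
  then have "u \<circ> (inv u \<circ> w) \<in> refl_group H M" using refl_group_comp u by blast
  then show "w \<in> refl_group H M" by (simp only: comp_assoc[symmetric] weyl_inv_comp(2)[OF uW] id_comp)
qed

lemma supported_tw: "M \<subseteq> simples H \<Longrightarrow> u \<in> refl_group H M \<Longrightarrow> supported (refl_group H M) (tw H u)"
  using simple_group_weyl by (auto simp: supported_def coef_tw split: if_splits)

lemma supported_1: "M \<subseteq> simples H \<Longrightarrow> supported (refl_group H M) 1"
  using supported_tw[OF _ refl_group.one] by (simp only: tw_one)

lemma supported_sym_tw:
  assumes M: "M \<subseteq> simples H"
  shows "u \<in> refl_group H M \<Longrightarrow> supported (refl_group H M) (sym H a * tw H u)"
proof (induction arbitrary: a rule: refl_group.induct)
  case one
  show ?case using supported_sym_right[OF supported_1[OF M]] by (simp only: tw_one mult_1_left mult_1_right)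
next
  case (step \<alpha> u)
  have \<alpha>: "\<alpha> \<in> simples H" using M step.hyps by blast
  let ?s = "root_refl H \<alpha>"
  obtain b where b: "sym H a * tw H ?s = tw H ?s * sym H (wact H ?s a) + sym H (kap \<alpha> * b)"
    using sym_tw_refl[OF \<alpha>] by metis
  have "sym H a * tw H (?s \<circ> u) = tw H ?s * (sym H (wact H ?s a) * tw H u) + sym H (kap \<alpha> * b) * tw H u"
    unfolding tw_mult[OF refl_simple_weyl[OF \<alpha>] simple_group_weyl[OF M step.hyps(2)]] mult.assoc[symmetric] b
    by (simp add: algebra_simps)
  also have "supported (refl_group H M) \<dots>"
    by (intro supported_add supported_tw_left[OF M refl_group_refl[OF step.hyps(1)]] step.IH)
  finally show ?case .
qed

lemma supported_sym: "M \<subseteq> simples H \<Longrightarrow> supported (refl_group H M) (sym H a)"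
  using supported_sym_tw[OF _ refl_group.one] by (simp only: tw_one mult_1_right)

lemma supported_expand:
  assumes M: "M \<subseteq> simples H" and h: "supported (refl_group H M) h"
  shows "h = (\<Sum>u\<in>refl_group H M. tw H u * sym H (coef h u))"
proof -
  have "h = (\<Sum>u\<in>weyl H. tw H u * sym H (coef h u))" by (rule coef_expand)
  also have "\<dots> = (\<Sum>u\<in>refl_group H M. tw H u * sym H (coef h u))"
    by (rule sum.mono_neutral_right[OF finite_weyl])
      (use h simple_group_weyl[OF M] in \<open>auto simp: supported_def sym_0\<close>)
  finally show ?thesis .
qed

lemma supported_mult:
  assumes M: "M \<subseteq> simples H" and g: "supported (refl_group H M) g" and h: "supported (refl_group H M) h"
  shows "supported (refl_group H M) (g * h)"
proof -
  have "g * h = (\<Sum>u\<in>refl_group H M. \<Sum>v\<in>refl_group H M. tw H u * (sym H (coef g u) * tw H v) * sym H (coef h v))"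
    by (subst supported_expand[OF M g], subst supported_expand[OF M h])
      (simp add: sum_product mult.assoc)
  also have "supported (refl_group H M) \<dots>"
    by (intro supported_sum supported_sym_right supported_tw_left[OF M] supported_sym_tw[OF M])
  finally show ?thesis .
qed

lemma levi_tw: "u \<in> refl_group H M \<Longrightarrow> tw H u \<in> levi H M"
  and levi_sym: "sym H a \<in> levi H M"
  unfolding levi_def by (auto intro: generated_subalgebra.gen)

lemma levi_add: "g \<in> levi H M \<Longrightarrow> h \<in> levi H M \<Longrightarrow> g + h \<in> levi H M"
  and levi_mult: "g \<in> levi H M \<Longrightarrow> h \<in> levi H M \<Longrightarrow> g * h \<in> levi H M"
  and levi_1: "1 \<in> levi H M"
  unfolding levi_def by (auto intro: generated_subalgebra.intros)

lemma levi_diff: "g \<in> levi H M \<Longrightarrow> h \<in> levi H M \<Longrightarrow> g - h \<in> levi H M"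
  using levi_add[of g M "sym H (- 1) * h"] levi_mult[OF levi_sym, of h M "- 1"] by (simp add: sym_minus sym_one)

lemma levi_sum: "(\<And>i. i \<in> I \<Longrightarrow> f i \<in> levi H M) \<Longrightarrow> (\<Sum>i\<in>I. f i) \<in> levi H M"
  using levi_sym[of 0 M]
  by (induction I rule: infinite_finite_induct) (auto simp: sym_0 intro: levi_add)

text \<open>
  Straightening \<open>a t\<^sub>u\<close> with \<open>u\<close> in \<open>W\<^sub>M\<close> uses reflections in \<open>M\<close> only, so the elements supported on \<open>W\<^sub>M\<close>
  are closed under multiplication.
\<close>

lemma levi_iff_supported:
  assumes M: "M \<subseteq> simples H"
  shows "h \<in> levi H M \<longleftrightarrow> supported (refl_group H M) h"
proof
  assume "h \<in> levi H M"
  then show "supported (refl_group H M) h" unfolding levi_def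
  proof (induction rule: generated_subalgebra.induct)
    case (gen g)
    then show ?case using supported_tw[OF M] supported_sym[OF M] by blast
  next
    case one
    show ?case by (rule supported_1[OF M])
  next
    case (scale a c)
    then show ?case using supported_mult[OF M supported_sym[OF M]] by (simp add: hscale_def)
  qed (auto intro: supported_add supported_mult[OF M])
next
  assume "supported (refl_group H M) h"
  from supported_expand[OF M this] show "h \<in> levi H M"
    by (metis (mono_tags, lifting) levi_sum levi_mult levi_tw levi_sym)
qed

lemma tau_word_levi: "set \<alpha>s \<subseteq> M \<Longrightarrow> tau_word \<alpha>s \<in> levi H M"
proof (induction \<alpha>s)
  case (Cons \<alpha> \<alpha>s)
  have "tau \<alpha> \<in> levi H M" unfolding tau_def
    by (intro levi_diff levi_mult levi_tw levi_sym refl_group_refl) (use Cons.prems in simp)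
  then show ?case using Cons levi_mult by (simp add: tau_word_def)
qed (simp add: tau_word_def levi_1)

end

section \<open>The star operation\<close>

locale starred_hecke_algebra = graded_hecke_algebra H
  for H :: "('v::real_vector, 'w::real_vector, 'h::ring_1, 'z) hecke_scheme" (structure) +
  fixes star :: "'h \<Rightarrow> 'h"
  assumes hecke_star: "hecke_star H star"
begin

lemma star_add: "star (g + h) = star g + star h"
  and star_hscale: "star (hscale H c h) = hscale H (cnj c) (star h)"
  and star_mult: "star (g * h) = star h * star g"
  and star_tw: "w \<in> weyl H \<Longrightarrow> star (tw H w) = tw H (inv w)"
  and star_clin: "star (sym H (clin H x y)) = sym H (clin H x (- y))"
  using hecke_star unfolding hecke_star_def by blast+

lemma star_0: "star 0 = 0" using star_add[of 0 0] by simp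

lemma star_sum: "star (\<Sum>i\<in>I. f i) = (\<Sum>i\<in>I. star (f i))"
  by (induction I rule: infinite_finite_induct) (simp_all add: star_0 star_add)

lemma star_1: "star 1 = 1"
  using star_tw[OF weyl_id] by (simp only: inv_id tw_one)

lemma star_sym: "star (sym H a) = sym H (pcnj a)"
proof (induction a rule: polyfun_induct)
  case (const c)
  show ?case using star_hscale[of c 1] by (simp add: hscale_def star_1 pcnj_pconst)
next
  case (lin x)
  have "clin H x 0 = lin H x" by (simp add: clin_def lin_0)
  then show ?case using star_clin[of x 0] by (simp add: pcnj_lin)
next
  case (add a b) then show ?case by (simp add: sym_add star_add pcnj_add)
next
  case (mult a b) then show ?case by (simp add: sym_mult star_mult pcnj_mult sym_comm)
qed

lemma star_star: "star (star h) = h"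
proof -
  have "star (star (tw H w * sym H a)) = tw H w * sym H a" if "w \<in> weyl H" for w a
    by (simp add: star_mult star_tw that weyl_inv inv_inv_eq weyl_bij star_sym pcnj_pcnj)
  then have "star (star (\<Sum>w\<in>weyl H. tw H w * sym H (coef h w))) = (\<Sum>w\<in>weyl H. tw H w * sym H (coef h w))"
    by (simp add: star_sum)
  then show ?thesis unfolding coef_expand[of h, symmetric] .
qed

lemma star_levi:
  assumes M: "M \<subseteq> simples H"
  shows "h \<in> levi H M \<Longrightarrow> star h \<in> levi H M"
proof -
  assume "h \<in> levi H M"
  then show ?thesis unfolding levi_def
  proof (induction rule: generated_subalgebra.induct)
    case (gen g)
    then show ?case
    proof
      assume "g \<in> tw H ` refl_group H M"
      then obtain u where "u \<in> refl_group H M" "g = tw H u" by blast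
      then show ?thesis
        using star_tw[OF simple_group_weyl[OF M]] levi_inv_group[OF M] by (auto intro: generated_subalgebra.gen)
    qed (auto simp: star_sym intro: generated_subalgebra.gen)
  qed (auto simp: star_1 star_hscale star_add star_mult intro: generated_subalgebra.intros)
qed

end

section \<open>The transfer and the top coset\<close>

locale hecke_transfer = starred_hecke_algebra H star
  for H :: "('v::real_vector, 'w::real_vector, 'h::ring_1, 'z) hecke_scheme" (structure) and star +
  fixes M :: "'v set" and \<phi> :: "'h \<Rightarrow> 'h"
  assumes M: "M \<subseteq> simples H" and transfer: "levi_transfer H M \<phi>"
begin

abbreviation "N \<equiv> delta H ` M"
abbreviation "w0 \<equiv> w0M H M"
abbreviation "w0act \<equiv> wact H (inv w0)"

lemmas N = delta_image[OF M]
lemmas w0 = w0M_weyl[OF M]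
lemmas iw0 = weyl_inv[OF w0]

lemma \<phi>_bij: "bij_betw \<phi> (levi H M) (levi H N)"
  and \<phi>_1: "\<phi> 1 = 1"
  and \<phi>_hscale: "a \<in> levi H M \<Longrightarrow> \<phi> (hscale H c a) = hscale H c (\<phi> a)"
  and \<phi>_add: "a \<in> levi H M \<Longrightarrow> b \<in> levi H M \<Longrightarrow> \<phi> (a + b) = \<phi> a + \<phi> b"
  and \<phi>_mult: "a \<in> levi H M \<Longrightarrow> b \<in> levi H M \<Longrightarrow> \<phi> (a * b) = \<phi> a * \<phi> b"
  and \<phi>_tw: "m \<in> refl_group H M \<Longrightarrow> \<phi> (tw H m) = tw H (inv w0 \<circ> m \<circ> w0)"
  and \<phi>_clin: "\<phi> (sym H (clin H x y)) = sym H (clin H (inv w0 x) (inv w0 y))"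
  using transfer unfolding levi_transfer_def by blast+

lemma \<phi>_sym: "\<phi> (sym H a) = sym H (w0act a)"
proof (induction a rule: polyfun_induct)
  case (const c)
  show ?case using \<phi>_hscale[OF levi_1, of c] by (simp add: hscale_def \<phi>_1 wact_hom iw0)
next
  case (lin x)
  have "clin H y 0 = lin H y" for y by (simp add: clin_def lin_0)
  then show ?case using \<phi>_clin[of x 0] linear_0[OF weyl_linear[OF iw0]] by (simp add: wact_lin iw0)
next
  case (add a b) then show ?case by (simp add: sym_add \<phi>_add levi_sym wact_hom iw0)
next
  case (mult a b) then show ?case by (simp add: sym_mult \<phi>_mult levi_sym wact_hom iw0)
qed

lemma \<phi>_levi: "a \<in> levi H M \<Longrightarrow> \<phi> a \<in> levi H N"
  using \<phi>_bij by (auto simp: bij_betw_def)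

lemma inv_w0_conj:
  assumes w: "w \<in> weyl H"
  shows "inv (inv w0 \<circ> w \<circ> w0) = inv w0 \<circ> inv w \<circ> w0"
proof -
  have "inv (inv w0 \<circ> w \<circ> w0) = inv w0 \<circ> inv (inv w0 \<circ> w)"
    by (rule o_inv_distrib[OF weyl_bij[OF weyl_comp[OF iw0 w]] weyl_bij[OF w0]])
  also have "inv (inv w0 \<circ> w) = inv w \<circ> inv (inv w0)"
    by (rule o_inv_distrib[OF weyl_bij[OF iw0] weyl_bij[OF w]])
  finally show ?thesis by (simp only: inv_inv_eq[OF weyl_bij[OF w0]] comp_assoc)
qed

text \<open>
  Both sides are conjugate linear anti-homomorphisms, so it is enough to compare them on generators.
\<close>

lemma \<phi>_star:
  assumes "a \<in> levi H M" shows "\<phi> (star a) = star (\<phi> a)"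
proof -
  have "a \<in> levi H M \<and> \<phi> (star a) = star (\<phi> a)" using assms unfolding levi_def
  proof (induction rule: generated_subalgebra.induct)
    case (gen g)
    then have "g \<in> levi H M" unfolding levi_def by (rule generated_subalgebra.gen)
    moreover have "\<phi> (star g) = star (\<phi> g)"
      using gen
    proof
      assume "g \<in> tw H ` refl_group H M"
      then obtain m where m: "m \<in> refl_group H M" "g = tw H m" by blast
      note W = simple_group_weyl[OF M m(1)]
      have "inv (inv w0 \<circ> m \<circ> w0) = inv w0 \<circ> inv m \<circ> w0" by (rule inv_w0_conj[OF W])
      then have "star (tw H (inv w0 \<circ> m \<circ> w0)) = tw H (inv w0 \<circ> inv m \<circ> w0)"
        using star_tw[OF weyl_comp[OF weyl_comp[OF iw0 W] w0]] by simp
      then show ?thesis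
        unfolding m(2) star_tw[OF W] \<phi>_tw[OF m(1)] \<phi>_tw[OF levi_inv_group[OF M m(1)]] by simp
    qed (auto simp: star_sym \<phi>_sym pcnj_wact iw0)
    ultimately show ?case unfolding levi_def by blast
  next
    case one
    show ?case using levi_1 by (simp add: star_1 \<phi>_1 levi_def)
  next
    case (scale a c)
    then have a: "a \<in> levi H M" unfolding levi_def by blast
    have "hscale H c a \<in> levi H M" unfolding hscale_def by (rule levi_mult[OF levi_sym a])
    then show ?case using scale a star_levi[OF M a] by (simp add: star_hscale \<phi>_hscale levi_def[symmetric])
  next
    case (add a b)
    then show ?case using star_levi[OF M] by (auto simp: levi_def[symmetric] star_add \<phi>_add levi_add)
  next
    case (mult a b)
    then show ?case using star_levi[OF M] by (auto simp: levi_def[symmetric] star_mult \<phi>_mult levi_mult)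
  qed
  then show ?thesis by blast
qed

text \<open>
  The component of \<open>h\<close> in \<open>t\<^bsub>w\<^sup>0\<^esub> \<H>\<^sub>N\<close>, divided by \<open>t\<^bsub>w\<^sup>0\<^esub>\<close>; this is \<open>\<epsilon>\<^sub>N(t\<^bsub>(w\<^sup>0)\<^sup>-\<^sup>1\<^esub> h)\<close> with polynomial coefficients.
\<close>

definition top_part :: "'h \<Rightarrow> 'h" where
  "top_part h = (\<Sum>u\<in>refl_group H N. tw H u * sym H (coef h (w0 \<circ> u)))"

lemma finite_levi_group: "A \<subseteq> simples H \<Longrightarrow> finite (refl_group H A)"
  using finite_subset[OF _ finite_weyl] simple_group_weyl by blast

lemma coef_top_part:
  assumes u: "u \<in> weyl H"
  shows "coef (top_part h) u = (if u \<in> refl_group H N then coef h (w0 \<circ> u) else 0)"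
proof -
  have "coef (tw H v * sym H (coef h (w0 \<circ> v))) u = (if v = u then coef h (w0 \<circ> u) else 0)"
    if "v \<in> refl_group H N" for v
    using simple_group_weyl[OF N that] u by (auto simp: coef_sym_right coef_tw)
  then show ?thesis unfolding top_part_def coef_sum using finite_levi_group[OF N] by simp
qed

lemma top_part_levi: "top_part h \<in> levi H N"
  unfolding top_part_def by (intro levi_sum levi_mult levi_tw levi_sym)

lemma top_part_add: "top_part (g + h) = top_part g + top_part h"
  by (simp add: top_part_def coef_add sym_add distrib_left sum.distrib)

lemma top_part_0: "top_part 0 = 0" using top_part_add[of 0 0] by simp

lemma top_part_sum: "top_part (\<Sum>i\<in>I. f i) = (\<Sum>i\<in>I. top_part (f i))"
  by (induction I rule: infinite_finite_induct) (simp_all add: top_part_0 top_part_add)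

lemma top_part_sym_right: "top_part (h * sym H a) = top_part h * sym H a"
  by (simp add: top_part_def coef_sym_right sym_mult sum_distrib_right mult.assoc)

lemma top_part_tw_left:
  assumes m: "m \<in> refl_group H M"
  shows "top_part (tw H m * h) = \<phi> (tw H m) * top_part h"
proof (rule coef_eqI)
  fix u assume u: "u \<in> weyl H"
  let ?m = "inv w0 \<circ> m \<circ> w0"
  have m': "?m \<in> refl_group H N" using w0M_conj(1)[OF M m] .
  note W = simple_group_weyl[OF M m] and W' = simple_group_weyl[OF N m'] and im' = levi_inv_group[OF N m']
  have "\<phi> (tw H m) * top_part h = tw H ?m * top_part h" by (simp only: \<phi>_tw[OF m])
  then have "coef (\<phi> (tw H m) * top_part h) u = coef (top_part h) (inv ?m \<circ> u)"
    by (simp only: coef_tw_left[OF W' u])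
  also have "\<dots> = (if inv ?m \<circ> u \<in> refl_group H N then coef h (w0 \<circ> (inv ?m \<circ> u)) else 0)"
    by (rule coef_top_part[OF weyl_comp[OF weyl_inv[OF W'] u]])
  also have "inv ?m \<circ> u \<in> refl_group H N \<longleftrightarrow> u \<in> refl_group H N"
  proof
    assume "inv ?m \<circ> u \<in> refl_group H N"
    then have "?m \<circ> (inv ?m \<circ> u) \<in> refl_group H N" by (rule refl_group_comp[OF m'])
    then show "u \<in> refl_group H N" by (simp only: comp_assoc[symmetric, of ?m] weyl_inv_comp(2)[OF W'] id_comp)
  qed (rule refl_group_comp[OF im'])
  also have "w0 \<circ> (inv ?m \<circ> u) = inv m \<circ> (w0 \<circ> u)"
  proof -
    have "m \<circ> w0 \<circ> inv ?m = w0 \<circ> (?m \<circ> inv ?m)"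
      by (simp only: comp_assoc[symmetric] weyl_inv_comp(2)[OF w0] id_comp)
    then have "m \<circ> w0 \<circ> inv ?m = w0" by (simp only: weyl_inv_comp(2)[OF W'] comp_id)
    then have "inv m \<circ> w0 = inv m \<circ> (m \<circ> (w0 \<circ> inv ?m))" by (simp only: comp_assoc)
    also have "\<dots> = w0 \<circ> inv ?m" by (simp only: comp_assoc[symmetric, of "inv m"] weyl_inv_comp(1)[OF W] id_comp)
    finally show ?thesis by (simp only: comp_assoc[symmetric])
  qed
  also have "(if u \<in> refl_group H N then coef h (inv m \<circ> (w0 \<circ> u)) else 0) = coef (top_part (tw H m * h)) u"
    using coef_top_part[OF u] coef_tw_left[OF W weyl_comp[OF w0 u]] by simp
  finally show "coef (top_part (tw H m * h)) u = coef (\<phi> (tw H m) * top_part h) u" by simp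
qed

lemma top_part_min_rep:
  assumes d: "d \<in> min_reps H N" and n: "n \<in> levi H N"
  shows "top_part (tw H d * n) = (if d = w0 then n else 0)"
proof (rule coef_eqI)
  fix u assume u: "u \<in> weyl H"
  note dW = min_repD(1)[OF N d]
  have n': "supported (refl_group H N) n" using n levi_iff_supported[OF N] by blast
  show "coef (top_part (tw H d * n)) u = coef (if d = w0 then n else 0) u"
  proof (cases "u \<in> refl_group H N")
    case False
    then show ?thesis using n' u by (auto simp: coef_top_part supported_def coef_0)
  next
    case True
    have c: "coef (top_part (tw H d * n)) u = coef n (inv d \<circ> (w0 \<circ> u))"
      using True coef_top_part[OF u] coef_tw_left[OF dW weyl_comp[OF w0 u]] by simp
    show ?thesis
    proof (cases "d = w0")
      case eq: True
      have "inv d \<circ> (w0 \<circ> u) = u" unfolding eq by (simp only: comp_assoc[symmetric] weyl_inv_comp(1)[OF w0] id_comp)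
      then show ?thesis using c eq by simp
    next
      case False
      have "coef n (inv d \<circ> (w0 \<circ> u)) = 0"
      proof (rule ccontr)
        let ?v = "inv d \<circ> (w0 \<circ> u)"
        assume "coef n ?v \<noteq> 0"
        then have v: "?v \<in> refl_group H N"
          using n' weyl_comp[OF weyl_inv[OF dW] weyl_comp[OF w0 u]] by (auto simp: supported_def)
        have "d \<circ> ?v = w0 \<circ> u" by (simp only: comp_assoc[symmetric] weyl_inv_comp(2)[OF dW] id_comp)
        then have eq: "(case (d, ?v) of (d, u) \<Rightarrow> d \<circ> u) = (case (w0, u) of (d, u) \<Rightarrow> d \<circ> u)" by (simp only: prod.case)
        have inj: "inj_on (\<lambda>(d, u). d \<circ> u) (min_reps H N \<times> refl_group H N)"
          using coset_decomposition_bij[OF N] unfolding bij_betw_def by (rule conjunct1)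
        have "(d, ?v) = (w0, u)"
          by (rule inj_onD[OF inj eq]) (intro SigmaI d v True w0M_min_rep[OF M])+
        then show False using False by blast
      qed
      then show ?thesis using c False by (simp add: coef_0)
    qed
  qed
qed

text \<open>
  Every element of the coset \<open>w\<^sup>0 W\<^sub>N\<close> is at least as long as \<open>w\<^sup>0\<close>, so \<open>w\<close> belongs to another coset.
\<close>

lemma top_part_short_tw:
  assumes w: "w \<in> weyl H" "len w < len w0" and n: "n \<in> levi H N"
  shows "top_part (tw H w * n) = 0"
proof -
  obtain d u where du: "d \<in> min_reps H N" "u \<in> refl_group H N" "w = d \<circ> u" using coset_decomposition[OF N w(1)] .
  have "d \<noteq> w0" using min_repD(3)[OF N w0M_min_rep[OF M] du(2)] du(3) w(2) by auto
  moreover have "tw H w * n = tw H d * (tw H u * n)"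
    unfolding du(3) tw_mult[OF min_repD(1)[OF N du(1)] simple_group_weyl[OF N du(2)]] by (simp add: mult.assoc)
  ultimately show ?thesis using top_part_min_rep[OF du(1) levi_mult[OF levi_tw[OF du(2)] n]] by simp
qed

lemma top_part_shorter:
  assumes r: "shorter (len w0) r" and n: "n \<in> levi H N"
  shows "top_part (r * n) = 0"
proof -
  have "r * n = (\<Sum>w\<in>weyl H. tw H w * (sym H (coef r w) * n))"
    by (subst coef_expand[of r]) (simp add: sum_distrib_right mult.assoc)
  moreover have "top_part (tw H w * (sym H (coef r w) * n)) = 0" if w: "w \<in> weyl H" for w
  proof (cases "coef r w = 0")
    case False
    then have "len w < len w0" using r w by (simp add: shorter_def)
    then show ?thesis using top_part_short_tw[OF w _ levi_mult[OF levi_sym n]] by blast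
  qed (simp add: sym_0 top_part_0)
  ultimately show ?thesis by (simp add: top_part_sum)
qed

text \<open>
  Decompose \<open>h\<close> into the parts \<open>t\<^sub>d n\<^sub>d\<close> with \<open>d\<close> a minimal length representative. For \<open>d \<noteq> w\<^sup>0\<close> the product
  \<open>a t\<^sub>d\<close> consists of terms shorter than \<open>w\<^sup>0\<close>, and for \<open>d = w\<^sup>0\<close> its only term that is not shorter is
  \<open>t\<^bsub>w\<^sup>0\<^esub> (w\<^sup>0)\<^sup>-\<^sup>1(a)\<close>.
\<close>

lemma top_part_sym_left: "top_part (sym H a * h) = sym H (w0act a) * top_part h"
proof -
  define n where "n d = (\<Sum>u\<in>refl_group H N. tw H u * sym H (coef h (d \<circ> u)))" for d
  have n: "n d \<in> levi H N" for d unfolding n_def by (intro levi_sum levi_mult levi_tw levi_sym)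
  have "h = (\<Sum>w\<in>weyl H. tw H w * sym H (coef h w))" by (rule coef_expand)
  also have "\<dots> = (\<Sum>(d, u)\<in>min_reps H N \<times> refl_group H N. tw H (d \<circ> u) * sym H (coef h (d \<circ> u)))"
    using sum.reindex_bij_betw[OF coset_decomposition_bij[OF N], of "\<lambda>w. tw H w * sym H (coef h w)"]
    by (simp add: case_prod_beta)
  also have "\<dots> = (\<Sum>d\<in>min_reps H N. \<Sum>u\<in>refl_group H N. tw H (d \<circ> u) * sym H (coef h (d \<circ> u)))"
    by (rule sum.cartesian_product[symmetric])
  also have "\<dots> = (\<Sum>d\<in>min_reps H N. tw H d * n d)"
    unfolding n_def sum_distrib_left
    by (intro sum.cong refl)
      (simp add: tw_mult[OF min_repD(1)[OF N] simple_group_weyl[OF N]] mult.assoc)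
  finally have h: "h = (\<Sum>d\<in>min_reps H N. tw H d * n d)" .
  have each: "top_part (sym H a * (tw H d * n d)) = sym H (w0act a) * top_part (tw H d * n d)"
    if d: "d \<in> min_reps H N" for d
  proof (cases "d = w0")
    case True
    define r where "r = sym H a * tw H w0 - tw H w0 * sym H (w0act a)"
    have "sym H a * (tw H d * n d) = tw H w0 * (sym H (w0act a) * n d) + r * n d"
      unfolding True r_def by (simp add: algebra_simps)
    moreover have "top_part (r * n d) = 0"
      by (rule top_part_shorter[OF _ n]) (use sym_tw_shorter[OF w0] in \<open>simp add: r_def\<close>)
    ultimately show ?thesis
      using top_part_min_rep[OF w0M_min_rep[OF M] levi_mult[OF levi_sym n]] top_part_min_rep[OF w0M_min_rep[OF M] n] True
      by (simp add: top_part_add)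
  next
    case False
    note dW = min_repD(1)[OF N d]
    have "shorter (len w0) (sym H a * tw H d)"
      by (rule shorter_sym_left[OF shorter_tw[OF dW len_min_rep_less[OF M d False]]])
    then have "top_part (sym H a * tw H d * n d) = 0" by (rule top_part_shorter[OF _ n])
    then show ?thesis using top_part_min_rep[OF d n] False by (simp add: mult.assoc)
  qed
  have "top_part (sym H a * (\<Sum>d\<in>min_reps H N. tw H d * n d)) = sym H (w0act a) * top_part (\<Sum>d\<in>min_reps H N. tw H d * n d)"
    unfolding sum_distrib_left top_part_sum by (rule sum.cong) (use each in auto)
  then show ?thesis unfolding h[symmetric] .
qed

lemma top_part_levi_left:
  assumes "m \<in> levi H M" shows "top_part (m * h) = \<phi> m * top_part h"
proof -
  have "m \<in> levi H M \<and> (\<forall>h. top_part (m * h) = \<phi> m * top_part h)" using assms unfolding levi_def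
  proof (induction rule: generated_subalgebra.induct)
    case (gen g)
    then show ?case using top_part_tw_left top_part_sym_left \<phi>_sym by (auto intro: generated_subalgebra.gen)
  next
    case one
    show ?case by (simp add: \<phi>_1 generated_subalgebra.one)
  next
    case (scale a c)
    then have a: "a \<in> levi H M" unfolding levi_def by blast
    have "hscale H c a \<in> levi H M" unfolding hscale_def by (rule levi_mult[OF levi_sym a])
    moreover have "top_part (hscale H c a * h) = \<phi> (hscale H c a) * top_part h" for h
      using scale unfolding \<phi>_hscale[OF a] unfolding hscale_def
      by (simp add: mult.assoc top_part_sym_left wact_hom iw0)
    ultimately show ?case unfolding levi_def by blast
  next
    case (add a b)
    then have "a \<in> levi H M" "b \<in> levi H M" unfolding levi_def by blast+
    with add show ?case by (simp add: levi_def[symmetric] levi_add \<phi>_add distrib_right top_part_add)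
  next
    case (mult a b)
    then have "a \<in> levi H M" "b \<in> levi H M" unfolding levi_def by blast+
    with mult show ?case by (simp add: levi_def[symmetric] levi_mult \<phi>_mult mult.assoc)
  qed
  then show ?thesis by blast
qed

text \<open>
  The other elements of \<open>w\<^sup>0 W\<^sub>N\<close> are at least as long as \<open>w\<^sup>0\<close>, and there \<open>h\<^sub>0\<close> has coefficient zero.
\<close>

lemma top_part_intertwiner:
  assumes h0: "intertwines w0 h0"
  shows "top_part h0 = sym H (coef h0 w0)"
proof (rule coef_eqI)
  fix u assume u: "u \<in> weyl H"
  show "coef (top_part h0) u = coef (sym H (coef h0 w0)) u"
  proof (cases "u \<in> refl_group H N \<and> u \<noteq> id")
    case True
    have "len w0 \<le> len (w0 \<circ> u)" using min_repD(3)[OF N w0M_min_rep[OF M]] True by blast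
    moreover have "w0 \<circ> u \<noteq> w0"
    proof
      assume "w0 \<circ> u = w0"
      then have "inv w0 \<circ> (w0 \<circ> u) = inv w0 \<circ> w0" by (simp only:)
      then have "u = id" by (simp only: comp_assoc[symmetric] weyl_inv_comp(1)[OF w0] id_comp)
      then show False using True by blast
    qed
    ultimately have "coef h0 (w0 \<circ> u) = 0" using intertwines_support[OF h0 w0 weyl_comp[OF w0 u]] by blast
    then show ?thesis using True by (simp only: coef_top_part[OF u] coef_sym[OF u] if_False if_True simp_thms)
  next
    case False
    then show ?thesis
    proof (cases "u = id")
      case True
      have "id \<in> refl_group H N" by (rule refl_group.one)
      then show ?thesis unfolding True by (simp only: coef_top_part[OF weyl_id] coef_sym[OF weyl_id] comp_id if_True simp_thms)
    next
      case nid: False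
      then have "u \<notin> refl_group H N" using False by blast
      then show ?thesis using nid by (simp only: coef_top_part[OF u] coef_sym[OF u] if_False)
    qed
  qed
qed

lemma w0act_injective: "w0act a = 0 \<Longrightarrow> a = 0"
  using wact_inv'[OF w0, of a] wact_zero_one(1)[OF w0] by simp

lemma \<phi>_intertwines:
  assumes X: "intertwines w X" "X \<in> levi H M" and w: "w \<in> weyl H"
  shows "sym H (w0act a) * \<phi> X = \<phi> X * sym H (w0act (wact H (inv w) a))"
proof -
  have "\<phi> (sym H a * X) = \<phi> (X * sym H (wact H (inv w) a))" using X(1) unfolding intertwines_def by metis
  then show ?thesis by (simp add: \<phi>_mult X(2) levi_sym \<phi>_sym)
qed

text \<open>
  Here \<open>Q/P\<close> stands for the leading coefficient of \<open>R\<^sup>0\<close>, and \<open>h\<^sub>0\<close> for \<open>R\<^sup>0 q\<close>. The difference \<open>\<Theta>\<close> of the two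
  sides is a bimodule map for the polynomials, twisted by \<open>(w\<^sup>0)\<^sup>-\<^sup>1\<close>, with values in \<open>\<H>\<^sub>N\<close>. Its value at an
  intertwining element for \<open>w\<close> is an intertwining element for \<open>(w\<^sup>0)\<^sup>-\<^sup>1 w w\<^sup>0\<close>; for \<open>w\<close> outside \<open>W\<^sub>M\<close> this forces
  it to vanish, and for \<open>w\<close> in \<open>W\<^sub>M\<close> it vanishes because \<open>P\<close> and \<open>Q\<close> are real and invariant under \<open>W\<^sub>N\<close>.
\<close>

lemma top_part_symmetry:
  assumes h0: "intertwines w0 h0" and P: "P \<noteq> 0" and lead: "coef h0 w0 * P = q * Q"
    and real: "pcnj P = P" "pcnj Q = Q"
    and invar: "\<And>u. u \<in> refl_group H N \<Longrightarrow> wact H u P = P" "\<And>u. u \<in> refl_group H N \<Longrightarrow> wact H u Q = Q"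
  shows "sym H (pcnj q) * top_part (h * h0) = star (top_part (star h * h0)) * sym H q"
proof -
  define \<Theta> where "\<Theta> h = sym H (pcnj q) * top_part (h * h0) - star (top_part (star h * h0)) * sym H q" for h
  have h0r: "sym H a * h0 = h0 * sym H (w0act a)" for a using h0 unfolding intertwines_def by blast
  have \<Theta>_add: "\<Theta> (g + h) = \<Theta> g + \<Theta> h" for g h
    by (simp add: \<Theta>_def distrib_right distrib_left star_add top_part_add)
  have \<Theta>_0: "\<Theta> 0 = 0" by (simp add: \<Theta>_def star_0 top_part_0)
  have \<Theta>_sum: "\<Theta> (\<Sum>i\<in>I. f i) = (\<Sum>i\<in>I. \<Theta> (f i))" for I :: "('v \<Rightarrow> 'v) set" and f
    by (induction I rule: infinite_finite_induct) (simp_all add: \<Theta>_0 \<Theta>_add)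
  have \<Theta>_levi: "\<Theta> h \<in> levi H N" for h
    unfolding \<Theta>_def by (intro levi_diff levi_mult levi_sym star_levi[OF N] top_part_levi)
  have \<Theta>_right: "\<Theta> (h * sym H a) = \<Theta> h * sym H (w0act a)" for h a
  proof -
    have 1: "top_part (h * sym H a * h0) = top_part (h * h0) * sym H (w0act a)"
      by (simp add: mult.assoc h0r top_part_sym_right[symmetric])
    have 2: "star (top_part (star (h * sym H a) * h0)) = star (top_part (star h * h0)) * sym H (w0act a)"
      by (simp add: star_mult star_sym mult.assoc top_part_sym_left pcnj_wact[OF iw0, symmetric] pcnj_pcnj)
    show ?thesis unfolding \<Theta>_def 1 2 by (simp add: left_diff_distrib mult.assoc sym_comm[of q])
  qed
  have \<Theta>_left: "\<Theta> (sym H a * h) = sym H (w0act a) * \<Theta> h" for h a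
  proof -
    have 1: "top_part (sym H a * h * h0) = sym H (w0act a) * top_part (h * h0)"
      by (simp add: mult.assoc top_part_sym_left)
    have 2: "star (top_part (star (sym H a * h) * h0)) = sym H (w0act a) * star (top_part (star h * h0))"
      by (simp add: star_mult star_sym mult.assoc h0r)
        (simp add: mult.assoc[symmetric] top_part_sym_right star_mult star_sym pcnj_wact[OF iw0] pcnj_pcnj)
    show ?thesis unfolding \<Theta>_def 1 2
      by (simp add: right_diff_distrib mult.assoc) (simp add: mult.assoc[symmetric] sym_comm[of "pcnj q"])
  qed
  have intertwiner: "\<Theta> X = 0"
    if X: "intertwines w X" and w: "w \<in> weyl H" and lev: "w \<in> refl_group H M \<Longrightarrow> X \<in> levi H M" for w X
  proof (cases "w \<in> refl_group H M")
    case True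
    note XM = lev[OF True]
    define v where "v = inv w0 \<circ> w \<circ> w0"
    have v: "v \<in> refl_group H N" unfolding v_def by (rule w0M_conj(1)[OF M True])
    note vW = simple_group_weyl[OF N v] and iv = levi_inv_group[OF N v]
    have iv_eq: "inv v = inv w0 \<circ> inv w \<circ> w0"
      unfolding v_def by (rule inv_w0_conj[OF w])
    have Y: "sym H b * \<phi> X = \<phi> X * sym H (wact H (inv v) b)" for b
    proof -
      have "w0act (wact H (inv w) (wact H w0 b)) = wact H (inv v) b"
        by (simp only: iv_eq wact_comp[OF weyl_comp[OF iw0 weyl_inv[OF w]] w0] wact_comp[OF iw0 weyl_inv[OF w]])
      then show ?thesis using \<phi>_intertwines[OF X XM w, of "wact H w0 b"] by (simp add: wact_inv[OF w0])
    qed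
    let ?c = "coef h0 w0"
    have 1: "top_part (X * h0) = \<phi> X * sym H ?c"
      by (simp add: top_part_levi_left[OF XM] top_part_intertwiner[OF h0])
    have 2: "star (top_part (star X * h0)) = sym H (pcnj ?c) * \<phi> X"
      by (simp add: top_part_levi_left[OF star_levi[OF M XM]] top_part_intertwiner[OF h0] \<phi>_star[OF XM]
          star_mult star_star star_sym)
    have "\<Theta> X = \<phi> X * sym H (wact H (inv v) (pcnj q) * ?c - wact H (inv v) (pcnj ?c) * q)"
      unfolding \<Theta>_def 1 2
      by (simp add: mult.assoc[symmetric] Y) (simp add: mult.assoc right_diff_distrib sym_diff sym_mult)
    moreover have "(wact H (inv v) (pcnj q) * ?c - wact H (inv v) (pcnj ?c) * q) * P = 0"
    proof -
      have "pcnj ?c * P = pcnj q * Q" using arg_cong[OF lead, of pcnj] by (simp add: pcnj_mult real)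
      then have "wact H (inv v) (pcnj ?c) * P = wact H (inv v) (pcnj q) * Q"
        using arg_cong[of _ _ "wact H (inv v)"] by (metis wact_hom(2)[OF weyl_inv[OF vW]] invar[OF iv])
      then show ?thesis using lead by (simp add: left_diff_distrib mult.assoc)
    qed
    then have "wact H (inv v) (pcnj q) * ?c - wact H (inv v) (pcnj ?c) * q = 0" using P by simp
    ultimately show ?thesis by (simp add: sym_0)
  next
    case False
    define v where "v = inv w0 \<circ> w \<circ> w0"
    have vW: "v \<in> weyl H" unfolding v_def by (intro weyl_comp iw0 w w0)
    have iv_eq: "inv v = inv w0 \<circ> inv w \<circ> w0"
      unfolding v_def by (rule inv_w0_conj[OF w])
    have "intertwines v (\<Theta> X)" unfolding intertwines_def
    proof
      fix b
      let ?a = "wact H w0 b"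
      have "sym H b * \<Theta> X = \<Theta> (sym H ?a * X)" by (simp add: \<Theta>_left wact_inv[OF w0])
      also have "\<dots> = \<Theta> (X * sym H (wact H (inv w) ?a))" using X unfolding intertwines_def by metis
      also have "\<dots> = \<Theta> X * sym H (w0act (wact H (inv w) ?a))" by (rule \<Theta>_right)
      also have "w0act (wact H (inv w) ?a) = wact H (inv v) b"
        by (simp only: iv_eq wact_comp[OF weyl_comp[OF iw0 weyl_inv[OF w]] w0] wact_comp[OF iw0 weyl_inv[OF w]])
      finally show "sym H b * \<Theta> X = \<Theta> X * sym H (wact H (inv v) b)" .
    qed
    moreover have "v \<notin> refl_group H N"
    proof
      assume "v \<in> refl_group H N"
      then have "w0 \<circ> v \<circ> inv w0 \<in> refl_group H M" by (rule w0M_conj(2)[OF M])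
      moreover have "w0 \<circ> v \<circ> inv w0 = (w0 \<circ> inv w0) \<circ> w \<circ> (w0 \<circ> inv w0)" unfolding v_def by (simp only: comp_assoc)
      ultimately show False using False by (simp only: weyl_inv_comp(2)[OF w0] id_comp comp_id)
    qed
    then have "coef (\<Theta> X) v = 0" using \<Theta>_levi[of X] vW by (auto simp: levi_iff_supported[OF N] supported_def)
    ultimately show ?thesis using intertwines_zero vW by blast
  qed
  have tw: "\<Theta> (tw H w) = 0" if "w \<in> weyl H" for w
    using that
  proof (induction "len w" arbitrary: w rule: less_induct)
    case less
    obtain \<alpha>s where \<alpha>s: "set \<alpha>s \<subseteq> simples H" "refl_word H \<alpha>s = w" "length \<alpha>s = len w"
      "w \<in> refl_group H M \<Longrightarrow> set \<alpha>s \<subseteq> M"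
    proof (cases "w \<in> refl_group H M")
      case True
      then show ?thesis using levi_reduced_word[OF M True] that M by blast
    next
      case False
      then show ?thesis using levi_reduced_word[OF order_refl] less.prems weyl_simple_group that by blast
    qed
    \<comment> \<open>For \<open>w\<close> in \<open>W\<^sub>M\<close> the word has letters in \<open>M\<close>, which puts \<open>\<tau>\<close> into \<open>\<H>\<^sub>M\<close>.\<close>
    let ?X = "tau_word \<alpha>s" and ?c = "coef (tau_word \<alpha>s) w"
    have X: "intertwines w ?X" using intertwines_tau_word[OF \<alpha>s(1)] \<alpha>s(2) by simp
    have c: "?c \<noteq> 0" using coef_tau_word[OF \<alpha>s(1)] \<alpha>s(2,3) inversions_prod_nonzero by simp
    have z: "\<Theta> (tw H v * sym H (coef ?X v)) = 0" if v: "v \<in> weyl H" "v \<noteq> w" for v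
    proof (cases "coef ?X v = 0")
      case False
      then have "len v < len w"
        using intertwines_support[OF X less.prems v(1)] v(2) by (meson not_le)
      then show ?thesis using less.hyps[OF _ v(1)] by (simp add: \<Theta>_right)
    qed (simp add: sym_0 \<Theta>_0)
    have "0 = \<Theta> ?X" using intertwiner[OF X less.prems] tau_word_levi \<alpha>s(4) by metis
    also have "\<dots> = \<Theta> (\<Sum>v\<in>weyl H. tw H v * sym H (coef ?X v))" using coef_expand[of ?X] by simp
    also have "\<dots> = (\<Sum>v\<in>weyl H. \<Theta> (tw H v * sym H (coef ?X v)))" by (rule \<Theta>_sum)
    also have "\<dots> = \<Theta> (tw H w * sym H ?c)"
      using sum.remove[OF finite_weyl less.prems, of "\<lambda>v. \<Theta> (tw H v * sym H (coef ?X v))"] z by simp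
    finally have "\<Theta> (tw H w) * sym H (w0act ?c) = 0" by (simp add: \<Theta>_right)
    then show ?case using sym_right_cancel w0act_injective c by blast
  qed
  have "\<Theta> h = (\<Sum>v\<in>weyl H. \<Theta> (tw H v * sym H (coef h v)))"
    by (subst coef_expand[of h]) (rule \<Theta>_sum)
  also have "\<dots> = 0" by (rule sum.neutral) (simp add: \<Theta>_right tw)
  finally show ?thesis by (simp add: \<Theta>_def)
qed

end

section \<open>Rational coefficients\<close>

context graded_hecke_algebra
begin

text \<open>
  Invariance of the parameters under conjugation makes the choice of the simple root immaterial.
\<close>

definition root_param :: "'v \<Rightarrow> real" where
  "root_param \<gamma> = param H (SOME \<alpha>. \<alpha> \<in> simples H \<and> (\<exists>w\<in>weyl H. w \<alpha> = \<gamma>))"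

lemma root_param_simple:
  assumes \<alpha>: "\<alpha> \<in> simples H" and w: "w \<in> weyl H"
  shows "root_param (w \<alpha>) = param H \<alpha>"
proof -
  define \<beta> where "\<beta> = (SOME \<beta>. \<beta> \<in> simples H \<and> (\<exists>v\<in>weyl H. v \<beta> = w \<alpha>))"
  have "\<beta> \<in> simples H \<and> (\<exists>v\<in>weyl H. v \<beta> = w \<alpha>)" unfolding \<beta>_def by (rule someI_ex) (use assms in blast)
  then obtain v where v: "\<beta> \<in> simples H" "v \<in> weyl H" "v \<beta> = w \<alpha>" by blast
  then have "(inv w \<circ> v) \<beta> = \<alpha>" by (simp add: weyl_inv_apply w)
  then have "param H \<beta> = param H \<alpha>"
    using param_conjugate[OF v(1) \<alpha> weyl_comp[OF weyl_inv[OF w] v(2)]] by blast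
  then show ?thesis by (simp add: root_param_def \<beta>_def)
qed

lemma root_param_invariant:
  assumes w: "w \<in> weyl H" shows "root_param (w \<gamma>) = root_param \<gamma>"
proof -
  have "(\<exists>v\<in>weyl H. v \<alpha> = w \<gamma>) \<longleftrightarrow> (\<exists>v\<in>weyl H. v \<alpha> = \<gamma>)" for \<alpha>
  proof
    assume "\<exists>v\<in>weyl H. v \<alpha> = w \<gamma>"
    then obtain v where v: "v \<in> weyl H" "v \<alpha> = w \<gamma>" by blast
    then have "(inv w \<circ> v) \<alpha> = \<gamma>" by (simp add: weyl_inv_apply w)
    then show "\<exists>v\<in>weyl H. v \<alpha> = \<gamma>" using weyl_comp[OF weyl_inv[OF w] v(1)] by blast
  next
    assume "\<exists>v\<in>weyl H. v \<alpha> = \<gamma>"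
    then obtain v where v: "v \<in> weyl H" "v \<alpha> = \<gamma>" by blast
    then have "(w \<circ> v) \<alpha> = w \<gamma>" by simp
    then show "\<exists>v\<in>weyl H. v \<alpha> = w \<gamma>" using weyl_comp[OF w v(1)] by blast
  qed
  then show ?thesis by (simp add: root_param_def)
qed

definition den :: "'v \<Rightarrow> 'w polyfun" where
  "den \<gamma> = pconst (complex_of_real (root_param \<gamma>)) - lin H \<gamma>"

lemma den_simple: "\<alpha> \<in> simples H \<Longrightarrow> den \<alpha> = kap \<alpha> - lin H \<alpha>"
  using root_param_simple[OF _ weyl_id] by (simp add: den_def)

text \<open>
  A root is not a constant function: it takes the values \<open>0\<close> at the origin and \<open>2\<close> at its coroot.
\<close>

lemma den_nonzero:
  assumes "\<gamma> \<in> roots H" shows "den \<gamma> \<noteq> 0"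
proof
  assume "den \<gamma> = 0"
  then have "peval (den \<gamma>) \<xi> = 0" for \<xi> by (simp add: zero_polyfun.rep_eq)
  then have *: "root_param \<gamma> = pairing H \<gamma> \<xi>" for \<xi>
    by (simp add: den_def minus_polyfun.rep_eq pconst.rep_eq peval_lin)
  show False using *[of 0] *[of "coroot H \<gamma>"] pairing_root_coroot[OF assms] linear_0[OF pairing_linear(2)] by simp
qed

lemma wact_den: "w \<in> weyl H \<Longrightarrow> wact H w (den \<gamma>) = den (w \<gamma>)"
  by (simp add: den_def wact_zero_one wact_hom wact_lin root_param_invariant)

lemma pcnj_den: "pcnj (den \<gamma>) = den \<gamma>"
  by (simp add: den_def pcnj_diff pcnj_pconst pcnj_lin)

definition num_prod :: "('v \<Rightarrow> 'v) \<Rightarrow> 'w polyfun" where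
  "num_prod w = (\<Prod>\<gamma>\<in>inversions w. lin H \<gamma>)"

definition den_prod :: "('v \<Rightarrow> 'v) \<Rightarrow> 'w polyfun" where
  "den_prod w = (\<Prod>\<gamma>\<in>inversions w. den \<gamma>)"

lemma den_prod_nonzero: "den_prod w \<noteq> 0"
  unfolding den_prod_def using den_nonzero pos_root finite_inversions by (auto simp: inversions_def)

lemma pcnj_prods: "pcnj (num_prod w) = num_prod w" "pcnj (den_prod w) = den_prod w"
  by (simp_all add: num_prod_def den_prod_def pcnj_prod pcnj_lin pcnj_den)

lemma wact_w0M_prods:
  assumes M: "M \<subseteq> simples H"
  shows "u \<in> refl_group H (delta H ` M) \<Longrightarrow>
    wact H u (num_prod (w0M H M)) = num_prod (w0M H M) \<and> wact H u (den_prod (w0M H M)) = den_prod (w0M H M)"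
proof (induction rule: refl_group.induct)
  case one
  show ?case by (simp only: wact_id simp_thms)
next
  case (step \<beta> u)
  have \<beta>: "\<beta> \<in> simples H" using delta_image[OF M] step.hyps(1) by blast
  note s = refl_simple_weyl[OF \<beta>]
  have inj: "inj_on (root_refl H \<beta>) (inversions (w0M H M))"
    using bij_is_inj[OF weyl_bij[OF s]] by (rule inj_on_subset) simp
  note perm = refl_permutes_inversions_w0M[OF M step.hyps(1)]
  have "wact H (root_refl H \<beta>) (num_prod (w0M H M)) = (\<Prod>\<gamma>\<in>inversions (w0M H M). lin H (root_refl H \<beta> \<gamma>))"
    "wact H (root_refl H \<beta>) (den_prod (w0M H M)) = (\<Prod>\<gamma>\<in>inversions (w0M H M). den (root_refl H \<beta> \<gamma>))"
    by (simp_all add: num_prod_def den_prod_def wact_prod s wact_lin wact_den)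
  moreover have "(\<Prod>\<gamma>\<in>inversions (w0M H M). f (root_refl H \<beta> \<gamma>)) = (\<Prod>\<gamma>\<in>inversions (w0M H M). f \<gamma>)"
    for f :: "'v \<Rightarrow> 'w polyfun"
    using prod.reindex[OF inj, of f] unfolding perm by (simp add: o_def)
  ultimately have "wact H (root_refl H \<beta>) (num_prod (w0M H M)) = num_prod (w0M H M)"
    "wact H (root_refl H \<beta>) (den_prod (w0M H M)) = den_prod (w0M H M)"
    by (simp_all add: num_prod_def den_prod_def)
  then show ?case
    using step.IH wact_comp[OF s simple_group_weyl[OF delta_image[OF M] step.hyps(2)]] by metis
qed

end

context rational_hecke_algebra
begin

lemma emb_0: "emb H 0 = 0" using emb_add[of 0 0] by simp

lemma emb_sum: "emb H (\<Sum>i\<in>I. f i) = (\<Sum>i\<in>I. emb H (f i))"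
  by (induction I rule: infinite_finite_induct) (simp_all add: emb_0 emb_add)

lemma emb_diff: "emb H (g - h) = emb H g - emb H h"
  using emb_add[of "g - h" h] by (simp add: eq_diff_eq)

lemma rational_coefs:
  obtains f where "x = (\<Sum>w\<in>weyl H. emb H (tw H w) * rat H (f w))"
  using rational_basis[of x] by blast

lemma rational_coefs_unique:
  assumes "(\<Sum>w\<in>weyl H. emb H (tw H w) * rat H (f w)) = (\<Sum>w\<in>weyl H. emb H (tw H w) * rat H (g w))"
    and w: "w \<in> weyl H"
  shows "f w = g w"
proof -
  define r :: "(('v \<Rightarrow> 'v) \<Rightarrow> 'w polyfun fract) \<Rightarrow> ('v \<Rightarrow> 'v) \<Rightarrow> 'w polyfun fract"
    where "r f w = (if w \<in> weyl H then f w else 0)" for f w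
  define x where "x = (\<Sum>w\<in>weyl H. emb H (tw H w) * rat H (f w))"
  define Q where "Q f \<longleftrightarrow> (\<forall>w. w \<notin> weyl H \<longrightarrow> f w = 0) \<and> x = (\<Sum>w\<in>weyl H. emb H (tw H w) * rat H (f w))" for f
  have ex1: "\<exists>!f. Q f" unfolding Q_def by (rule rational_basis)
  have "Q (r f)" by (auto simp: Q_def r_def x_def intro: sum.cong)
  moreover have "Q (r g)" unfolding Q_def x_def assms(1) by (auto simp: r_def intro: sum.cong)
  ultimately have "r f = r g" using ex1 by blast
  from fun_cong[OF this, of w] show ?thesis using w by (simp add: r_def)
qed

lemma emb_expand: "emb H h = (\<Sum>w\<in>weyl H. emb H (tw H w) * rat H (Fract (coef h w) 1))"
  by (subst coef_expand[of h]) (simp add: emb_sum emb_mult emb_sym)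

lemma emb_inject: "emb H g = emb H h \<Longrightarrow> g = h"
proof (rule coef_eqI)
  fix w assume eq: "emb H g = emb H h" and w: "w \<in> weyl H"
  have "Fract (coef g w) 1 = Fract (coef h w) 1"
    by (rule rational_coefs_unique[of "\<lambda>w. Fract (coef g w) 1" "\<lambda>w. Fract (coef h w) 1" w,
          OF trans[OF emb_expand[symmetric] trans[OF eq emb_expand]] w])
  then show "coef g w = coef h w" by (simp add: eq_fract)
qed

lemma rat_inverse:
  assumes "a \<noteq> 0"
  shows "rat H (Fract a 1) * rat H (Fract 1 a) = 1" "rat H (Fract 1 a) * rat H (Fract a 1) = 1"
proof -
  have "Fract a 1 * Fract 1 a = 1" "Fract 1 a * Fract a 1 = 1" using assms by (simp_all add: One_fract_def eq_fract)
  then show "rat H (Fract a 1) * rat H (Fract 1 a) = 1" "rat H (Fract 1 a) * rat H (Fract a 1) = 1"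
    unfolding rat_mult[symmetric] by (simp_all only: rat_one)
qed

lemma R_simple_tau:
  assumes \<alpha>: "\<alpha> \<in> simples H"
  shows "R_simple H \<alpha> = emb H (tau \<alpha>) * rat H (Fract 1 (den \<alpha>))"
proof -
  have d: "den \<alpha> \<noteq> 0" using den_nonzero simple_root \<alpha> by blast
  have "emb H (tau \<alpha>) = emb H (tw H (root_refl H \<alpha>)) * rat H (Fract (lin H \<alpha>) 1) - rat H (Fract (kap \<alpha>) 1)"
    by (simp add: tau_def emb_diff emb_mult emb_sym)
  then have "emb H (tau \<alpha>) * rat H (Fract 1 (den \<alpha>))
      = emb H (tw H (root_refl H \<alpha>)) * rat H (Fract (lin H \<alpha>) 1 * Fract 1 (den \<alpha>)) - rat H (Fract (kap \<alpha>) 1 * Fract 1 (den \<alpha>))"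
    by (simp add: left_diff_distrib mult.assoc flip: rat_mult)
  then show ?thesis by (simp add: R_simple_def Let_def den_simple[OF \<alpha>, symmetric])
qed

text \<open>
  The relation for polynomials, multiplied by inverses on both sides.
\<close>

lemma intertwines_rat:
  assumes X: "intertwines w X" and w: "w \<in> weyl H" and p: "p \<noteq> 0"
  shows "rat H (Fract 1 p) * emb H X = emb H X * rat H (Fract 1 (wact H (inv w) p))"
proof -
  let ?p = "wact H (inv w) p"
  have p': "?p \<noteq> 0" using p wact_inv'[OF w, of p] wact_zero_one(1)[OF w] by auto
  have e: "rat H (Fract p 1) * emb H X = emb H X * rat H (Fract ?p 1)"
    using arg_cong[of _ _ "emb H", OF X[unfolded intertwines_def, rule_format, of p]] by (simp add: emb_mult emb_sym)
  have "rat H (Fract 1 p) * emb H X = rat H (Fract 1 p) * (emb H X * rat H (Fract ?p 1)) * rat H (Fract 1 ?p)"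
    by (simp add: mult.assoc rat_inverse[OF p'])
  also have "\<dots> = (rat H (Fract 1 p) * rat H (Fract p 1)) * emb H X * rat H (Fract 1 ?p)"
    unfolding e[symmetric] by (simp add: mult.assoc)
  finally show ?thesis by (simp add: rat_inverse[OF p])
qed

text \<open>
  Each factor is \<open>\<tau>\<^sub>\<alpha>/(k\<^sub>\<alpha> - \<alpha>)\<close>. Collecting the denominators on the right turns the one of a letter \<open>\<alpha>\<close>
  into \<open>k\<^sub>\<gamma> - \<gamma>\<close> with \<open>\<gamma> = w\<^sup>-\<^sup>1(\<alpha>)\<close>, \<open>w\<close> being the product of the later letters.
\<close>

lemma R_word:
  assumes "set \<alpha>s \<subseteq> simples H" "length \<alpha>s = len (refl_word H \<alpha>s)"
  shows "prod_list (map (R_simple H) \<alpha>s) = emb H (tau_word \<alpha>s) * rat H (Fract 1 (den_prod (refl_word H \<alpha>s)))"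
  using assms
proof (induction \<alpha>s)
  case Nil
  have "inversions id = {}" by (auto simp: inversions_def)
  then have "den_prod id = 1" unfolding den_prod_def by (simp only: prod.empty)
  then show ?case by (simp only: refl_word_Nil tau_word_Nil list.map prod_list.Nil emb_one One_fract_def[symmetric] rat_one mult_1_right)
next
  case (Cons \<alpha> \<alpha>s)
  let ?w = "refl_word H \<alpha>s"
  have \<alpha>: "\<alpha> \<in> simples H" and w: "?w \<in> weyl H" and sub: "set \<alpha>s \<subseteq> simples H" using Cons.prems word_weyl by auto
  note red = reduced_word_Cons[OF Cons.prems]
  have d: "den \<alpha> \<noteq> 0" using den_nonzero simple_root \<alpha> by blast
  have P: "den_prod (refl_word H (\<alpha> # \<alpha>s)) = den (inv ?w \<alpha>) * den_prod ?w"
    unfolding refl_word_Cons den_prod_def inversions_left_pos(1)[OF w \<alpha> red(2)]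
    using inversions_left_pos(2)[OF w \<alpha> red(2)] finite_inversions by simp
  have "prod_list (map (R_simple H) (\<alpha> # \<alpha>s))
      = emb H (tau \<alpha>) * (rat H (Fract 1 (den \<alpha>)) * emb H (tau_word \<alpha>s)) * rat H (Fract 1 (den_prod ?w))"
    by (simp add: Cons.IH[OF sub red(1)] R_simple_tau[OF \<alpha>] mult.assoc)
  also have "\<dots> = emb H (tau \<alpha>) * emb H (tau_word \<alpha>s) * (rat H (Fract 1 (den (inv ?w \<alpha>))) * rat H (Fract 1 (den_prod ?w)))"
    unfolding intertwines_rat[OF intertwines_tau_word[OF sub] w d] wact_den[OF weyl_inv[OF w]] by (simp add: mult.assoc)
  also have "\<dots> = emb H (tau_word (\<alpha> # \<alpha>s)) * rat H (Fract 1 (den_prod (refl_word H (\<alpha> # \<alpha>s))))"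
    unfolding P rat_mult[symmetric] tau_word_Cons emb_mult by simp
  finally show ?case .
qed

text \<open>
  All that has to be known about \<open>R\<^sub>w\<close>: a polynomial multiple \<open>h\<close> of it satisfies \<open>h P = \<tau> q\<close>, where \<open>P\<close> is the
  product of denominators and \<open>\<tau>\<close> the product of numerators along a reduced expression, and \<open>P\<close> can be
  cancelled.
\<close>

lemma R_elt_polynomial_multiple:
  assumes w: "w \<in> weyl H" and h: "R_elt H w * emb H (sym H q) = emb H h"
  shows "intertwines w h" "coef h w * den_prod w = q * num_prod w"
proof -
  obtain \<alpha>s where \<alpha>s: "set \<alpha>s \<subseteq> simples H" "refl_word H \<alpha>s = w" "length \<alpha>s = len w"
    "R_elt H w = prod_list (map (R_simple H) \<alpha>s)"
  proof -
    define \<alpha>s where "\<alpha>s = (SOME \<alpha>s. reduced_expression H w \<alpha>s)"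
    have "\<exists>\<alpha>s. reduced_expression H w \<alpha>s"
      using levi_reduced_word[OF order_refl, of w] w weyl_simple_group by (simp add: reduced_expression_iff)
    then have "reduced_expression H w \<alpha>s" unfolding \<alpha>s_def by (rule someI_ex)
    then show ?thesis using that[of \<alpha>s] by (simp add: reduced_expression_iff R_elt_def \<alpha>s_def)
  qed
  let ?P = "den_prod w" and ?T = "tau_word \<alpha>s"
  have R: "R_elt H w = emb H ?T * rat H (Fract 1 ?P)" using R_word[OF \<alpha>s(1)] \<alpha>s by simp
  have "emb H (h * sym H ?P) = R_elt H w * emb H (sym H q * sym H ?P)"
    by (simp only: emb_mult h[symmetric] mult.assoc)
  also have "\<dots> = emb H ?T * (rat H (Fract 1 ?P) * rat H (Fract ?P 1)) * emb H (sym H q)"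
    by (simp only: sym_comm[of q] emb_mult R mult.assoc) (simp only: emb_sym)
  also have "\<dots> = emb H (?T * sym H q)" by (simp add: rat_inverse[OF den_prod_nonzero] emb_mult)
  finally have hP: "h * sym H ?P = ?T * sym H q" by (rule emb_inject)
  have T: "intertwines w ?T" using intertwines_tau_word[OF \<alpha>s(1)] \<alpha>s(2) by simp
  show "intertwines w h" unfolding intertwines_def
  proof
    fix a
    have "sym H a * h * sym H ?P = sym H a * (?T * sym H q)" by (simp add: mult.assoc hP)
    also have "\<dots> = ?T * sym H q * sym H (wact H (inv w) a)"
      using intertwines_sym_right[OF T, of q] unfolding intertwines_def by blast
    also have "\<dots> = h * sym H (wact H (inv w) a) * sym H ?P" unfolding hP[symmetric] by (simp add: mult.assoc sym_comm)
    finally show "sym H a * h = h * sym H (wact H (inv w) a)" by (rule sym_right_cancel'[OF _ den_prod_nonzero])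
  qed
  have "coef h w * ?P = coef ?T w * q" using arg_cong[OF hP, of "\<lambda>h. coef h w"] by (simp add: coef_sym_right)
  then show "coef h w * ?P = q * num_prod w"
    using coef_tau_word[OF \<alpha>s(1)] \<alpha>s(2,3) by (simp add: num_prod_def mult.commute)
qed

text \<open>
  The products \<open>d u\<close> of minimal representatives and elements of \<open>W\<^sub>N\<close> run through \<open>W\<close> once each, so the
  decomposition defining \<open>\<epsilon>\<close> is the sorting of the basis expansion by cosets.
\<close>

lemma epsilon_eq:
  assumes N: "N \<subseteq> simples H" and x: "x = (\<Sum>w\<in>weyl H. emb H (tw H w) * rat H (f w))"
  shows "epsilon H N x = (\<Sum>u\<in>refl_group H N. emb H (tw H u) * rat H (f u))"
proof -
  define E where "E g = (\<Sum>u\<in>refl_group H N. emb H (tw H u) * rat H (g u))" for g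
  define D where "D m \<longleftrightarrow> (\<forall>w\<in>min_reps H N. m w \<in> rational_levi H N) \<and>
     x = (\<Sum>w\<in>min_reps H N. emb H (tw H w) * m w)" for m
  have reindex: "(\<Sum>w\<in>weyl H. F w) = (\<Sum>d\<in>min_reps H N. \<Sum>u\<in>refl_group H N. F (d \<circ> u))" for F :: "('v \<Rightarrow> 'v) \<Rightarrow> 'q"
    using sum.reindex_bij_betw[OF coset_decomposition_bij[OF N], of F]
    by (simp add: case_prod_beta sum.cartesian_product)
  have split: "(\<Sum>w\<in>weyl H. emb H (tw H w) * rat H (g w)) = (\<Sum>d\<in>min_reps H N. emb H (tw H d) * E (\<lambda>u. g (d \<circ> u)))" for g
    unfolding reindex E_def sum_distrib_left
    by (intro sum.cong refl)
      (simp add: tw_mult[OF min_repD(1)[OF N] simple_group_weyl[OF N]] emb_mult mult.assoc)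
  have "epsilon H N x = E f" unfolding epsilon_def
  proof (rule the_equality)
    have "D (\<lambda>d. E (\<lambda>u. f (d \<circ> u)))" unfolding D_def x split
      by (auto simp: E_def rational_levi_def)
    moreover have "E (\<lambda>u. f (id \<circ> u)) = E f" by (simp only: id_comp)
    ultimately show "\<exists>m. (\<forall>w\<in>min_reps H N. m w \<in> rational_levi H N) \<and>
        x = (\<Sum>w\<in>min_reps H N. emb H (tw H w) * m w) \<and> E f = m id"
      unfolding D_def by (intro exI[of _ "\<lambda>d. E (\<lambda>u. f (d \<circ> u))"]) simp
  next
    fix m1 assume "\<exists>m. (\<forall>w\<in>min_reps H N. m w \<in> rational_levi H N) \<and>
        x = (\<Sum>w\<in>min_reps H N. emb H (tw H w) * m w) \<and> m1 = m id"
    then obtain m where m: "\<forall>w\<in>min_reps H N. m w \<in> rational_levi H N"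
      "x = (\<Sum>w\<in>min_reps H N. emb H (tw H w) * m w)" "m1 = m id" by blast
    have "\<forall>d\<in>min_reps H N. \<exists>g. m d = E g" using m(1) unfolding rational_levi_def E_def by blast
    then obtain g where g: "\<And>d. d \<in> min_reps H N \<Longrightarrow> m d = E (g d)" by metis
    define dec where "dec = inv_into (min_reps H N \<times> refl_group H N) (\<lambda>(d, u). d \<circ> u)"
    \<comment> \<open>\<open>g'\<close> glues the coefficients of the \<open>m d\<close> to one function on \<open>W\<close>.\<close>
    define g' where "g' w = g (fst (dec w)) (snd (dec w))" for w
    have inj: "inj_on (\<lambda>(d, u). d \<circ> u) (min_reps H N \<times> refl_group H N)"
      using coset_decomposition_bij[OF N] unfolding bij_betw_def by (rule conjunct1)
    have g': "g' (d \<circ> u) = g d u" if "d \<in> min_reps H N" "u \<in> refl_group H N" for d u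
      using inv_into_f_f[OF inj, of "(d, u)"] that unfolding g'_def dec_def
      by (simp only: prod.case mem_Sigma_iff simp_thms fst_conv snd_conv)
    have "x = (\<Sum>d\<in>min_reps H N. emb H (tw H d) * E (\<lambda>u. g' (d \<circ> u)))"
      unfolding m(2) E_def by (intro sum.cong refl) (simp only: g[unfolded E_def] g' cong: sum.cong)
    then have eq: "(\<Sum>w\<in>weyl H. emb H (tw H w) * rat H (f w)) = (\<Sum>w\<in>weyl H. emb H (tw H w) * rat H (g' w))"
      unfolding split[of g'] x[symmetric] .
    have "f u = g id u" if u: "u \<in> refl_group H N" for u
      using rational_coefs_unique[OF eq simple_group_weyl[OF N u]] g'[OF id_min_rep[OF N] u] by (simp only: id_comp)
    then show "m1 = E f" unfolding m(3) g[OF id_min_rep[OF N]] by (simp add: E_def)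
  qed
  then show ?thesis by (simp add: E_def)
qed

lemma epsilon_polynomial_multiple:
  assumes N: "N \<subseteq> simples H" and g: "x * emb H (sym H q) = emb H g"
  shows "epsilon H N x * emb H (sym H q) = emb H (\<Sum>u\<in>refl_group H N. tw H u * sym H (coef g u))"
proof -
  obtain f where f: "x = (\<Sum>w\<in>weyl H. emb H (tw H w) * rat H (f w))" using rational_coefs .
  have "(\<Sum>w\<in>weyl H. emb H (tw H w) * rat H (f w * Fract q 1)) = (\<Sum>w\<in>weyl H. emb H (tw H w) * rat H (Fract (coef g w) 1))"
    using g unfolding f emb_expand[of g] emb_sym by (simp add: sum_distrib_right rat_mult mult.assoc)
  then have c: "f w * Fract q 1 = Fract (coef g w) 1" if "w \<in> weyl H" for w
    using rational_coefs_unique[of "\<lambda>w. f w * Fract q 1" "\<lambda>w. Fract (coef g w) 1" w] that by blast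
  have "epsilon H N x * emb H (sym H q) = (\<Sum>u\<in>refl_group H N. emb H (tw H u) * rat H (f u * Fract q 1))"
    unfolding epsilon_eq[OF N f] emb_sym by (simp add: sum_distrib_right rat_mult mult.assoc)
  also have "\<dots> = (\<Sum>u\<in>refl_group H N. emb H (tw H u) * rat H (Fract (coef g u) 1))"
    by (rule sum.cong) (simp_all add: c simple_group_weyl[OF N])
  finally show ?thesis by (simp add: emb_sum emb_mult emb_sym)
qed

text \<open>
  Two presentations \<open>h q\<^sup>-\<^sup>1\<close> and \<open>h' q'\<^sup>-\<^sup>1\<close> of \<open>x\<close> satisfy \<open>h q' = h' q\<close>, as polynomials commute; hence they define
  the same operator.
\<close>

lemma rational_extension_eq:
  assumes \<rho>: "\<And>a b. a \<in> A \<Longrightarrow> b \<in> A \<Longrightarrow> \<rho> (a * b) = \<rho> a \<circ> \<rho> b" and A: "\<And>a. sym H a \<in> A"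
    and h: "h \<in> A" "bij (\<rho> (sym H q))" "x * emb H (sym H q) = emb H h"
  shows "rational_extension H A \<rho> x \<circ> \<rho> (sym H q) = \<rho> h"
proof -
  define T where "T = \<rho> h \<circ> inv (\<rho> (sym H q))"
  have T: "T \<circ> \<rho> (sym H q) = \<rho> h" using h(2) by (simp add: T_def fun_eq_iff bij_is_inj)
  have "rational_extension H A \<rho> x = T" unfolding rational_extension_def
  proof (rule the_equality)
    show "\<exists>h\<in>A. \<exists>q. bij (\<rho> (sym H q)) \<and> x * emb H (sym H q) = emb H h \<and> T \<circ> \<rho> (sym H q) = \<rho> h"
      using h T by blast
  next
    fix T' assume "\<exists>h\<in>A. \<exists>q. bij (\<rho> (sym H q)) \<and> x * emb H (sym H q) = emb H h \<and> T' \<circ> \<rho> (sym H q) = \<rho> h"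
    then obtain h' q' where h': "h' \<in> A" "bij (\<rho> (sym H q'))" "x * emb H (sym H q') = emb H h'" "T' \<circ> \<rho> (sym H q') = \<rho> h'"
      by blast
    have "emb H (h * sym H q') = x * emb H (sym H q * sym H q')" by (simp add: emb_mult h(3)[symmetric] mult.assoc)
    also have "\<dots> = emb H (h' * sym H q)" by (simp add: sym_comm[of q] emb_mult h'(3)[symmetric] mult.assoc)
    finally have e: "h * sym H q' = h' * sym H q" by (rule emb_inject)
    have s: "\<rho> (sym H q) \<circ> \<rho> (sym H q') = \<rho> (sym H q') \<circ> \<rho> (sym H q)"
      using \<rho>[OF A A, of q q'] \<rho>[OF A A, of q' q] sym_comm[of q q'] by simp
    have "T' \<circ> (\<rho> (sym H q) \<circ> \<rho> (sym H q')) = (T' \<circ> \<rho> (sym H q')) \<circ> \<rho> (sym H q)" unfolding s by (simp only: comp_assoc)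
    also have "\<dots> = \<rho> (h' * sym H q)" unfolding h'(4) \<rho>[OF h'(1) A] ..
    also have "\<dots> = T \<circ> (\<rho> (sym H q) \<circ> \<rho> (sym H q'))" unfolding e[symmetric] \<rho>[OF h(1) A] T[symmetric] by (simp only: comp_assoc)
    finally have "T' \<circ> (\<rho> (sym H q) \<circ> \<rho> (sym H q')) = T \<circ> (\<rho> (sym H q) \<circ> \<rho> (sym H q'))" .
    moreover have "surj (\<rho> (sym H q) \<circ> \<rho> (sym H q'))" using h(2) h'(2) bij_comp bij_is_surj by blast
    ultimately show "T' = T" by (metis (no_types, lifting) ext o_apply surjD)
  qed
  then show ?thesis using T by simp
qed

end

section \<open>Forms on tensor products\<close>

lemma frag_induct [case_names zero one diff]:
  assumes "P 0" "\<And>p. P (frag_of p)" "\<And>a b. P a \<Longrightarrow> P b \<Longrightarrow> P (a - b)"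
  shows "P c"
  by (rule frag_induction[of c UNIV]) (use assms in auto)

definition frag_eval :: "('a \<Rightarrow> complex) \<Rightarrow> ('a \<Rightarrow>\<^sub>0 int) \<Rightarrow> complex" where
  "frag_eval f x = (\<Sum>k\<in>Poly_Mapping.keys x. of_int (Poly_Mapping.lookup x k) * f k)"

lemma frag_eval_of: "frag_eval f (frag_of p) = f p"
  by (simp add: frag_eval_def)

lemma frag_eval_0: "frag_eval f 0 = 0"
  by (simp add: frag_eval_def)

lemma frag_eval_superset:
  "finite K \<Longrightarrow> Poly_Mapping.keys x \<subseteq> K \<Longrightarrow> frag_eval f x = (\<Sum>k\<in>K. of_int (Poly_Mapping.lookup x k) * f k)"
  unfolding frag_eval_def by (rule sum.mono_neutral_left) (auto simp: in_keys_iff)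

lemma frag_eval_diff: "frag_eval f (x - y) = frag_eval f x - frag_eval f y"
proof -
  let ?K = "Poly_Mapping.keys x \<union> Poly_Mapping.keys y"
  have "Poly_Mapping.keys (x - y) \<subseteq> ?K" by (rule keys_diff)
  then have "frag_eval f (x - y) = (\<Sum>k\<in>?K. of_int (Poly_Mapping.lookup (x - y) k) * f k)"
    by (intro frag_eval_superset) auto
  also have "\<dots> = (\<Sum>k\<in>?K. of_int (Poly_Mapping.lookup x k) * f k) - (\<Sum>k\<in>?K. of_int (Poly_Mapping.lookup y k) * f k)"
    by (simp add: lookup_minus sum_subtractf[symmetric] left_diff_distrib)
  also have "\<dots> = frag_eval f x - frag_eval f y"
    by (intro arg_cong2[of _ _ _ _ "(-)"] frag_eval_superset[symmetric]) auto
  finally show ?thesis .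
qed

lemma frag_eval_zero_fun: "frag_eval (\<lambda>_. 0) x = 0"
  by (simp add: frag_eval_def)

lemma frag_eval_diff_fun: "frag_eval (\<lambda>p. f p - g p) x = frag_eval f x - frag_eval g x"
  by (simp add: frag_eval_def sum_subtractf right_diff_distrib)

text \<open>
  The biadditive extension of \<open>b\<close> to the free abelian group.
\<close>

definition frag_form :: "('a \<Rightarrow> 'a \<Rightarrow> complex) \<Rightarrow> ('a \<Rightarrow>\<^sub>0 int) \<Rightarrow> ('a \<Rightarrow>\<^sub>0 int) \<Rightarrow> complex" where
  "frag_form b x y = frag_eval (\<lambda>p. frag_eval (b p) y) x"

lemma frag_form_of: "frag_form b (frag_of p) (frag_of q) = b p q"
  by (simp add: frag_form_def frag_eval_of)

lemma frag_form_diff: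
  "frag_form b (x - x') y = frag_form b x y - frag_form b x' y"
  "frag_form b x (y - y') = frag_form b x y - frag_form b x y'"
  by (simp_all add: frag_form_def frag_eval_diff frag_eval_diff_fun)

lemma frag_form_add:
  "frag_form b (x + x') y = frag_form b x y + frag_form b x' y"
  "frag_form b x (y + y') = frag_form b x y + frag_form b x y'"
  using frag_form_diff(1)[of b "x + x'" x' y] frag_form_diff(2)[of b x "y + y'" y'] by (simp_all add: eq_diff_eq)

lemma frag_form_0: "frag_form b 0 y = 0" "frag_form b x 0 = 0"
  by (simp_all add: frag_form_def frag_eval_0 frag_eval_zero_fun)

lemma frag_form_hermitian:
  assumes "\<And>p q. b q p = cnj (b p q)"
  shows "frag_form b y x = cnj (frag_form b x y)"
proof (induction x rule: frag_induct)
  case (one p)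
  show ?case
    by (induction y rule: frag_induct) (simp_all add: frag_form_0 frag_form_of assms[of p] frag_form_diff)
qed (simp_all add: frag_form_0 frag_form_diff)

section \<open>Cosets of tensor relations\<close>

context
  fixes A :: "'h::ring_1 set" and \<rho> :: "'h \<Rightarrow> 'u::ab_group_add \<Rightarrow> 'u"
begin

lemma relations_minus: "x \<in> tensor_relations A \<rho> \<Longrightarrow> - x \<in> tensor_relations A \<rho>"
  using tensor_relations.diff[OF tensor_relations.zero] by fastforce

lemma relations_add: "x \<in> tensor_relations A \<rho> \<Longrightarrow> y \<in> tensor_relations A \<rho> \<Longrightarrow> x + y \<in> tensor_relations A \<rho>"
  using tensor_relations.diff[OF _ relations_minus] by fastforce

lemma tclass_self: "x \<in> tclass A \<rho> x"
  by (simp add: tclass_def tensor_relations.zero)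

lemma tclass_eq: "y - x \<in> tensor_relations A \<rho> \<Longrightarrow> tclass A \<rho> y = tclass A \<rho> x"
proof -
  assume r: "y - x \<in> tensor_relations A \<rho>"
  have "z - y \<in> tensor_relations A \<rho> \<longleftrightarrow> z - x \<in> tensor_relations A \<rho>" for z
    using relations_add[OF _ r, of "z - y"] tensor_relations.diff[OF _ r, of "z - x"] by auto
  then show ?thesis by (simp add: tclass_def)
qed

text \<open>
  The union in the definition of the sum runs over cosets that all coincide.
\<close>

lemma induced_add_tclass: "induced_add A \<rho> (tclass A \<rho> x) (tclass A \<rho> y) = tclass A \<rho> (x + y)"
proof -
  have "tclass A \<rho> (x' + y') = tclass A \<rho> (x + y)" if "x' \<in> tclass A \<rho> x" "y' \<in> tclass A \<rho> y" for x' y'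
  proof (rule tclass_eq)
    have "(x' + y') - (x + y) = (x' - x) + (y' - y)" by simp
    moreover have "(x' - x) + (y' - y) \<in> tensor_relations A \<rho>"
      using that by (intro relations_add) (simp_all add: tclass_def)
    ultimately show "(x' + y') - (x + y) \<in> tensor_relations A \<rho>" by (simp only:)
  qed
  then show ?thesis using tclass_self unfolding induced_add_def by blast
qed

abbreviation "lmult h \<equiv> frag_extend (\<lambda>(g, u). frag_of (h * g, u :: 'u))"

lemma relations_lmult: "x \<in> tensor_relations A \<rho> \<Longrightarrow> lmult h x \<in> tensor_relations A \<rho>"
proof (induction rule: tensor_relations.induct)
  case (add_left g k u)
  then show ?case using tensor_relations.add_left[of "h * g" "h * k" u A \<rho>] by (simp add: frag_extend_diff distrib_left)
next
  case (add_right k u v)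
  then show ?case using tensor_relations.add_right[of "h * k" u v A \<rho>] by (simp add: frag_extend_diff)
next
  case (balanced a k u)
  then show ?case using tensor_relations.balanced[of a A "h * k" u \<rho>] by (simp add: frag_extend_diff mult.assoc)
qed (auto simp: frag_extend_diff intro: tensor_relations.zero tensor_relations.diff)

lemma induced_act_tclass: "induced_act A \<rho> h (tclass A \<rho> x) = tclass A \<rho> (lmult h x)"
proof -
  have "tclass A \<rho> (lmult h x') = tclass A \<rho> (lmult h x)" if "x' \<in> tclass A \<rho> x" for x'
    using relations_lmult[of "x' - x" h] that by (intro tclass_eq) (simp add: tclass_def frag_extend_diff)
  then show ?thesis using tclass_self unfolding induced_act_def by blast
qed

lemma frag_form_relations:
  assumes "\<And>p g h u. b p (g + h, u) = b p (g, u) + b p (h, u)"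
    "\<And>p h u v. b p (h, u + v) = b p (h, u) + b p (h, v)"
    "\<And>p h a u. a \<in> A \<Longrightarrow> b p (h * a, u) = b p (h, \<rho> a u)"
    and x: "x \<in> tensor_relations A \<rho>"
  shows "frag_form b y x = 0"
proof -
  have "frag_eval (b p) x = 0" for p
    using x by (induction rule: tensor_relations.induct)
      (simp_all add: frag_eval_diff frag_eval_of frag_eval_0 assms(1-3))
  then show ?thesis by (simp add: frag_form_def frag_eval_zero_fun)
qed

end

section \<open>The hermitian form\<close>

locale hermitian_data =
  rational_hecke_algebra H + hecke_transfer H star M \<phi>
  for H :: "('v::real_vector, 'w::real_vector, 'h::ring_1, 'q::ring_1, 'z) rational_hecke_scheme" (structure)
    and star M \<phi> +
  fixes sc :: "complex \<Rightarrow> 'u::ab_group_add \<Rightarrow> 'u" and \<sigma> :: "'h \<Rightarrow> 'u \<Rightarrow> 'u" and form :: "'u \<Rightarrow> 'u \<Rightarrow> complex"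
  assumes rep: "representation H (levi H M) sc \<sigma>"
    and herm: "hermitian_form UNIV (+) sc form"
    and invar: "invariant_form (levi H M) star UNIV \<sigma> form"
    and regular: "regular_on H (transfer_rep H M \<phi> \<sigma>) (R_elt H w0)"
begin

abbreviation "a\<sigma> \<equiv> transfer_rep H M \<phi> \<sigma>"

lemma form_add: "form (x + y) z = form x z + form y z" "form z (x + y) = form z x + form z y"
  and form_sc: "form (sc c x) y = c * form x y" "form x (sc c y) = cnj c * form x y"
  and form_cnj: "form y x = cnj (form x y)"
  using herm unfolding hermitian_form_def sesquilinear_form_def by blast+

lemma \<sigma>_1: "\<sigma> 1 = id"
  and \<sigma>_hscale: "a \<in> levi H M \<Longrightarrow> \<sigma> (hscale H c a) = (\<lambda>u. sc c (\<sigma> a u))"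
  and \<sigma>_plus: "a \<in> levi H M \<Longrightarrow> b \<in> levi H M \<Longrightarrow> \<sigma> (a + b) = (\<lambda>u. \<sigma> a u + \<sigma> b u)"
  and \<sigma>_mult: "a \<in> levi H M \<Longrightarrow> b \<in> levi H M \<Longrightarrow> \<sigma> (a * b) = \<sigma> a \<circ> \<sigma> b"
  using rep unfolding representation_def by blast+

lemma \<sigma>_adjoint: "a \<in> levi H M \<Longrightarrow> form (\<sigma> a x) y = form x (\<sigma> (star a) y)"
  using invar unfolding invariant_form_def by blast

lemma a\<sigma>_\<phi>: "m \<in> levi H M \<Longrightarrow> a\<sigma> (\<phi> m) = \<sigma> m"
  using inv_into_f_f[of \<phi> "levi H M" m] \<phi>_bij by (simp add: transfer_rep_def bij_betw_def fun_eq_iff)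

lemma levi_N_cases:
  assumes "n \<in> levi H N"
  obtains m where "m \<in> levi H M" "n = \<phi> m"
  using assms \<phi>_bij unfolding bij_betw_def by blast

lemma a\<sigma>_mult: "a \<in> levi H N \<Longrightarrow> b \<in> levi H N \<Longrightarrow> a\<sigma> (a * b) = a\<sigma> a \<circ> a\<sigma> b"
proof -
  assume "a \<in> levi H N" "b \<in> levi H N"
  then obtain m n where m: "m \<in> levi H M" "a = \<phi> m" "n \<in> levi H M" "b = \<phi> n" by (meson levi_N_cases)
  have "a * b = \<phi> (m * n)" using m by (simp add: \<phi>_mult)
  then show ?thesis using m a\<sigma>_\<phi> levi_mult \<sigma>_mult by metis
qed

lemma a\<sigma>_plus: "a \<in> levi H N \<Longrightarrow> b \<in> levi H N \<Longrightarrow> a\<sigma> (a + b) x = a\<sigma> a x + a\<sigma> b x"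
proof -
  assume "a \<in> levi H N" "b \<in> levi H N"
  then obtain m n where m: "m \<in> levi H M" "a = \<phi> m" "n \<in> levi H M" "b = \<phi> n" by (meson levi_N_cases)
  have "a + b = \<phi> (m + n)" using m by (simp add: \<phi>_add)
  then show ?thesis using m(1,3) unfolding m(2,4) by (simp add: a\<sigma>_\<phi> levi_add \<sigma>_plus)
qed

lemma a\<sigma>_adjoint: "a \<in> levi H N \<Longrightarrow> form (a\<sigma> a x) y = form x (a\<sigma> (star a) y)"
proof -
  assume "a \<in> levi H N"
  then obtain m where m: "m \<in> levi H M" "a = \<phi> m" using levi_N_cases by blast
  then have "a\<sigma> (star a) = \<sigma> (star m)" using a\<sigma>_\<phi>[OF star_levi[OF M m(1)]] \<phi>_star by metis
  then show ?thesis using m a\<sigma>_\<phi> \<sigma>_adjoint by simp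
qed

text \<open>
  The operator \<open>a\<sigma>[\<epsilon>(t\<^bsub>(w\<^sup>0)\<^sup>-\<^sup>1\<^esub> h R\<^sup>0)]\<close> that enters the form with \<open>h = h\<^sub>2\<^sup>\<bullet> h\<^sub>1\<close>.
\<close>

definition T :: "'h \<Rightarrow> 'u \<Rightarrow> 'u" where
  "T h = rational_extension H (levi H N) a\<sigma> (epsilon H N (emb H (tw H (inv w0) * h) * R_elt H w0))"

lemma T_polynomial:
  assumes q: "bij (a\<sigma> (sym H q))" and h0: "R_elt H w0 * emb H (sym H q) = emb H h0"
  shows "T h (a\<sigma> (sym H q) x) = a\<sigma> (top_part (h * h0)) x"
proof -
  let ?x = "emb H (tw H (inv w0) * h) * R_elt H w0" and ?g = "tw H (inv w0) * (h * h0)"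
  have "?x * emb H (sym H q) = emb H ?g" by (simp add: mult.assoc h0 emb_mult)
  then have "epsilon H N ?x * emb H (sym H q) = emb H (\<Sum>u\<in>refl_group H N. tw H u * sym H (coef ?g u))"
    by (rule epsilon_polynomial_multiple[OF N])
  also have "(\<Sum>u\<in>refl_group H N. tw H u * sym H (coef ?g u)) = top_part (h * h0)"
    unfolding top_part_def
    by (rule sum.cong[OF refl])
      (simp only: coef_tw_left[OF iw0 simple_group_weyl[OF N]] inv_inv_eq[OF weyl_bij[OF w0]])
  finally have "epsilon H N ?x * emb H (sym H q) = emb H (top_part (h * h0))" .
  from rational_extension_eq[OF a\<sigma>_mult levi_sym top_part_levi q this]
  show ?thesis unfolding T_def by (metis o_apply)
qed

lemma regular_polynomial:
  obtains q h0 where "bij (a\<sigma> (sym H q))" "\<And>h x. T h (a\<sigma> (sym H q) x) = a\<sigma> (top_part (h * h0)) x"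
    "\<And>h. sym H (pcnj q) * top_part (h * h0) = star (top_part (star h * h0)) * sym H q"
proof -
  obtain q h0 where q: "bij (a\<sigma> (sym H q))" "R_elt H w0 * emb H (sym H q) = emb H h0"
    using regular unfolding regular_on_def by blast
  note R = R_elt_polynomial_multiple[OF w0 q(2)]
  have "sym H (pcnj q) * top_part (h * h0) = star (top_part (star h * h0)) * sym H q" for h
    by (rule top_part_symmetry[OF R(1) den_prod_nonzero R(2) pcnj_prods(2,1)]) (use wact_w0M_prods[OF M] in blast)+
  then show ?thesis using that q(1) T_polynomial[OF q] by blast
qed

text \<open>
  On vectors in the image of the invertible operator \<open>a\<sigma>(q)\<close> this is the identity
  \<open>q\<^sup>\<bullet> E(h h\<^sub>0) = E(h\<^sup>\<bullet> h\<^sub>0)\<^sup>\<bullet> q\<close> applied to the invariant form on \<open>\<sigma>\<close>.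
\<close>

lemma T_adjoint: "form (T h x) y = form x (T (star h) y)"
proof -
  obtain q h0 where q: "bij (a\<sigma> (sym H q))" "\<And>h x. T h (a\<sigma> (sym H q) x) = a\<sigma> (top_part (h * h0)) x"
    "\<And>h. sym H (pcnj q) * top_part (h * h0) = star (top_part (star h * h0)) * sym H q"
    using regular_polynomial by blast
  obtain x' y' where xy: "x = a\<sigma> (sym H q) x'" "y = a\<sigma> (sym H q) y'" using bij_is_surj[OF q(1)] by (metis surjD)
  let ?a = "top_part (h * h0)" and ?b = "top_part (star h * h0)"
  have "form (a\<sigma> (sym H (pcnj q) * ?a) x') y' = form (a\<sigma> (star ?b * sym H q) x') y'" unfolding q(3) ..
  then have "form (a\<sigma> (sym H (pcnj q)) (a\<sigma> ?a x')) y' = form (a\<sigma> (star ?b) (a\<sigma> (sym H q) x')) y'"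
    by (simp add: a\<sigma>_mult levi_sym top_part_levi star_levi[OF N])
  then have "form (a\<sigma> ?a x') (a\<sigma> (sym H q) y') = form (a\<sigma> (sym H q) x') (a\<sigma> ?b y')"
    by (simp add: a\<sigma>_adjoint levi_sym top_part_levi star_levi[OF N] star_sym pcnj_pcnj star_star)
  then show ?thesis unfolding xy q(2) .
qed

lemma T_plus: "T (g + h) x = T g x + T h x"
  and T_levi: "m \<in> levi H M \<Longrightarrow> T (m * h) x = \<sigma> m (T h x)"
proof -
  obtain q h0 where q: "bij (a\<sigma> (sym H q))" "\<And>h x. T h (a\<sigma> (sym H q) x) = a\<sigma> (top_part (h * h0)) x"
    using regular_polynomial by metis
  obtain x' where x: "x = a\<sigma> (sym H q) x'" using bij_is_surj[OF q(1)] by (metis surjD)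
  show "T (g + h) x = T g x + T h x"
    unfolding x q(2) by (simp add: distrib_right top_part_add a\<sigma>_plus top_part_levi)
  show "m \<in> levi H M \<Longrightarrow> T (m * h) x = \<sigma> m (T h x)"
    unfolding x q(2) by (simp add: mult.assoc top_part_levi_left a\<sigma>_mult \<phi>_levi top_part_levi a\<sigma>_\<phi>)
qed

definition b :: "'h \<times> 'u \<Rightarrow> 'h \<times> 'u \<Rightarrow> complex" where
  "b p q = form (T (star (fst q) * fst p) (snd p)) (snd q)"

lemma b_eq: "b (g, u) (h, v) = form (T (star h * g) u) v"
  by (simp add: b_def)

lemma b_hermitian: "b q p = cnj (b p q)"
  unfolding b_def T_adjoint[of "star (fst p) * fst q"] by (simp add: star_mult star_star) (rule form_cnj)

text \<open>
  The tensor relations in the second variable; the last one comes from \<open>E(m h) = \<phi>(m) E(h)\<close>.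
\<close>

lemma b_right:
  "b p (g + h, u) = b p (g, u) + b p (h, u)"
  "b p (h, u + v) = b p (h, u) + b p (h, v)"
  "a \<in> levi H M \<Longrightarrow> b p (h * a, u) = b p (h, \<sigma> a u)"
  by (simp_all add: b_def star_add distrib_right T_plus form_add star_mult mult.assoc T_levi star_levi[OF M] \<sigma>_adjoint star_star)

lemma b_act: "b (a * g, u) (h, v) = b (g, u) (star a * h, v)"
  by (simp add: b_eq star_mult star_star mult.assoc)

lemma b_scale: "b (hscale H c 1 * g, u) p = c * b (g, u) p"
proof -
  have "star (fst p) * (hscale H c 1 * g) = sym H (pconst c) * (star (fst p) * g)"
    unfolding hscale_def mult_1_right pconst_central[of c g] pconst_central[of c "star (fst p) * g"]
    by (simp only: mult.assoc)
  then have "T (star (fst p) * (hscale H c 1 * g)) u = \<sigma> (hscale H c 1) (T (star (fst p) * g) u)"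
    using T_levi[OF levi_sym, of "pconst c"] by (simp add: hscale_def)
  then show ?thesis by (simp add: b_def \<sigma>_hscale levi_1 \<sigma>_1 form_sc)
qed

abbreviation "cls \<equiv> tclass (levi H M) \<sigma>"

text \<open>
  Hermitian symmetry carries the relations over to the first variable.
\<close>

lemma form_relations:
  assumes "x' - x \<in> tensor_relations (levi H M) \<sigma>" "y' - y \<in> tensor_relations (levi H M) \<sigma>"
  shows "frag_form b x' y' = frag_form b x y"
proof -
  have z: "frag_form b y x = 0" if "x \<in> tensor_relations (levi H M) \<sigma>" for x y
    by (rule frag_form_relations[OF b_right that])
  have z': "frag_form b x y = 0" if "x \<in> tensor_relations (levi H M) \<sigma>" for x y
    using z[OF that, of y] frag_form_hermitian[of b x y, OF b_hermitian] by simp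
  have "frag_form b x' y' = frag_form b x y'" using z'[OF assms(1), of y'] by (simp add: frag_form_diff)
  also have "\<dots> = frag_form b x y" using z[OF assms(2), of x] by (simp add: frag_form_diff)
  finally show ?thesis .
qed

lemma frag_form_lmult: "frag_form b (lmult a x) y = frag_form b x (lmult (star a) y)"
proof (induction x rule: frag_induct)
  case (one p)
  show ?case
    by (induction y rule: frag_induct)
      (auto simp: frag_form_0 frag_form_of frag_form_diff frag_extend_diff b_act split: prod.split)
qed (simp_all add: frag_form_0 frag_form_diff frag_extend_diff)

lemma frag_form_scale: "frag_form b (lmult (hscale H c 1) x) y = c * frag_form b x y"
proof (induction x rule: frag_induct)
  case (one p)
  show ?case
    by (induction y rule: frag_induct)
      (auto simp: frag_form_0 frag_form_of frag_form_diff right_diff_distrib b_scale split: prod.split)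
qed (simp_all add: frag_form_0 frag_form_diff frag_extend_diff right_diff_distrib)

lemma frag_form_scale_right: "frag_form b x (lmult (hscale H c 1) y) = cnj c * frag_form b x y"
  using frag_form_scale[of c y x] frag_form_hermitian[of b, OF b_hermitian] by (metis complex_cnj_mult)

text \<open>
  Sesquilinearity and the values on pure tensors determine the form, as pure tensors generate.
\<close>

lemma induced_form_iff:
  "induced_form H star M \<phi> \<sigma> form B \<longleftrightarrow> (\<forall>x y. B (cls x) (cls y) = frag_form b x y)"
proof
  assume ind: "induced_form H star M \<phi> \<sigma> form B"
  then have add: "B (cls (x + y)) (cls z) = B (cls x) (cls z) + B (cls y) (cls z)"
      "B (cls z) (cls (x + y)) = B (cls z) (cls x) + B (cls z) (cls y)" for x y z
    unfolding induced_form_def sesquilinear_form_def induced_space_def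
    by (simp_all add: induced_add_tclass[symmetric])
  have diff: "B (cls (x - y)) (cls z) = B (cls x) (cls z) - B (cls y) (cls z)"
    "B (cls z) (cls (x - y)) = B (cls z) (cls x) - B (cls z) (cls y)" for x y z
    using add(1)[of "x - y" y z] add(2)[of z "x - y" y] by simp_all
  have zero: "B (cls 0) (cls z) = 0" "B (cls z) (cls 0) = 0" for z
    using diff(1)[of 0 0 z] diff(2)[of z 0 0] by simp_all
  have gen: "B (cls (frag_of p)) (cls (frag_of r)) = b p r" for p r
  proof (cases p, cases r)
    fix g u h v assume "p = (g, u)" "r = (h, v)"
    then show ?thesis using ind unfolding induced_form_def tens_def by (simp add: b_eq T_def mult.assoc)
  qed
  have "B (cls x) (cls y) = frag_form b x y" for x y
  proof (induction x rule: frag_induct)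
    case (one p)
    show ?case by (induction y rule: frag_induct) (simp_all add: zero diff gen frag_form_0 frag_form_of frag_form_diff)
  qed (simp_all add: zero diff frag_form_0 frag_form_diff)
  then show "\<forall>x y. B (cls x) (cls y) = frag_form b x y" by blast
next
  assume "\<forall>x y. B (cls x) (cls y) = frag_form b x y"
  then show "induced_form H star M \<phi> \<sigma> form B"
    unfolding induced_form_def sesquilinear_form_def induced_space_def tens_def induced_scale_def
    by (auto simp: induced_add_tclass induced_act_tclass frag_form_add frag_form_scale frag_form_scale_right
        frag_form_of b_eq T_def mult.assoc)
qed

lemma induced_form_exists: "\<exists>B. induced_form H star M \<phi> \<sigma> form B"
proof
  \<comment> \<open>Any representatives will do, by \<open>form_relations\<close>.\<close>
  let ?B = "\<lambda>X Y. frag_form b (SOME x. x \<in> X) (SOME y. y \<in> Y)"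
  have r: "(SOME y. y \<in> cls x) - x \<in> tensor_relations (levi H M) \<sigma>" for x
    using someI[of "\<lambda>y. y \<in> cls x" x] tclass_self[of x "levi H M" \<sigma>] by (simp add: tclass_def)
  show "induced_form H star M \<phi> \<sigma> form ?B"
    unfolding induced_form_iff using form_relations[OF r r] by blast
qed

lemma induced_form_hermitian_invariant:
  assumes "induced_form H star M \<phi> \<sigma> form B"
  shows "hermitian_form (induced_space (levi H M) \<sigma>) (induced_add (levi H M) \<sigma>) (induced_scale H (levi H M) \<sigma>) B"
    and "invariant_form UNIV star (induced_space (levi H M) \<sigma>) (induced_act (levi H M) \<sigma>) B"
proof -
  have B: "B (cls x) (cls y) = frag_form b x y" for x y using assms induced_form_iff by blast
  have "sesquilinear_form (induced_space (levi H M) \<sigma>) (induced_add (levi H M) \<sigma>) (induced_scale H (levi H M) \<sigma>) B"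
    using assms by (simp add: induced_form_def)
  moreover have "B Y X = cnj (B X Y)" if "X \<in> range cls" "Y \<in> range cls" for X Y
    using that by (elim rangeE) (simp only: B frag_form_hermitian[of b, OF b_hermitian, symmetric])
  ultimately show "hermitian_form (induced_space (levi H M) \<sigma>) (induced_add (levi H M) \<sigma>) (induced_scale H (levi H M) \<sigma>) B"
    unfolding hermitian_form_def induced_space_def by blast
  show "invariant_form UNIV star (induced_space (levi H M) \<sigma>) (induced_act (levi H M) \<sigma>) B"
    unfolding invariant_form_def induced_space_def by (auto simp: B induced_act_tclass frag_form_lmult)
qed

end

theorem theorem3p9p2:
  fixes H :: "('v::real_vector, 'w::real_vector, 'h::ring_1, 'q::ring_1) rational_hecke"
    and star :: "'h \<Rightarrow> 'h"
    and M :: "'v set"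
    and sc :: "complex \<Rightarrow> 'u::ab_group_add \<Rightarrow> 'u"
    and \<sigma> \<sigma>\<^sub>0 :: "'h \<Rightarrow> 'u \<Rightarrow> 'u"
    and \<nu> :: "'w \<times> 'w"
    and form :: "'u \<Rightarrow> 'u \<Rightarrow> complex"
    and \<phi> :: "'h \<Rightarrow> 'h"
  assumes "rational_hecke_algebra H"
    and "hecke_star H star"
    and "M \<subseteq> simples H"
    and "vector_space sc" and "\<exists>E. finite E \<and> module.span sc E = UNIV"
    and "representation H (levi0 H M) sc \<sigma>\<^sub>0"
    and "\<nu> \<in> levi_V_dual_perp H M \<times> levi_V_dual_perp H M"
    and "representation H (levi H M) sc \<sigma>"
    and "twisted_by H M sc \<sigma>\<^sub>0 \<nu> \<sigma>"
    and "hermitian_form UNIV (+) sc form"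
    and "invariant_form (levi H M) star UNIV \<sigma> form"
    and "levi_transfer H M \<phi>"
    and "regular_on H (transfer_rep H M \<phi> \<sigma>) (R_elt H (w0M H M))"
  shows "(\<exists>B. induced_form H star M \<phi> \<sigma> form B) \<and>
    (\<forall>B. induced_form H star M \<phi> \<sigma> form B \<longrightarrow>
       hermitian_form (induced_space (levi H M) \<sigma>) (induced_add (levi H M) \<sigma>)
         (induced_scale H (levi H M) \<sigma>) B \<and>
       invariant_form UNIV star (induced_space (levi H M) \<sigma>) (induced_act (levi H M) \<sigma>) B)"
proof -
  interpret rational_hecke_algebra H by (rule assms(1))
  interpret hermitian_data H star M \<phi> sc \<sigma> form
    by unfold_locales (fact assms)+
  show ?thesis using induced_form_exists induced_form_hermitian_invariant by blast
qed

end
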